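(* Let $K$ be a field, let $k\ge 2$ be an integer, and let $a,d\in\mathbb{N}^2$ be linearly independent over $\mathbb{Q}$ such that $\{a,a+d,\ldots,a+kd\}$ is a minimal generating set of $S_{a,d,k}=\langle a,a+d,\ldots,a+kd\rangle$. Let $b\in\mathbb{N}^2$ with $b\notin S_{a,d,k}$, and suppose that for some integer $\mu>0$ we have $\mu b\in S_{a,d,k}$ and $\mu b=\sum_{i=1}^{k+1}\lambda_i(a+(i-1)d)$ with $\lambda_i\in\mathbb{N}$ such that $\lambda_1$ or $\lambda_{k+1}$ is non-zero. Let $S_{a,d,k}^b=\langle a,a+d,\ldots,a+kd,b\rangle$. Then $K[S_{a,d,k}^b]$ is Cohen-Macaulay with Cohen-Macaulay type $k-1$. In particular, $K[S_{a,d,k}^b]$ is Gorenstein if and only if $k=2$.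
   Context: $\mathbb{N}$ denotes the set of non-negative integers. $\langle a_1,\ldots,a_n\rangle=\{\sum_i\lambda_i a_i\mid \lambda_i\in\mathbb{N}\}$ is the affine semigroup generated by $a_1,\ldots,a_n\in\mathbb{N}^r$. $K[S]=\bigoplus_{s\in S}K\mathbf{t}^s\subseteq K[t_1,\ldots,t_r]$ is the semigroup ring of $S$; its Cohen-Macaulay type is the type at its unique monomial maximal ideal $\langle\mathbf{t}^s\mid s\in S\setminus\{0\}\rangle$. *)

theory Defs
  imports
    "HOL-Algebra.Algebra"
    "HOL-Library.Poly_Mapping"
    "HOL-Library.Product_Plus"
    "HOL-Library.Extended_Nat"
    "Jordan_Normal_Form.Missing_VectorSpace"
begin

section \<open>Affine semigroups in the plane\<close>

definition nscale :: "nat \<Rightarrow> nat \<times> nat \<Rightarrow> nat \<times> nat" where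
  "nscale n v = (n * fst v, n * snd v)"

text \<open>Meant for finite \<open>A\<close> only: sums over infinite sets are 0 by convention.\<close>

definition affine_semigroup :: "(nat \<times> nat) set \<Rightarrow> (nat \<times> nat) set" where
  "affine_semigroup A = {(\<Sum>v\<in>A. nscale (l v) v) | l. True}"

definition minimal_generating_set :: "(nat \<times> nat) set \<Rightarrow> (nat \<times> nat) set \<Rightarrow> bool" where
  "minimal_generating_set A S \<longleftrightarrow>
     affine_semigroup A = S \<and> (\<forall>B. B \<subset> A \<longrightarrow> affine_semigroup B \<noteq> S)"

text \<open>Independence of the pair \<open>(a, d)\<close> as a family, so that \<open>a = d\<close> counts as dependent.\<close>

definition lin_indep_rat :: "nat \<times> nat \<Rightarrow> nat \<times> nat \<Rightarrow> bool" where
  "lin_indep_rat a d \<longleftrightarrow>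
     (\<forall>p q :: rat. p * of_nat (fst a) + q * of_nat (fst d) = 0 \<and>
                   p * of_nat (snd a) + q * of_nat (snd d) = 0 \<longrightarrow> p = 0 \<and> q = 0)"

definition arith_gens :: "nat \<times> nat \<Rightarrow> nat \<times> nat \<Rightarrow> nat \<Rightarrow> (nat \<times> nat) set" where
  "arith_gens a d k = (\<lambda>i. a + nscale i d) ` {0..k}"

definition S_adk :: "nat \<times> nat \<Rightarrow> nat \<times> nat \<Rightarrow> nat \<Rightarrow> (nat \<times> nat) set" where
  "S_adk a d k = affine_semigroup (arith_gens a d k)"

definition S_adkb :: "nat \<times> nat \<Rightarrow> nat \<times> nat \<Rightarrow> nat \<Rightarrow> nat \<times> nat \<Rightarrow> (nat \<times> nat) set" where
  "S_adkb a d k b = affine_semigroup (insert b (arith_gens a d k))"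


section \<open>Semigroup rings\<close>

text \<open>
  The type \<open>(nat \<times> nat) \<Rightarrow>\<^sub>0 'k\<close> with its convolution product is the polynomial ring
  in two variables over \<open>'k\<close>; \<open>Poly_Mapping.single s 1\<close> is the monomial with exponent \<open>s\<close>.
\<close>

definition semigroup_ring :: "(nat \<times> nat) set \<Rightarrow> ((nat \<times> nat) \<Rightarrow>\<^sub>0 'k::field) ring" where
  "semigroup_ring S =
     \<lparr>partial_object.carrier = {p. Poly_Mapping.keys p \<subseteq> S}, monoid.mult = (*), monoid.one = 1, ring.zero = 0, ring.add = (+)\<rparr>"

definition monomial_max_ideal :: "(nat \<times> nat) set \<Rightarrow> ((nat \<times> nat) \<Rightarrow>\<^sub>0 'k::field) set" where
  "monomial_max_ideal S =
     Idl\<^bsub>semigroup_ring S\<^esub> ((\<lambda>s. Poly_Mapping.single s 1) ` (S - {0}))"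


section \<open>Localization at a prime ideal\<close>

text \<open>
  The factor \<open>u\<close> is what makes this an equivalence relation when \<open>R\<close> has zero divisors.
\<close>

definition loc_rel :: "('a, 'b) ring_scheme \<Rightarrow> 'a set \<Rightarrow> (('a \<times> 'a) \<times> ('a \<times> 'a)) set" where
  "loc_rel R P =
     {((r, s), (r', s')). r \<in> carrier R \<and> r' \<in> carrier R \<and>
        s \<in> carrier R - P \<and> s' \<in> carrier R - P \<and>
        (\<exists>u\<in>carrier R - P. u \<otimes>\<^bsub>R\<^esub> ((r \<otimes>\<^bsub>R\<^esub> s') \<ominus>\<^bsub>R\<^esub> (r' \<otimes>\<^bsub>R\<^esub> s)) = \<zero>\<^bsub>R\<^esub>)}"

definition loc_frac :: "('a, 'b) ring_scheme \<Rightarrow> 'a set \<Rightarrow> 'a \<Rightarrow> 'a \<Rightarrow> ('a \<times> 'a) set" where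
  "loc_frac R P r s = loc_rel R P `` {(r, s)}"

text \<open>All sets joined by the unions below coincide, because the operations respect \<open>loc_rel\<close>.\<close>

definition localization :: "('a, 'b) ring_scheme \<Rightarrow> 'a set \<Rightarrow> ('a \<times> 'a) set ring" where
  "localization R P =
     \<lparr>partial_object.carrier = (carrier R \<times> (carrier R - P)) // loc_rel R P,
      monoid.mult = (\<lambda>A B. \<Union>(r, s)\<in>A. \<Union>(r', s')\<in>B. loc_frac R P (r \<otimes>\<^bsub>R\<^esub> r') (s \<otimes>\<^bsub>R\<^esub> s')),
      monoid.one = loc_frac R P \<one>\<^bsub>R\<^esub> \<one>\<^bsub>R\<^esub>,
      ring.zero = loc_frac R P \<zero>\<^bsub>R\<^esub> \<one>\<^bsub>R\<^esub>,
      ring.add = (\<lambda>A B. \<Union>(r, s)\<in>A. \<Union>(r', s')\<in>B.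
               loc_frac R P ((r \<otimes>\<^bsub>R\<^esub> s') \<oplus>\<^bsub>R\<^esub> (r' \<otimes>\<^bsub>R\<^esub> s)) (s \<otimes>\<^bsub>R\<^esub> s'))\<rparr>"


section \<open>Noetherian local rings: dimension, depth, type\<close>

definition noetherian_local :: "('a, 'b) ring_scheme \<Rightarrow> bool" where
  "noetherian_local R \<longleftrightarrow> cring R \<and> noetherian_ring R \<and> (\<exists>!m. maximalideal m R)"

definition max_ideal :: "('a, 'b) ring_scheme \<Rightarrow> 'a set" where
  "max_ideal R = (THE m. maximalideal m R)"

definition krull_dim :: "('a, 'b) ring_scheme \<Rightarrow> enat" where
  "krull_dim R =
     Sup {enat n | n. \<exists>P :: nat \<Rightarrow> 'a set.
            (\<forall>i\<le>n. primeideal (P i) R) \<and> (\<forall>i<n. P i \<subset> P (Suc i))}"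

text \<open>
  The condition on \<open>xs ! i\<close> says that it is a nonzerodivisor on the quotient of \<open>R\<close> by the
  preceding elements.
\<close>

definition regular_sequence :: "('a, 'b) ring_scheme \<Rightarrow> 'a list \<Rightarrow> bool" where
  "regular_sequence R xs \<longleftrightarrow>
     set xs \<subseteq> carrier R \<and> Idl\<^bsub>R\<^esub> (set xs) \<noteq> carrier R \<and>
     (\<forall>i<length xs. \<forall>r\<in>carrier R.
        r \<otimes>\<^bsub>R\<^esub> (xs ! i) \<in> Idl\<^bsub>R\<^esub> (set (take i xs)) \<longrightarrow> r \<in> Idl\<^bsub>R\<^esub> (set (take i xs)))"

definition depth :: "('a, 'b) ring_scheme \<Rightarrow> enat" where
  "depth R =
     Sup {enat (length xs) | xs. regular_sequence R xs \<and> set xs \<subseteq> max_ideal R}"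

definition cohen_macaulay_local :: "('a, 'b) ring_scheme \<Rightarrow> bool" where
  "cohen_macaulay_local R \<longleftrightarrow> noetherian_local R \<and> depth R = krull_dim R"

definition residue_field :: "('a, 'b) ring_scheme \<Rightarrow> 'a set ring" where
  "residue_field R = R Quot (max_ideal R)"

text \<open>
  The socle of \<open>R/I\<close>, that is, the submodule of all elements killed by the maximal ideal, as a
  vector space over the residue field. A residue class \<open>A\<close> acts through any of its
  representatives \<open>r\<close>; the sets joined by the union coincide. Modules in \<open>HOL-Algebra\<close> extend
  the record of rings, so the fields \<open>mult\<close> and \<open>one\<close> have to be filled but play no role.
\<close>

definition socle :: "('a, 'b) ring_scheme \<Rightarrow> 'a set \<Rightarrow> ('a set, 'a set) module" where
  "socle R I =
     \<lparr>partial_object.carrier = {v \<in> carrier (R Quot I).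
                   \<forall>r\<in>max_ideal R. (I +>\<^bsub>R\<^esub> r) \<otimes>\<^bsub>R Quot I\<^esub> v = \<zero>\<^bsub>R Quot I\<^esub>},
      monoid.mult = monoid.mult (R Quot I), monoid.one = \<one>\<^bsub>R Quot I\<^esub>,
      ring.zero = \<zero>\<^bsub>R Quot I\<^esub>, ring.add = ring.add (R Quot I),
      module.smult = (\<lambda>A v. \<Union>r\<in>A. (I +>\<^bsub>R\<^esub> r) \<otimes>\<^bsub>R Quot I\<^esub> v)\<rparr>"

text \<open>
  The type of a Cohen-Macaulay local ring \<open>R\<close> with residue field \<open>\<kappa>\<close>: the \<open>\<kappa>\<close>-dimension of the
  socle of \<open>R/(x\<^sub>1,\<dots>,x\<^sub>t)\<close> for a maximal regular sequence in the maximal ideal (as in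
  Kunz, Introduction to Commutative Algebra and Algebraic Geometry, Ch. VI). It is independent
  of the sequence, and it is the dimension of \<open>Ext\<^sup>t(\<kappa>, R)\<close>, where \<open>t\<close> is the depth.
\<close>

definition cm_type :: "('a, 'b) ring_scheme \<Rightarrow> nat" where
  "cm_type R =
     (THE n. \<forall>xs. regular_sequence R xs \<and> set xs \<subseteq> max_ideal R \<and> enat (length xs) = depth R \<longrightarrow>
        vectorspace.fin_dim (residue_field R) (socle R (Idl\<^bsub>R\<^esub> (set xs))) \<and>
        vectorspace.dim (residue_field R) (socle R (Idl\<^bsub>R\<^esub> (set xs))) = n)"

text \<open>
  Gorenstein is taken in the sense of Kunz: Cohen-Macaulay of type 1 (equivalently, of finite
  injective dimension over itself).
\<close>

definition gorenstein_local :: "('a, 'b) ring_scheme \<Rightarrow> bool" where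
  "gorenstein_local R \<longleftrightarrow> cohen_macaulay_local R \<and> cm_type R = 1"


section \<open>Cohen-Macaulay and Gorenstein rings\<close>

definition cohen_macaulay :: "('a, 'b) ring_scheme \<Rightarrow> bool" where
  "cohen_macaulay R \<longleftrightarrow> cring R \<and> noetherian_ring R \<and>
     (\<forall>m. maximalideal m R \<longrightarrow> cohen_macaulay_local (localization R m))"

definition gorenstein :: "('a, 'b) ring_scheme \<Rightarrow> bool" where
  "gorenstein R \<longleftrightarrow> cring R \<and> noetherian_ring R \<and>
     (\<forall>m. maximalideal m R \<longrightarrow> gorenstein_local (localization R m))"

text \<open>The type of a semigroup ring is its type at the monomial maximal ideal.\<close>

definition semigroup_ring_type :: "'k::field itself \<Rightarrow> (nat \<times> nat) set \<Rightarrow> nat" where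
  "semigroup_ring_type _ S =
     cm_type (localization (semigroup_ring S :: ((nat \<times> nat) \<Rightarrow>\<^sub>0 'k) ring) (monomial_max_ideal S))"

end

theory Submission
  imports Defs "HOL-Library.Product_Lexorder"
begin

text \<open>
  Let \<open>T\<close> be the semigroup generated by the arithmetic sequence, put \<open>v = a + k d\<close> and \<open>S = T + \<nat> b\<close>, and let \<open>\<nu>\<close> be
  the least positive integer such that \<open>\<nu> b\<close> lies in the lattice generated by \<open>a\<close> and \<open>d\<close>. As \<open>T\<close> consists of all lattice
  points of the cone spanned by \<open>a\<close> and \<open>v\<close>, and \<open>b\<close> lies in this cone, \<open>\<nu> b\<close> belongs to \<open>T\<close>. So every element of
  \<open>S\<close> is, in exactly one way, of the form \<open>n a + m v + w\<close> with \<open>w\<close> in the finite set \<open>W\<close> of all \<open>e j + i b\<close> with \<open>j < k\<close> and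
  \<open>i < \<nu>\<close>, where \<open>e 0 = 0\<close> and \<open>e j = a + j d\<close> for \<open>j > 0\<close>. In other words, \<open>K[S]\<close> is a free module over the polynomial
  ring \<open>K[a, v]\<close> whose basis consists of the monomials of \<open>W\<close>. (Vectors also denote the corresponding monomials.)

  Being Cohen-Macaulay is a condition at every maximal ideal \<open>m\<close> of \<open>K[S]\<close>. By an argument in the style of Zariski's lemma,
  \<open>m\<close> contains nonzero polynomials \<open>p \<in> K[a]\<close> and \<open>q \<in> K[v]\<close> (\<open>maximal_meets_Ku\<close>), and freeness makes them a
  regular sequence (\<open>regular_pair_Ku_Kv\<close>). Three elements of \<open>K[S]\<close> are algebraically dependent over \<open>K\<close>, which excludes chains
  of four prime ideals (\<open>no_long_prime_chain\<close>). Hence the local ring at \<open>m\<close> has depth and dimension two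
  (locale \<open>two_dim_local\<close>).

  The type refers to all maximal regular sequences at once. For two of them, the socles of the quotients are matched by an
  explicit relation between representatives (\<open>linked\<close>, \<open>socle_basis_linked\<close>), so one sequence suffices; and since
  elements of the socle lift from the localization to the ring (\<open>socle_lift\<close>), the type can be computed in \<open>K[S]\<close>. At the monomial
  maximal ideal the sequence \<open>a, v\<close> has a quotient with the basis \<open>W\<close>, and the socle is spanned by the
  monomials \<open>e j + (\<nu> - 1) b\<close> with \<open>0 < j < k\<close> (\<open>socle_monomials\<close>). This is the type \<open>k - 1\<close>.

  So \<open>K[S]\<close> can only be Gorenstein for \<open>k = 2\<close>. In this case \<open>W\<close> has a duality \<open>w \<mapsto> \<delta> w\<close> for which \<open>\<delta> w + w\<close> is constant. At
  an arbitrary maximal ideal, with \<open>p\<close> and \<open>q\<close> as above, the duality combines with the residue functionals of \<open>p\<close> and \<open>q\<close> to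
  make \<open>K[S]/(p, q)\<close> a Frobenius algebra, and the socle is one-dimensional (\<open>socle_basis_frobenius\<close>).
\<close>

section \<open>Ideals generated by two elements\<close>

context cring begin

lemma Idl_empty: "Idl {} = {\<zero>}"
proof
  show "Idl {} \<subseteq> {\<zero>}" by (rule genideal_minimal[OF zeroideal]) simp
  show "{\<zero>} \<subseteq> Idl {}"
    using additive_subgroup.zero_closed[OF ideal.axioms(1)[OF genideal_ideal[of "{}"]]] by simp
qed

lemma Idl_single:
  assumes "x \<in> carrier R"
  shows "Idl {x} = {p \<otimes> x | p. p \<in> carrier R}"
  using cgenideal_eq_genideal[OF assms] unfolding cgenideal_def by simp

lemma Idl_pair:
  assumes x: "x \<in> carrier R" and y: "y \<in> carrier R"
  shows "Idl {x, y} = {p \<otimes> x \<oplus> q \<otimes> y | p q. p \<in> carrier R \<and> q \<in> carrier R}"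
proof -
  have "Idl {x, y} = Idl ({x} \<union> {y})" by (simp add: insert_commute)
  also have "\<dots> = Idl (Idl {x} \<union> Idl {y})"
  proof
    have sub: "{x} \<union> {y} \<subseteq> Idl {x} \<union> Idl {y}"
      using x y genideal_self'[of x] genideal_self'[of y] by auto
    have c: "Idl {x} \<union> Idl {y} \<subseteq> carrier R"
      using x y Idl_single by auto
    show "Idl ({x} \<union> {y}) \<subseteq> Idl (Idl {x} \<union> Idl {y})"
      by (rule genideal_minimal[OF genideal_ideal[OF c]]) (use genideal_self[OF c] sub in auto)
    have I: "ideal (Idl ({x} \<union> {y})) R" using x y by (intro genideal_ideal) auto
    have "x \<in> Idl ({x} \<union> {y})" "y \<in> Idl ({x} \<union> {y})"
      using x y genideal_self[of "{x} \<union> {y}"] by auto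
    then have "Idl {x} \<subseteq> Idl ({x} \<union> {y})" "Idl {y} \<subseteq> Idl ({x} \<union> {y})"
      using genideal_minimal[OF I] by auto
    then show "Idl (Idl {x} \<union> Idl {y}) \<subseteq> Idl ({x} \<union> {y})"
      by (intro genideal_minimal[OF I]) auto
  qed
  also have "\<dots> = Idl {x} <+> Idl {y}"
    by (rule union_genideal) (use x y in \<open>auto intro: genideal_ideal\<close>)
  also have "\<dots> = {p \<otimes> x \<oplus> q \<otimes> y | p q. p \<in> carrier R \<and> q \<in> carrier R}"
    unfolding set_add_def' Idl_single[OF x] Idl_single[OF y] by auto
  finally show ?thesis .
qed

lemma colon_ideal:
  assumes I: "ideal I R" and x: "x \<in> carrier R"
  shows "ideal {r \<in> carrier R. r \<otimes> x \<in> I} R"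
proof -
  interpret I: ideal I R by fact
  show ?thesis
  proof (rule idealI[OF ring_axioms])
    show "subgroup {r \<in> carrier R. r \<otimes> x \<in> I} (add_monoid R)"
    proof (rule add.subgroupI)
      show "{r \<in> carrier R. r \<otimes> x \<in> I} \<noteq> {}" using x I.zero_closed by (auto intro: exI[of _ "\<zero>"])
    qed (use x in \<open>auto simp: l_minus l_distr a_inv_def[symmetric]\<close>)
    fix a b assume a: "a \<in> {r \<in> carrier R. r \<otimes> x \<in> I}" and b: "b \<in> carrier R"
    have "(b \<otimes> a) \<otimes> x = b \<otimes> (a \<otimes> x)" "(a \<otimes> b) \<otimes> x = b \<otimes> (a \<otimes> x)"
      using a b x by (simp_all add: m_ac)
    then show "b \<otimes> a \<in> {r \<in> carrier R. r \<otimes> x \<in> I}" "a \<otimes> b \<in> {r \<in> carrier R. r \<otimes> x \<in> I}"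
      using a b I.I_l_closed by auto
  qed
qed

lemma ideal_pair:
  "\<lbrakk>x \<in> carrier R; y \<in> carrier R\<rbrakk> \<Longrightarrow> ideal (Idl {x, y}) R"
  by (rule genideal_ideal) simp

end

section \<open>Regular sequences of length two\<close>

text \<open>
  Unlike for regular sequences, the ideal \<open>(x, y)\<close> may be the whole ring. Its properness will come from a
  maximal ideal containing \<open>x\<close> and \<open>y\<close>.
\<close>

definition regular_pair :: "('a, 'b) ring_scheme \<Rightarrow> 'a \<Rightarrow> 'a \<Rightarrow> bool" where
  "regular_pair R x y \<longleftrightarrow> x \<in> carrier R \<and> y \<in> carrier R \<and>
     (\<forall>r\<in>carrier R. r \<otimes>\<^bsub>R\<^esub> x = \<zero>\<^bsub>R\<^esub> \<longrightarrow> r = \<zero>\<^bsub>R\<^esub>) \<and>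
     (\<forall>r\<in>carrier R. \<forall>s\<in>carrier R. r \<otimes>\<^bsub>R\<^esub> y = s \<otimes>\<^bsub>R\<^esub> x \<longrightarrow> (\<exists>t\<in>carrier R. r = t \<otimes>\<^bsub>R\<^esub> x))"

text \<open>
  Two regular sequences \<open>x = (x\<^sub>1, x\<^sub>2)\<close> and \<open>y = (y\<^sub>1, y\<^sub>2)\<close> in a maximal ideal \<open>m\<close> of a local ring \<open>R\<close> give
  quotients with isomorphic socles: both are \<open>Ext\<^sup>2(R/m, R)\<close>. The following relation
  describes the isomorphism by elements of \<open>R\<close>. If \<open>v\<close> represents an element of the socle of \<open>R/(x)\<close>, then \<open>y v = E x\<close>
  for a matrix \<open>E\<close>, whose rows here are \<open>(e\<^sub>1, c\<^sub>1)\<close> and \<open>(e\<^sub>2, c\<^sub>2)\<close>. The corresponding \<open>w\<close>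
  satisfies \<open>x w = E' y\<close>, where \<open>E'\<close> is the adjugate matrix of \<open>E\<close>.
\<close>

definition linked :: "('a, 'b) ring_scheme \<Rightarrow> 'a \<Rightarrow> 'a \<Rightarrow> 'a \<Rightarrow> 'a \<Rightarrow> 'a \<Rightarrow> 'a \<Rightarrow> bool" where
  "linked R x\<^sub>1 x\<^sub>2 y\<^sub>1 y\<^sub>2 v w \<longleftrightarrow> v \<in> carrier R \<and> w \<in> carrier R \<and>
     (\<exists>e\<^sub>1\<in>carrier R. \<exists>e\<^sub>2\<in>carrier R. \<exists>c\<^sub>1\<in>carrier R. \<exists>c\<^sub>2\<in>carrier R.
        y\<^sub>1 \<otimes>\<^bsub>R\<^esub> v = e\<^sub>1 \<otimes>\<^bsub>R\<^esub> x\<^sub>1 \<oplus>\<^bsub>R\<^esub> c\<^sub>1 \<otimes>\<^bsub>R\<^esub> x\<^sub>2 \<and>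
        y\<^sub>2 \<otimes>\<^bsub>R\<^esub> v = e\<^sub>2 \<otimes>\<^bsub>R\<^esub> x\<^sub>1 \<oplus>\<^bsub>R\<^esub> c\<^sub>2 \<otimes>\<^bsub>R\<^esub> x\<^sub>2 \<and>
        x\<^sub>1 \<otimes>\<^bsub>R\<^esub> w = c\<^sub>2 \<otimes>\<^bsub>R\<^esub> y\<^sub>1 \<ominus>\<^bsub>R\<^esub> c\<^sub>1 \<otimes>\<^bsub>R\<^esub> y\<^sub>2 \<and>
        x\<^sub>2 \<otimes>\<^bsub>R\<^esub> w = e\<^sub>1 \<otimes>\<^bsub>R\<^esub> y\<^sub>2 \<ominus>\<^bsub>R\<^esub> e\<^sub>2 \<otimes>\<^bsub>R\<^esub> y\<^sub>1)"

context cring begin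

lemma regular_pair_quotient:
  "\<lbrakk>regular_pair R x y; r \<in> carrier R; s \<in> carrier R; r \<otimes> y = s \<otimes> x\<rbrakk>
    \<Longrightarrow> \<exists>t\<in>carrier R. r = t \<otimes> x"
  unfolding regular_pair_def by blast

lemma regular_pair_zero:
  "\<lbrakk>regular_pair R x y; r \<in> carrier R; s \<in> carrier R; r \<otimes> x = s \<otimes> x\<rbrakk> \<Longrightarrow> r = s"
proof -
  assume a: "regular_pair R x y" "r \<in> carrier R" "s \<in> carrier R" "r \<otimes> x = s \<otimes> x"
  then have x: "x \<in> carrier R" by (simp add: regular_pair_def)
  have "(r \<ominus> s) \<otimes> x = r \<otimes> x \<ominus> s \<otimes> x" using a(2,3) x by algebra
  also have "\<dots> = \<zero>" using a x by simp
  finally have "r \<ominus> s = \<zero>" using a by (simp add: regular_pair_def)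
  then show ?thesis using a by simp
qed

text \<open>
  The adjugate of the adjugate of a \<open>2 \<times> 2\<close> matrix is the matrix itself.
\<close>

lemma linked_sym:
  assumes c: "x\<^sub>1 \<in> carrier R" "x\<^sub>2 \<in> carrier R" "y\<^sub>1 \<in> carrier R" "y\<^sub>2 \<in> carrier R"
    and "linked R x\<^sub>1 x\<^sub>2 y\<^sub>1 y\<^sub>2 v w"
  shows "linked R y\<^sub>1 y\<^sub>2 x\<^sub>1 x\<^sub>2 w v"
proof -
  from assms(5) obtain e\<^sub>1 e\<^sub>2 c\<^sub>1 c\<^sub>2 where e: "e\<^sub>1 \<in> carrier R" "e\<^sub>2 \<in> carrier R" "c\<^sub>1 \<in> carrier R" "c\<^sub>2 \<in> carrier R"
    and vw: "v \<in> carrier R" "w \<in> carrier R"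
    and eq: "y\<^sub>1 \<otimes> v = e\<^sub>1 \<otimes> x\<^sub>1 \<oplus> c\<^sub>1 \<otimes> x\<^sub>2" "y\<^sub>2 \<otimes> v = e\<^sub>2 \<otimes> x\<^sub>1 \<oplus> c\<^sub>2 \<otimes> x\<^sub>2"
      "x\<^sub>1 \<otimes> w = c\<^sub>2 \<otimes> y\<^sub>1 \<ominus> c\<^sub>1 \<otimes> y\<^sub>2" "x\<^sub>2 \<otimes> w = e\<^sub>1 \<otimes> y\<^sub>2 \<ominus> e\<^sub>2 \<otimes> y\<^sub>1"
    unfolding linked_def by blast
  show ?thesis unfolding linked_def
  proof (intro conjI bexI)
    show "x\<^sub>1 \<otimes> w = c\<^sub>2 \<otimes> y\<^sub>1 \<oplus> (\<ominus> c\<^sub>1) \<otimes> y\<^sub>2" unfolding eq using c e by algebra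
    show "x\<^sub>2 \<otimes> w = (\<ominus> e\<^sub>2) \<otimes> y\<^sub>1 \<oplus> e\<^sub>1 \<otimes> y\<^sub>2" unfolding eq using c e by algebra
    show "y\<^sub>1 \<otimes> v = e\<^sub>1 \<otimes> x\<^sub>1 \<ominus> (\<ominus> c\<^sub>1) \<otimes> x\<^sub>2" unfolding eq using c e by algebra
    show "y\<^sub>2 \<otimes> v = c\<^sub>2 \<otimes> x\<^sub>2 \<ominus> (\<ominus> e\<^sub>2) \<otimes> x\<^sub>1" unfolding eq using c e by algebra
  qed (use e vw in auto)
qed

lemma linked_add:
  assumes c: "x\<^sub>1 \<in> carrier R" "x\<^sub>2 \<in> carrier R" "y\<^sub>1 \<in> carrier R" "y\<^sub>2 \<in> carrier R"
    and "linked R x\<^sub>1 x\<^sub>2 y\<^sub>1 y\<^sub>2 v w" "linked R x\<^sub>1 x\<^sub>2 y\<^sub>1 y\<^sub>2 v' w'"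
  shows "linked R x\<^sub>1 x\<^sub>2 y\<^sub>1 y\<^sub>2 (v \<oplus> v') (w \<oplus> w')"
proof -
  from assms(5) obtain e\<^sub>1 e\<^sub>2 c\<^sub>1 c\<^sub>2 where e: "e\<^sub>1 \<in> carrier R" "e\<^sub>2 \<in> carrier R" "c\<^sub>1 \<in> carrier R" "c\<^sub>2 \<in> carrier R"
    and vw: "v \<in> carrier R" "w \<in> carrier R"
    and eq: "y\<^sub>1 \<otimes> v = e\<^sub>1 \<otimes> x\<^sub>1 \<oplus> c\<^sub>1 \<otimes> x\<^sub>2" "y\<^sub>2 \<otimes> v = e\<^sub>2 \<otimes> x\<^sub>1 \<oplus> c\<^sub>2 \<otimes> x\<^sub>2"
      "x\<^sub>1 \<otimes> w = c\<^sub>2 \<otimes> y\<^sub>1 \<ominus> c\<^sub>1 \<otimes> y\<^sub>2" "x\<^sub>2 \<otimes> w = e\<^sub>1 \<otimes> y\<^sub>2 \<ominus> e\<^sub>2 \<otimes> y\<^sub>1"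
    unfolding linked_def by blast
  from assms(6) obtain f\<^sub>1 f\<^sub>2 d\<^sub>1 d\<^sub>2 where f: "f\<^sub>1 \<in> carrier R" "f\<^sub>2 \<in> carrier R" "d\<^sub>1 \<in> carrier R" "d\<^sub>2 \<in> carrier R"
    and vw': "v' \<in> carrier R" "w' \<in> carrier R"
    and eq': "y\<^sub>1 \<otimes> v' = f\<^sub>1 \<otimes> x\<^sub>1 \<oplus> d\<^sub>1 \<otimes> x\<^sub>2" "y\<^sub>2 \<otimes> v' = f\<^sub>2 \<otimes> x\<^sub>1 \<oplus> d\<^sub>2 \<otimes> x\<^sub>2"
      "x\<^sub>1 \<otimes> w' = d\<^sub>2 \<otimes> y\<^sub>1 \<ominus> d\<^sub>1 \<otimes> y\<^sub>2" "x\<^sub>2 \<otimes> w' = f\<^sub>1 \<otimes> y\<^sub>2 \<ominus> f\<^sub>2 \<otimes> y\<^sub>1"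
    unfolding linked_def by blast
  have d: "y\<^sub>1 \<otimes> (v \<oplus> v') = y\<^sub>1 \<otimes> v \<oplus> y\<^sub>1 \<otimes> v'" "y\<^sub>2 \<otimes> (v \<oplus> v') = y\<^sub>2 \<otimes> v \<oplus> y\<^sub>2 \<otimes> v'"
    "x\<^sub>1 \<otimes> (w \<oplus> w') = x\<^sub>1 \<otimes> w \<oplus> x\<^sub>1 \<otimes> w'" "x\<^sub>2 \<otimes> (w \<oplus> w') = x\<^sub>2 \<otimes> w \<oplus> x\<^sub>2 \<otimes> w'"
    using c vw vw' by (simp_all add: r_distr)
  show ?thesis unfolding linked_def
  proof (intro conjI bexI)
    show "y\<^sub>1 \<otimes> (v \<oplus> v') = (e\<^sub>1 \<oplus> f\<^sub>1) \<otimes> x\<^sub>1 \<oplus> (c\<^sub>1 \<oplus> d\<^sub>1) \<otimes> x\<^sub>2" unfolding d eq eq' using c e f by algebra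
    show "y\<^sub>2 \<otimes> (v \<oplus> v') = (e\<^sub>2 \<oplus> f\<^sub>2) \<otimes> x\<^sub>1 \<oplus> (c\<^sub>2 \<oplus> d\<^sub>2) \<otimes> x\<^sub>2" unfolding d eq eq' using c e f by algebra
    show "x\<^sub>1 \<otimes> (w \<oplus> w') = (c\<^sub>2 \<oplus> d\<^sub>2) \<otimes> y\<^sub>1 \<ominus> (c\<^sub>1 \<oplus> d\<^sub>1) \<otimes> y\<^sub>2" unfolding d eq eq' using c e f by algebra
    show "x\<^sub>2 \<otimes> (w \<oplus> w') = (e\<^sub>1 \<oplus> f\<^sub>1) \<otimes> y\<^sub>2 \<ominus> (e\<^sub>2 \<oplus> f\<^sub>2) \<otimes> y\<^sub>1" unfolding d eq eq' using c e f by algebra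
  qed (use e f vw vw' in auto)
qed

lemma linked_smult:
  assumes c: "x\<^sub>1 \<in> carrier R" "x\<^sub>2 \<in> carrier R" "y\<^sub>1 \<in> carrier R" "y\<^sub>2 \<in> carrier R" "r \<in> carrier R"
    and "linked R x\<^sub>1 x\<^sub>2 y\<^sub>1 y\<^sub>2 v w"
  shows "linked R x\<^sub>1 x\<^sub>2 y\<^sub>1 y\<^sub>2 (r \<otimes> v) (r \<otimes> w)"
proof -
  from assms(6) obtain e\<^sub>1 e\<^sub>2 c\<^sub>1 c\<^sub>2 where e: "e\<^sub>1 \<in> carrier R" "e\<^sub>2 \<in> carrier R" "c\<^sub>1 \<in> carrier R" "c\<^sub>2 \<in> carrier R"
    and vw: "v \<in> carrier R" "w \<in> carrier R"
    and eq: "y\<^sub>1 \<otimes> v = e\<^sub>1 \<otimes> x\<^sub>1 \<oplus> c\<^sub>1 \<otimes> x\<^sub>2" "y\<^sub>2 \<otimes> v = e\<^sub>2 \<otimes> x\<^sub>1 \<oplus> c\<^sub>2 \<otimes> x\<^sub>2"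
      "x\<^sub>1 \<otimes> w = c\<^sub>2 \<otimes> y\<^sub>1 \<ominus> c\<^sub>1 \<otimes> y\<^sub>2" "x\<^sub>2 \<otimes> w = e\<^sub>1 \<otimes> y\<^sub>2 \<ominus> e\<^sub>2 \<otimes> y\<^sub>1"
    unfolding linked_def by blast
  have d: "z \<otimes> (r \<otimes> u) = r \<otimes> (z \<otimes> u)" if "z \<in> carrier R" "u \<in> carrier R" for z u
    using that c(5) by algebra
  show ?thesis unfolding linked_def
  proof (intro conjI bexI)
    show "y\<^sub>1 \<otimes> (r \<otimes> v) = (r \<otimes> e\<^sub>1) \<otimes> x\<^sub>1 \<oplus> (r \<otimes> c\<^sub>1) \<otimes> x\<^sub>2"
      unfolding d[OF c(3) vw(1)] eq using c e by algebra
    show "y\<^sub>2 \<otimes> (r \<otimes> v) = (r \<otimes> e\<^sub>2) \<otimes> x\<^sub>1 \<oplus> (r \<otimes> c\<^sub>2) \<otimes> x\<^sub>2"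
      unfolding d[OF c(4) vw(1)] eq using c e by algebra
    show "x\<^sub>1 \<otimes> (r \<otimes> w) = (r \<otimes> c\<^sub>2) \<otimes> y\<^sub>1 \<ominus> (r \<otimes> c\<^sub>1) \<otimes> y\<^sub>2"
      unfolding d[OF c(1) vw(2)] eq using c e by algebra
    show "x\<^sub>2 \<otimes> (r \<otimes> w) = (r \<otimes> e\<^sub>1) \<otimes> y\<^sub>2 \<ominus> (r \<otimes> e\<^sub>2) \<otimes> y\<^sub>1"
      unfolding d[OF c(2) vw(2)] eq using c e by algebra
  qed (use e c vw in auto)
qed

text \<open>
  Since \<open>E x = y v\<close>, the entries \<open>(p, q)\<close> of the vector \<open>E' y\<close> satisfy \<open>p x\<^sub>2 = q x\<^sub>1\<close>. Regularity makes this
  vector a multiple of \<open>x\<close>.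
\<close>

lemma linked_ex:
  assumes reg: "regular_pair R x\<^sub>1 x\<^sub>2" and c: "y\<^sub>1 \<in> carrier R" "y\<^sub>2 \<in> carrier R" "v \<in> carrier R"
    and v: "y\<^sub>1 \<otimes> v \<in> Idl {x\<^sub>1, x\<^sub>2}" "y\<^sub>2 \<otimes> v \<in> Idl {x\<^sub>1, x\<^sub>2}"
  shows "\<exists>w. linked R x\<^sub>1 x\<^sub>2 y\<^sub>1 y\<^sub>2 v w"
proof -
  have x: "x\<^sub>1 \<in> carrier R" "x\<^sub>2 \<in> carrier R" using reg by (auto simp: regular_pair_def)
  from v(1) obtain e\<^sub>1 c\<^sub>1 where 1: "e\<^sub>1 \<in> carrier R" "c\<^sub>1 \<in> carrier R" "y\<^sub>1 \<otimes> v = e\<^sub>1 \<otimes> x\<^sub>1 \<oplus> c\<^sub>1 \<otimes> x\<^sub>2"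
    unfolding Idl_pair[OF x] by blast
  from v(2) obtain e\<^sub>2 c\<^sub>2 where 2: "e\<^sub>2 \<in> carrier R" "c\<^sub>2 \<in> carrier R" "y\<^sub>2 \<otimes> v = e\<^sub>2 \<otimes> x\<^sub>1 \<oplus> c\<^sub>2 \<otimes> x\<^sub>2"
    unfolding Idl_pair[OF x] by blast
  define p where "p = c\<^sub>2 \<otimes> y\<^sub>1 \<ominus> c\<^sub>1 \<otimes> y\<^sub>2"
  define q where "q = e\<^sub>1 \<otimes> y\<^sub>2 \<ominus> e\<^sub>2 \<otimes> y\<^sub>1"
  have pq: "p \<in> carrier R" "q \<in> carrier R" using c 1 2 by (auto simp: p_def q_def)
  have "p \<otimes> x\<^sub>2 \<ominus> q \<otimes> x\<^sub>1
      = y\<^sub>1 \<otimes> (e\<^sub>2 \<otimes> x\<^sub>1 \<oplus> c\<^sub>2 \<otimes> x\<^sub>2) \<ominus> y\<^sub>2 \<otimes> (e\<^sub>1 \<otimes> x\<^sub>1 \<oplus> c\<^sub>1 \<otimes> x\<^sub>2)"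
    unfolding p_def q_def using c x 1(1,2) 2(1,2) by algebra
  also have "\<dots> = y\<^sub>1 \<otimes> (y\<^sub>2 \<otimes> v) \<ominus> y\<^sub>2 \<otimes> (y\<^sub>1 \<otimes> v)" by (simp only: 1 2)
  also have "\<dots> = \<zero>" using c by algebra
  finally have pq_eq: "p \<otimes> x\<^sub>2 = q \<otimes> x\<^sub>1" using pq x by simp
  then obtain w where w: "w \<in> carrier R" "p = w \<otimes> x\<^sub>1"
    using reg pq unfolding regular_pair_def by blast
  have "(w \<otimes> x\<^sub>2) \<otimes> x\<^sub>1 = p \<otimes> x\<^sub>2" unfolding w(2) using w(1) x by algebra
  then have q: "w \<otimes> x\<^sub>2 = q"
    using pq_eq regular_pair_zero[OF reg, of "w \<otimes> x\<^sub>2" q] pq w x by simp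
  have "linked R x\<^sub>1 x\<^sub>2 y\<^sub>1 y\<^sub>2 v w" unfolding linked_def
  proof (intro conjI bexI)
    show "x\<^sub>1 \<otimes> w = c\<^sub>2 \<otimes> y\<^sub>1 \<ominus> c\<^sub>1 \<otimes> y\<^sub>2"
      using w p_def x by (simp add: m_comm)
    show "x\<^sub>2 \<otimes> w = e\<^sub>1 \<otimes> y\<^sub>2 \<ominus> e\<^sub>2 \<otimes> y\<^sub>1"
      using q q_def x w by (simp add: m_comm)
  qed (use 1 2 c w in auto)
  then show ?thesis ..
qed

text \<open>
  As a consequence the relation is, in both directions, a well-defined map on classes modulo the two ideals.
\<close>

lemma linked_zero:
  assumes reg: "regular_pair R x\<^sub>1 x\<^sub>2" and c: "y\<^sub>1 \<in> carrier R" "y\<^sub>2 \<in> carrier R"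
    and lk: "linked R x\<^sub>1 x\<^sub>2 y\<^sub>1 y\<^sub>2 v w" and v: "v \<in> Idl {x\<^sub>1, x\<^sub>2}"
  shows "w \<in> Idl {y\<^sub>1, y\<^sub>2}"
proof -
  have x: "x\<^sub>1 \<in> carrier R" "x\<^sub>2 \<in> carrier R" using reg by (auto simp: regular_pair_def)
  from lk obtain e\<^sub>1 e\<^sub>2 c\<^sub>1 c\<^sub>2 where e: "e\<^sub>1 \<in> carrier R" "e\<^sub>2 \<in> carrier R" "c\<^sub>1 \<in> carrier R" "c\<^sub>2 \<in> carrier R"
    and vw: "v \<in> carrier R" "w \<in> carrier R"
    and eq: "y\<^sub>1 \<otimes> v = e\<^sub>1 \<otimes> x\<^sub>1 \<oplus> c\<^sub>1 \<otimes> x\<^sub>2" "y\<^sub>2 \<otimes> v = e\<^sub>2 \<otimes> x\<^sub>1 \<oplus> c\<^sub>2 \<otimes> x\<^sub>2"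
      "x\<^sub>1 \<otimes> w = c\<^sub>2 \<otimes> y\<^sub>1 \<ominus> c\<^sub>1 \<otimes> y\<^sub>2" "x\<^sub>2 \<otimes> w = e\<^sub>1 \<otimes> y\<^sub>2 \<ominus> e\<^sub>2 \<otimes> y\<^sub>1"
    unfolding linked_def by blast
  from v obtain p q where pq: "p \<in> carrier R" "q \<in> carrier R" "v = p \<otimes> x\<^sub>1 \<oplus> q \<otimes> x\<^sub>2"
    unfolding Idl_pair[OF x] by blast
  \<comment> \<open>The two expansions of \<open>y v\<close> differ by a syzygy of \<open>x\<^sub>1, x\<^sub>2\<close>, and these are all trivial.\<close>
  have syz: "\<exists>t\<in>carrier R. c' = y \<otimes> q \<oplus> t \<otimes> x\<^sub>1"
    if h: "y \<in> carrier R" "e' \<in> carrier R" "c' \<in> carrier R" "y \<otimes> v = e' \<otimes> x\<^sub>1 \<oplus> c' \<otimes> x\<^sub>2" for y e' c'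
  proof -
    have "(c' \<ominus> y \<otimes> q) \<otimes> x\<^sub>2 \<ominus> (y \<otimes> p \<ominus> e') \<otimes> x\<^sub>1
        = (e' \<otimes> x\<^sub>1 \<oplus> c' \<otimes> x\<^sub>2) \<ominus> y \<otimes> (p \<otimes> x\<^sub>1 \<oplus> q \<otimes> x\<^sub>2)"
      using h(1-3) x pq(1,2) by algebra
    also have "\<dots> = y \<otimes> v \<ominus> y \<otimes> v" unfolding h(4) pq(3)[symmetric] by simp
    also have "\<dots> = \<zero>" using h(1) vw by simp
    finally have "(c' \<ominus> y \<otimes> q) \<otimes> x\<^sub>2 = (y \<otimes> p \<ominus> e') \<otimes> x\<^sub>1"
      using h(1-3) x pq(1,2) by simp
    then obtain t where t: "t \<in> carrier R" "c' \<ominus> y \<otimes> q = t \<otimes> x\<^sub>1"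
      using regular_pair_quotient[OF reg, of "c' \<ominus> y \<otimes> q" "y \<otimes> p \<ominus> e'"] h(1-3) pq(1,2) by blast
    have "y \<otimes> q \<oplus> (c' \<ominus> y \<otimes> q) = c'" using h(1-3) pq(1,2) by algebra
    then have "c' = y \<otimes> q \<oplus> t \<otimes> x\<^sub>1" unfolding t(2) by simp
    with t(1) show ?thesis by blast
  qed
  obtain t\<^sub>1 where t1: "t\<^sub>1 \<in> carrier R" "c\<^sub>1 = y\<^sub>1 \<otimes> q \<oplus> t\<^sub>1 \<otimes> x\<^sub>1"
    using syz[OF c(1) e(1,3) eq(1)] by blast
  obtain t\<^sub>2 where t2: "t\<^sub>2 \<in> carrier R" "c\<^sub>2 = y\<^sub>2 \<otimes> q \<oplus> t\<^sub>2 \<otimes> x\<^sub>1"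
    using syz[OF c(2) e(2,4) eq(2)] by blast
  have "w \<otimes> x\<^sub>1 = x\<^sub>1 \<otimes> w" using vw x by (simp add: m_comm)
  also have "\<dots> = (y\<^sub>2 \<otimes> q \<oplus> t\<^sub>2 \<otimes> x\<^sub>1) \<otimes> y\<^sub>1 \<ominus> (y\<^sub>1 \<otimes> q \<oplus> t\<^sub>1 \<otimes> x\<^sub>1) \<otimes> y\<^sub>2"
    unfolding eq t1(2)[symmetric] t2(2)[symmetric] ..
  also have "\<dots> = (t\<^sub>2 \<otimes> y\<^sub>1 \<oplus> (\<ominus> t\<^sub>1) \<otimes> y\<^sub>2) \<otimes> x\<^sub>1"
    using t1(1) t2(1) c x pq(2) by algebra
  finally have "w = t\<^sub>2 \<otimes> y\<^sub>1 \<oplus> (\<ominus> t\<^sub>1) \<otimes> y\<^sub>2"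
    using regular_pair_zero[OF reg] t1(1) t2(1) c vw by simp
  then show ?thesis unfolding Idl_pair[OF c] using t1(1) t2(1) by blast
qed

lemma linked_colon:
  assumes reg: "regular_pair R x\<^sub>1 x\<^sub>2" and c: "y\<^sub>1 \<in> carrier R" "y\<^sub>2 \<in> carrier R"
    and lk: "linked R x\<^sub>1 x\<^sub>2 y\<^sub>1 y\<^sub>2 v w" and r: "r \<in> carrier R" "r \<otimes> v \<in> Idl {x\<^sub>1, x\<^sub>2}"
  shows "r \<otimes> w \<in> Idl {y\<^sub>1, y\<^sub>2}"
proof -
  have "x\<^sub>1 \<in> carrier R" "x\<^sub>2 \<in> carrier R" using reg by (auto simp: regular_pair_def)
  then show ?thesis using linked_zero[OF reg c linked_smult[OF _ _ c r(1) lk] r(2)] by blast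
qed

end

section \<open>Prime ideals avoiding a multiplicative set\<close>

context cring begin

text \<open>
  An ideal that is maximal among those disjoint from a multiplicative set is prime.
\<close>

lemma prime_avoiding:
  assumes I: "ideal I R" and T: "T \<subseteq> carrier R" "\<one> \<in> T" "\<And>s t. s \<in> T \<Longrightarrow> t \<in> T \<Longrightarrow> s \<otimes> t \<in> T"
    and disj: "I \<inter> T = {}"
  shows "\<exists>P. primeideal P R \<and> I \<subseteq> P \<and> P \<inter> T = {}"
proof -
  define \<F> where "\<F> = {J. ideal J R \<and> I \<subseteq> J \<and> J \<inter> T = {}}"
  have "\<exists>M\<in>\<F>. \<forall>Z\<in>\<F>. M \<subseteq> Z \<longrightarrow> Z = M"
  proof (rule subset_Zorn)
    fix C assume C: "subset.chain \<F> C"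
    show "\<exists>U\<in>\<F>. \<forall>Z\<in>C. Z \<subseteq> U"
    proof (cases "C = {}")
      case True then show ?thesis using I disj by (auto simp: \<F>_def)
    next
      case False
      have Cs: "C \<subseteq> \<F>" using C by (auto simp: subset.chain_def)
      have "subset.chain {J. ideal J R} C" using C by (auto simp: subset.chain_def \<F>_def)
      then have "ideal (\<Union>C) R" using False chain_Union_is_ideal[of C] by simp
      then have "\<Union>C \<in> \<F>" using Cs False by (auto simp: \<F>_def)
      then show ?thesis by auto
    qed
  qed
  then obtain P where P: "P \<in> \<F>" and max: "\<And>Z. Z \<in> \<F> \<Longrightarrow> P \<subseteq> Z \<Longrightarrow> Z = P" by blast
  have Pi: "ideal P R" "I \<subseteq> P" "P \<inter> T = {}" using P by (auto simp: \<F>_def)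
  interpret P: ideal P R by fact
  \<comment> \<open>An element outside \<open>P\<close> has (maximality) a multiple in \<open>T\<close> modulo \<open>P\<close>.\<close>
  have out: "\<exists>p\<in>P. \<exists>r\<in>carrier R. p \<oplus> r \<otimes> a \<in> T" if a: "a \<in> carrier R" "a \<notin> P" for a
  proof -
    have J: "ideal (P <+>\<^bsub>R\<^esub> PIdl a) R" by (rule add_ideals[OF Pi(1) cgenideal_ideal[OF a(1)]])
    have Jeq: "P <+>\<^bsub>R\<^esub> PIdl a = {p \<oplus> r \<otimes> a | p r. p \<in> P \<and> r \<in> carrier R}"
      unfolding set_add_def' cgenideal_def by auto
    have mem: "p \<oplus> r \<otimes> a \<in> P <+>\<^bsub>R\<^esub> PIdl a" if "p \<in> P" "r \<in> carrier R" for p r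
      unfolding Jeq using that by blast
    have PJ: "P \<subseteq> P <+>\<^bsub>R\<^esub> PIdl a"
    proof
      fix p assume p: "p \<in> P"
      show "p \<in> P <+>\<^bsub>R\<^esub> PIdl a" using mem[OF p zero_closed] a(1) P.Icarr[OF p] by simp
    qed
    have aJ: "a \<in> P <+>\<^bsub>R\<^esub> PIdl a" using mem[OF P.zero_closed one_closed] a(1) by simp
    have "P <+>\<^bsub>R\<^esub> PIdl a \<notin> \<F>"
    proof
      assume "P <+>\<^bsub>R\<^esub> PIdl a \<in> \<F>"
      from max[OF this PJ] aJ a(2) show False by simp
    qed
    then have "(P <+>\<^bsub>R\<^esub> PIdl a) \<inter> T \<noteq> {}" using J PJ Pi(2) by (auto simp: \<F>_def)
    then show ?thesis unfolding Jeq by blast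
  qed
  have "primeideal P R"
  proof (rule primeidealI[OF Pi(1)])
    show "cring R" by (rule is_cring)
    show "carrier R \<noteq> P" using T Pi(3) by auto
    fix a b assume ab: "a \<in> carrier R" "b \<in> carrier R" "a \<otimes> b \<in> P"
    show "a \<in> P \<or> b \<in> P"
    proof (rule ccontr)
      assume "\<not> (a \<in> P \<or> b \<in> P)"
      then have na: "a \<notin> P" and nb: "b \<notin> P" by auto
      obtain p r where p: "p \<in> P" "r \<in> carrier R" "p \<oplus> r \<otimes> a \<in> T"
        using out[OF ab(1) na] by auto
      obtain q s where q: "q \<in> P" "s \<in> carrier R" "q \<oplus> s \<otimes> b \<in> T"
        using out[OF ab(2) nb] by auto
      have pc: "p \<in> carrier R" "q \<in> carrier R" using p(1) q(1) P.Icarr by auto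
      have "(p \<oplus> r \<otimes> a) \<otimes> (q \<oplus> s \<otimes> b) = (q \<oplus> s \<otimes> b) \<otimes> p \<oplus> ((r \<otimes> a) \<otimes> q \<oplus> (r \<otimes> s) \<otimes> (a \<otimes> b))"
        using pc p(2) q(2) ab(1,2) by algebra
      also have "\<dots> \<in> P"
        by (intro P.a_closed P.I_l_closed p(1) q(1) ab(3) m_closed p(2) q(2) ab(1) subsetD[OF T(1) q(3)])
      finally have "(p \<oplus> r \<otimes> a) \<otimes> (q \<oplus> s \<otimes> b) \<in> P" .
      then show False using T(3)[OF p(3) q(3)] Pi(3) by blast
    qed
  qed
  then show ?thesis using Pi by blast
qed

end

section \<open>Two-dimensional local domains with a regular sequence of length two\<close>

context "domain" begin

text \<open>
  As \<open>y\<close> is a nonzerodivisor modulo \<open>x\<close>, the ideal \<open>(x)\<close> is disjoint from the multiplicative set generated by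
  \<open>y\<close> and the complement of \<open>Q\<close>. A prime ideal over \<open>(x)\<close> avoiding this set lies in \<open>Q\<close> and does not contain \<open>y\<close>.
\<close>

lemma prime_strictly_between:
  assumes reg: "regular_pair R x y" and Q: "primeideal Q R" and xQ: "x \<in> Q" and yQ: "y \<in> Q"
  shows "\<exists>P. primeideal P R \<and> x \<in> P \<and> P \<subset> Q"
proof -
  interpret Q: primeideal Q R by fact
  have c: "x \<in> carrier R" "y \<in> carrier R" using reg by (auto simp: regular_pair_def)
  define T where "T = {y [^] (n::nat) \<otimes> s | n s. s \<in> carrier R - Q}"
  have oneQ: "\<one> \<notin> Q" using Q.one_imp_carrier Q.I_notcarr by blast
  have memT: "y [^] n \<otimes> s \<in> T" if "s \<in> carrier R" "s \<notin> Q" for n :: nat and s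
    using that unfolding T_def by blast
  \<comment> \<open>powers of \<open>y\<close> can be cancelled modulo \<open>x\<close>\<close>
  have desc: "s \<in> Idl {x}" if "s \<in> carrier R" "y [^] n \<otimes> s \<in> Idl {x}" for n :: nat and s
    using that(2)
  proof (induction n)
    case 0 then show ?case using that(1) by simp
  next
    case (Suc n)
    then obtain r where r: "r \<in> carrier R" "y [^] Suc n \<otimes> s = r \<otimes> x"
      unfolding Idl_single[OF c(1)] by blast
    have "(y [^] n \<otimes> s) \<otimes> y = y [^] Suc n \<otimes> s" using c that(1) by (simp add: m_ac)
    then have "(y [^] n \<otimes> s) \<otimes> y = r \<otimes> x" using r(2) by simp
    from regular_pair_quotient[OF reg _ r(1) this] c that(1)
    have "\<exists>t\<in>carrier R. y [^] n \<otimes> s = t \<otimes> x" by simp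
    then have "y [^] n \<otimes> s \<in> Idl {x}" unfolding Idl_single[OF c(1)] by blast
    then show ?case by (rule Suc.IH)
  qed
  have IQ: "Idl {x} \<subseteq> Q" using xQ by (intro genideal_minimal Q.ideal_axioms) simp
  have "\<exists>P. primeideal P R \<and> Idl {x} \<subseteq> P \<and> P \<inter> T = {}"
  proof (rule prime_avoiding)
    show "ideal (Idl {x}) R" using c by (intro genideal_ideal) simp
    show "T \<subseteq> carrier R" unfolding T_def using c by auto
    show "\<one> \<in> T" using memT[OF one_closed oneQ, of 0] by simp
    show "s \<otimes> t \<in> T" if st: "s \<in> T" "t \<in> T" for s t
    proof -
      obtain n u where u: "u \<in> carrier R" "u \<notin> Q" "s = y [^] (n::nat) \<otimes> u" using st(1) unfolding T_def by blast
      obtain n' u' where u': "u' \<in> carrier R" "u' \<notin> Q" "t = y [^] (n'::nat) \<otimes> u'" using st(2) unfolding T_def by blast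
      have "s \<otimes> t = (y [^] n \<otimes> y [^] n') \<otimes> (u \<otimes> u')"
        unfolding u(3) u'(3) using u(1) u'(1) c by (simp add: m_ac)
      also have "\<dots> = y [^] (n + n') \<otimes> (u \<otimes> u')" using c by (simp add: nat_pow_mult)
      finally show ?thesis using memT[of "u \<otimes> u'" "n + n'"] u(1,2) u'(1,2) Q.I_prime by auto
    qed
    show "Idl {x} \<inter> T = {}"
    proof (rule ccontr)
      assume "Idl {x} \<inter> T \<noteq> {}"
      then obtain n s where s: "s \<in> carrier R" "s \<notin> Q" "y [^] (n::nat) \<otimes> s \<in> Idl {x}" unfolding T_def by blast
      from desc[OF s(1,3)] s(2) IQ show False by blast
    qed
  qed
  then obtain P where P: "primeideal P R" "Idl {x} \<subseteq> P" "P \<inter> T = {}" by blast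
  interpret P: primeideal P R by fact
  have "x \<in> P" using P(2) genideal_self'[OF c(1)] by blast
  moreover have "P \<subseteq> Q"
  proof
    fix z assume z: "z \<in> P"
    then have zc: "z \<in> carrier R" by (rule P.Icarr)
    show "z \<in> Q"
    proof (rule ccontr)
      assume "z \<notin> Q"
      then have "z \<in> T" using memT[OF zc, of 0] zc by simp
      with z P(3) show False by blast
    qed
  qed
  moreover have "y \<notin> P" using memT[OF one_closed oneQ, of 1] c P(3) by auto
  ultimately show ?thesis using P(1) yQ by blast
qed

end

text \<open>
  The chain condition bounds the dimension from above, and the regular sequence bounds the depth from below; both
  will turn out to be two.
\<close>

locale two_dim_local = noetherian_domain R for R (structure) +
  fixes m and x\<^sub>1 x\<^sub>2
  assumes maximal_m: "maximalideal m R"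
    and unit_outside: "\<lbrakk>x \<in> carrier R; x \<notin> m\<rbrakk> \<Longrightarrow> x \<in> Units R"
    and no_long_chain: "\<lbrakk>\<And>i. i \<le> 3 \<Longrightarrow> primeideal (P i) R; \<And>i. i < 3 \<Longrightarrow> P i \<subset> P (Suc i)\<rbrakk> \<Longrightarrow> False"
    and reg: "regular_pair R x\<^sub>1 x\<^sub>2" and x_in_m: "x\<^sub>1 \<in> m" "x\<^sub>2 \<in> m"
begin

sublocale m: maximalideal m R by (rule maximal_m)

lemma x_carrier: "x\<^sub>1 \<in> carrier R" "x\<^sub>2 \<in> carrier R"
  using reg by (auto simp: regular_pair_def)

lemma x1_nonzero: "x\<^sub>1 \<noteq> \<zero>"
proof
  assume "x\<^sub>1 = \<zero>"
  then have "\<one> \<otimes> x\<^sub>1 = \<zero>" by simp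
  then have "\<one> = \<zero>" using reg unfolding regular_pair_def by blast
  then show False by simp
qed

lemma prime_m: "primeideal m R"
  by (rule maximalideal_prime[OF maximal_m])

lemma proper_ideal_le_m:
  assumes "ideal J R" "J \<noteq> carrier R"
  shows "J \<subseteq> m"
proof
  interpret J: ideal J R by fact
  fix z assume z: "z \<in> J"
  show "z \<in> m"
  proof (rule ccontr)
    assume "z \<notin> m"
    then have u: "z \<in> Units R" using unit_outside J.Icarr[OF z] by blast
    have "inv z \<otimes> z \<in> J" by (rule J.I_l_closed[OF z Units_inv_closed[OF u]])
    then have "\<one> \<in> J" using u by simp
    then show False using J.one_imp_carrier assms(2) by blast
  qed
qed

lemma maximalideal_unique: "maximalideal n R \<Longrightarrow> n = m"
  using m.I_maximal[of n] proper_ideal_le_m[of n] maximalideal.I_maximal[of n R m]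
    maximalideal.I_notcarr[of n R] m.I_notcarr m.ideal_axioms m.a_subset
  by (metis maximalideal.axioms(1))

lemma max_ideal_eq: "max_ideal R = m"
  unfolding max_ideal_def using maximal_m maximalideal_unique by (rule the_equality)

lemma noetherian_local: "noetherian_local R"
  unfolding noetherian_local_def
  using is_cring noetherian_ring_axioms maximal_m maximalideal_unique by blast

lemma one_notin_m: "\<one> \<notin> m"
  using m.one_imp_carrier m.I_notcarr by blast

text \<open>
  Otherwise some prime ideal \<open>Q\<close> contains \<open>x\<^sub>1\<close> and \<open>x\<^sub>2\<close> but not \<open>r\<close>. With a prime ideal \<open>P\<close> strictly below \<open>Q\<close> that
  contains \<open>x\<^sub>1\<close> there would be the chain \<open>0 \<subset> P \<subset> Q \<subset> m\<close>.
\<close>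

lemma power_in_parameter_ideal:
  assumes r: "r \<in> m"
  shows "\<exists>e::nat. r [^] e \<in> Idl {x\<^sub>1, x\<^sub>2}"
proof (rule ccontr)
  assume no: "\<nexists>e::nat. r [^] e \<in> Idl {x\<^sub>1, x\<^sub>2}"
  have rc: "r \<in> carrier R" using r m.Icarr by blast
  have "\<exists>Q. primeideal Q R \<and> Idl {x\<^sub>1, x\<^sub>2} \<subseteq> Q \<and> Q \<inter> range (\<lambda>n::nat. r [^] n) = {}"
  proof (rule prime_avoiding)
    show "ideal (Idl {x\<^sub>1, x\<^sub>2}) R" by (rule ideal_pair[OF x_carrier])
    show "range (\<lambda>n::nat. r [^] n) \<subseteq> carrier R" using rc by auto
    show "\<one> \<in> range (\<lambda>n::nat. r [^] n)" by (rule range_eqI[of _ _ 0]) simp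
    show "s \<otimes> t \<in> range (\<lambda>n::nat. r [^] n)"
      if "s \<in> range (\<lambda>n::nat. r [^] n)" "t \<in> range (\<lambda>n::nat. r [^] n)" for s t
      using that rc by (auto simp: nat_pow_mult)
    show "Idl {x\<^sub>1, x\<^sub>2} \<inter> range (\<lambda>n::nat. r [^] n) = {}" using no by blast
  qed
  then obtain Q where Q: "primeideal Q R" "Idl {x\<^sub>1, x\<^sub>2} \<subseteq> Q" "Q \<inter> range (\<lambda>n::nat. r [^] n) = {}"
    by blast
  interpret Q: primeideal Q R by fact
  have xQ: "x\<^sub>1 \<in> Q" "x\<^sub>2 \<in> Q" using Q(2) genideal_self[of "{x\<^sub>1, x\<^sub>2}"] x_carrier by auto
  have rQ: "r \<notin> Q"
  proof
    assume "r \<in> Q"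
    moreover have "r = r [^] (1::nat)" using rc by simp
    ultimately show False using Q(3) by blast
  qed
  have Qm: "Q \<subset> m" using proper_ideal_le_m[OF Q.ideal_axioms] Q.I_notcarr r rQ by blast
  obtain P where P: "primeideal P R" "x\<^sub>1 \<in> P" "P \<subset> Q"
    using prime_strictly_between[OF reg Q(1) xQ] by blast
  interpret P: primeideal P R by fact
  define C where "C = (\<lambda>i::nat. if i = 0 then {\<zero>} else if i = 1 then P else if i = 2 then Q else m)"
  show False
  proof (rule no_long_chain[of C])
    fix i :: nat
    show "primeideal (C i) R" unfolding C_def using zeroprimeideal P(1) Q(1) prime_m by simp
    assume "i < 3"
    then consider "i = 0" | "i = 1" | "i = 2" by linarith
    then show "C i \<subset> C (Suc i)"
    proof cases
      case 1 then show ?thesis unfolding C_def using P(2) x1_nonzero P.zero_closed by auto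
    next
      case 2 then show ?thesis unfolding C_def using P(3) by auto
    next
      case 3 then show ?thesis unfolding C_def using Qm by auto
    qed
  qed
qed

lemma parameter_ideal_le_m: "Idl {x\<^sub>1, x\<^sub>2} \<subseteq> m"
  using x_in_m by (intro genideal_minimal m.ideal_axioms) simp

text \<open>
  Start with \<open>1\<close> and multiply, for one generator of \<open>m\<close> after the other, by the highest power of it that keeps the
  product outside the ideal. Such a power exists because the elements of \<open>m\<close> are nilpotent modulo the ideal.
\<close>

lemma socle_nonzero:
  "\<exists>x\<in>carrier R. x \<notin> Idl {x\<^sub>1, x\<^sub>2} \<and> (\<forall>r\<in>m. r \<otimes> x \<in> Idl {x\<^sub>1, x\<^sub>2})"
proof -
  let ?I = "Idl {x\<^sub>1, x\<^sub>2}"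
  interpret I: ideal ?I R by (rule ideal_pair[OF x_carrier])
  obtain A where A: "A \<subseteq> carrier R" "finite A" "m = Idl A" using finetely_gen[OF m.ideal_axioms] by blast
  have Am: "A \<subseteq> m" using A genideal_self by blast
  have "\<exists>x\<in>carrier R. x \<notin> ?I \<and> (\<forall>r\<in>A. r \<otimes> x \<in> ?I)"
    using A(2) Am
  proof (induction A rule: finite_induct)
    case empty
    have "\<one> \<notin> ?I" using one_notin_m parameter_ideal_le_m by blast
    then show ?case by auto
  next
    case (insert r A)
    then obtain x where x: "x \<in> carrier R" "x \<notin> ?I" "\<And>s. s \<in> A \<Longrightarrow> s \<otimes> x \<in> ?I" by blast
    have rc: "r \<in> carrier R" using insert.prems m.Icarr by blast
    define e where "e = (LEAST e::nat. r [^] e \<otimes> x \<in> ?I)"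
    obtain e' :: nat where "r [^] e' \<in> ?I" using power_in_parameter_ideal insert.prems by blast
    then have "r [^] e' \<otimes> x \<in> ?I" using x(1) I.I_r_closed by blast
    then have e: "r [^] e \<otimes> x \<in> ?I" unfolding e_def by (rule LeastI)
    have "e \<noteq> 0"
    proof
      assume "e = 0" then show False using e x by simp
    qed
    then obtain e0 where e0: "e = Suc e0" using not0_implies_Suc by blast
    have ne: "r [^] e0 \<otimes> x \<notin> ?I" using not_less_Least[of e0 "\<lambda>e. r [^] e \<otimes> x \<in> ?I"] e0 unfolding e_def by simp
    show ?case
    proof (intro bexI conjI ballI)
      show "r [^] e0 \<otimes> x \<in> carrier R" using rc x by simp
      show "r [^] e0 \<otimes> x \<notin> ?I" by fact
      fix s assume "s \<in> insert r A"
      then show "s \<otimes> (r [^] e0 \<otimes> x) \<in> ?I"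
      proof
        assume "s = r"
        then have "s \<otimes> (r [^] e0 \<otimes> x) = r [^] e \<otimes> x" using rc x(1) e0 by (simp add: m_ac)
        then show ?thesis using e by simp
      next
        assume s: "s \<in> A"
        then have sc: "s \<in> carrier R" using insert.prems m.Icarr by blast
        have "s \<otimes> (r [^] e0 \<otimes> x) = r [^] e0 \<otimes> (s \<otimes> x)" using rc sc x(1) by (simp add: m_lcomm)
        then show ?thesis using I.I_l_closed[OF x(3)[OF s], of "r [^] e0"] rc by simp
      qed
    qed
  qed
  then obtain x where x: "x \<in> carrier R" "x \<notin> ?I" "\<And>r. r \<in> A \<Longrightarrow> r \<otimes> x \<in> ?I" by blast
  have "ideal {r \<in> carrier R. r \<otimes> x \<in> ?I} R" by (rule colon_ideal[OF I.ideal_axioms x(1)])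
  then have "m \<subseteq> {r \<in> carrier R. r \<otimes> x \<in> ?I}"
    unfolding A(3) using x(3) A(1) by (intro genideal_minimal) auto
  then show ?thesis using x(1,2) by blast
qed

lemma regular_sequence_pair:
  assumes ys: "set ys \<subseteq> m" "length ys = 2"
  shows "regular_sequence R ys \<longleftrightarrow> regular_pair R (ys ! 0) (ys ! 1)"
proof -
  obtain y z where yz: "ys = [y, z]" using ys(2) by (auto simp: length_Suc_conv numeral_2_eq_2)
  have c: "y \<in> carrier R" "z \<in> carrier R" using ys(1) yz m.Icarr by auto
  have ne: "Idl (set ys) \<noteq> carrier R"
    using genideal_minimal[OF m.ideal_axioms ys(1)] one_notin_m by auto
  have all2: "(\<forall>i<2. Q i) \<longleftrightarrow> Q 0 \<and> Q (1::nat)" for Q by (auto simp: less_Suc_eq numeral_2_eq_2)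
  show ?thesis
    unfolding regular_sequence_def regular_pair_def ys(2) all2 using ne c
    by (auto simp: yz Idl_empty Idl_single)
qed

text \<open>
  The socle of \<open>R/(x\<^sub>1, x\<^sub>2)\<close> is nonzero, hence by linkage so is the socle of \<open>R/(y\<^sub>1, y\<^sub>2)\<close>. A third element of \<open>m\<close>
  annihilates it and is therefore a zero divisor.
\<close>

lemma regular_sequence_length_le:
  assumes "regular_sequence R ys" "set ys \<subseteq> m"
  shows "length ys \<le> 2"
proof (rule ccontr)
  assume "\<not> length ys \<le> 2"
  then have len: "length ys > 2" by simp
  define y\<^sub>1 y\<^sub>2 y\<^sub>3 where y: "y\<^sub>1 = ys ! 0" "y\<^sub>2 = ys ! 1" "y\<^sub>3 = ys ! 2"
  have ne: "ys \<noteq> []" using len by auto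
  have tk: "take (Suc 0) ys = [y\<^sub>1]" "take 2 ys = [y\<^sub>1, y\<^sub>2]"
    using len ne by (auto simp: y take_Suc_conv_app_nth numeral_2_eq_2)
  have ym: "y\<^sub>1 \<in> m" "y\<^sub>2 \<in> m" "y\<^sub>3 \<in> m" using assms(2) len ne by (auto simp: y)
  have c: "y\<^sub>1 \<in> carrier R" "y\<^sub>2 \<in> carrier R" "y\<^sub>3 \<in> carrier R" using ym m.Icarr by auto
  have nzd: "\<And>i r. i < length ys \<Longrightarrow> r \<in> carrier R \<Longrightarrow> r \<otimes> ys ! i \<in> Idl (set (take i ys)) \<Longrightarrow> r \<in> Idl (set (take i ys))"
    using assms(1) unfolding regular_sequence_def by blast
  have r1: "r = \<zero>" if "r \<in> carrier R" "r \<otimes> y\<^sub>1 = \<zero>" for r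
    using nzd[of 0 r] that len ne by (auto simp: y Idl_empty)
  have r2: "r \<in> Idl {y\<^sub>1}" if "r \<in> carrier R" "r \<otimes> y\<^sub>2 \<in> Idl {y\<^sub>1}" for r
    using nzd[of 1 r] that len tk(1) by (simp add: y)
  have r3: "r \<in> Idl {y\<^sub>1, y\<^sub>2}" if "r \<in> carrier R" "r \<otimes> y\<^sub>3 \<in> Idl {y\<^sub>1, y\<^sub>2}" for r
    using nzd[of 2 r] that len tk(2) by (simp add: y)
  have regy: "regular_pair R y\<^sub>1 y\<^sub>2"
    unfolding regular_pair_def using c r1 r2 unfolding Idl_single[OF c(1)] by blast
  obtain x where x: "x \<in> carrier R" "x \<notin> Idl {x\<^sub>1, x\<^sub>2}" "\<And>r. r \<in> m \<Longrightarrow> r \<otimes> x \<in> Idl {x\<^sub>1, x\<^sub>2}"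
    using socle_nonzero by blast
  obtain w where w: "linked R x\<^sub>1 x\<^sub>2 y\<^sub>1 y\<^sub>2 x w"
    using linked_ex[OF reg c(1,2) x(1) x(3)[OF ym(1)] x(3)[OF ym(2)]] by blast
  have wc: "w \<in> carrier R" using w by (simp add: linked_def)
  have "y\<^sub>3 \<otimes> w \<in> Idl {y\<^sub>1, y\<^sub>2}" by (rule linked_colon[OF reg c(1,2) w c(3) x(3)[OF ym(3)]])
  then have "w \<in> Idl {y\<^sub>1, y\<^sub>2}" using r3[OF wc] wc c by (simp add: m_comm)
  then have "x \<in> Idl {x\<^sub>1, x\<^sub>2}"
    using linked_zero[OF regy x_carrier linked_sym[OF x_carrier c(1,2) w]] by blast
  with x(2) show False ..
qed

lemma depth_eq: "depth R = 2"
proof -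
  have "regular_sequence R [x\<^sub>1, x\<^sub>2]" using regular_sequence_pair[of "[x\<^sub>1, x\<^sub>2]"] x_in_m reg by simp
  then have "enat (length [x\<^sub>1, x\<^sub>2]) \<in> {enat (length xs) | xs. regular_sequence R xs \<and> set xs \<subseteq> max_ideal R}"
    using x_in_m unfolding max_ideal_eq by (intro CollectI exI[of _ "[x\<^sub>1, x\<^sub>2]"]) simp
  then have "enat (length [x\<^sub>1, x\<^sub>2]) \<le> depth R" unfolding depth_def by (rule Sup_upper)
  moreover have "depth R \<le> enat 2"
    unfolding depth_def max_ideal_eq using regular_sequence_length_le by (intro Sup_least) auto
  ultimately show ?thesis by (simp add: numeral_eq_enat numeral_2_eq_2)
qed

lemma krull_dim_eq: "krull_dim R = 2"
proof (rule antisym)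
  show "krull_dim R \<le> 2" unfolding krull_dim_def
  proof (rule Sup_least, clarify)
    fix n and P :: "nat \<Rightarrow> 'a set"
    assume P: "\<forall>i\<le>n. primeideal (P i) R" "\<forall>i<n. P i \<subset> P (Suc i)"
    have "n \<le> 2"
    proof (rule ccontr)
      assume "\<not> n \<le> 2"
      then show False using no_long_chain[of P] P by auto
    qed
    then show "enat n \<le> 2" by (simp add: numeral_eq_enat)
  qed
  obtain P where P: "primeideal P R" "x\<^sub>1 \<in> P" "P \<subset> m"
    using prime_strictly_between[OF reg prime_m x_in_m] by blast
  define C where "C = (\<lambda>i::nat. if i = 0 then {\<zero>} else if i = 1 then P else m)"
  have "\<forall>i\<le>2. primeideal (C i) R" unfolding C_def using zeroprimeideal P(1) prime_m by simp
  moreover have "\<forall>i<2. C i \<subset> C (Suc i)"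
  proof (intro allI impI)
    fix i :: nat assume "i < 2"
    then consider "i = 0" | "i = 1" by linarith
    then show "C i \<subset> C (Suc i)"
    proof cases
      case 1
      have "\<zero> \<in> P" using primeideal.axioms(1)[OF P(1)] additive_subgroup.zero_closed ideal.axioms(1) by blast
      then show ?thesis using 1 unfolding C_def using P(2) x1_nonzero by auto
    next
      case 2 then show ?thesis unfolding C_def using P(3) by auto
    qed
  qed
  ultimately have "enat 2 \<in> {enat n | n. \<exists>P :: nat \<Rightarrow> 'a set.
            (\<forall>i\<le>n. primeideal (P i) R) \<and> (\<forall>i<n. P i \<subset> P (Suc i))}" by blast
  then have "enat 2 \<le> krull_dim R" unfolding krull_dim_def by (rule Sup_upper)
  then show "2 \<le> krull_dim R" by (simp add: numeral_eq_enat)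
qed

lemma cohen_macaulay_local: "cohen_macaulay_local R"
  unfolding cohen_macaulay_local_def using noetherian_local depth_eq krull_dim_eq by simp

end

section \<open>Socles and the Cohen-Macaulay type\<close>

text \<open>
  A basis, over \<open>R/M\<close>, of the annihilator of \<open>M\<close> in \<open>R/I\<close>, given by representatives in \<open>R\<close>. Scalars are represented
  as well, so that being zero becomes membership in \<open>M\<close>. This makes it possible to compute in \<open>R\<close> instead
  of a vector space of cosets.
\<close>

definition socle_basis :: "('a, 'b) ring_scheme \<Rightarrow> 'a set \<Rightarrow> 'a set \<Rightarrow> nat \<Rightarrow> (nat \<Rightarrow> 'a) \<Rightarrow> bool" where
  "socle_basis R M I n b \<longleftrightarrow>
     (\<forall>i<n. b i \<in> carrier R \<and> (\<forall>r\<in>M. r \<otimes>\<^bsub>R\<^esub> b i \<in> I)) \<and>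
     (\<forall>v\<in>carrier R. (\<forall>r\<in>M. r \<otimes>\<^bsub>R\<^esub> v \<in> I) \<longrightarrow>
        (\<exists>c\<in>{..<n} \<rightarrow> carrier R. v \<ominus>\<^bsub>R\<^esub> (\<Oplus>\<^bsub>R\<^esub>i\<in>{..<n}. c i \<otimes>\<^bsub>R\<^esub> b i) \<in> I)) \<and>
     (\<forall>c\<in>{..<n} \<rightarrow> carrier R. (\<Oplus>\<^bsub>R\<^esub>i\<in>{..<n}. c i \<otimes>\<^bsub>R\<^esub> b i) \<in> I \<longrightarrow> (\<forall>i<n. c i \<in> M))"

context cring begin

lemma linked_zero_zero:
  assumes "x\<^sub>1 \<in> carrier R" "x\<^sub>2 \<in> carrier R" "y\<^sub>1 \<in> carrier R" "y\<^sub>2 \<in> carrier R"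
  shows "linked R x\<^sub>1 x\<^sub>2 y\<^sub>1 y\<^sub>2 \<zero> \<zero>"
  unfolding linked_def using assms
  by (intro conjI bexI[of _ \<zero>]) (simp_all add: minus_eq)

lemma linked_sum:
  assumes c: "x\<^sub>1 \<in> carrier R" "x\<^sub>2 \<in> carrier R" "y\<^sub>1 \<in> carrier R" "y\<^sub>2 \<in> carrier R"
    and "\<And>i. i < (n::nat) \<Longrightarrow> linked R x\<^sub>1 x\<^sub>2 y\<^sub>1 y\<^sub>2 (v i) (w i)" and "a \<in> {..<n} \<rightarrow> carrier R"
  shows "linked R x\<^sub>1 x\<^sub>2 y\<^sub>1 y\<^sub>2 (\<Oplus>i\<in>{..<n}. a i \<otimes> v i) (\<Oplus>i\<in>{..<n}. a i \<otimes> w i)"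
  using assms(5,6)
proof (induction n)
  case 0 then show ?case using linked_zero_zero[OF c] by simp
next
  case (Suc n)
  have vw: "v i \<in> carrier R" "w i \<in> carrier R" if "i < Suc n" for i
    using Suc.prems(1)[OF that] by (auto simp: linked_def)
  have a: "a i \<in> carrier R" if "i < Suc n" for i using Suc.prems(2) that by auto
  have s: "(\<Oplus>i\<in>{..<Suc n}. a i \<otimes> u i) = a n \<otimes> u n \<oplus> (\<Oplus>i\<in>{..<n}. a i \<otimes> u i)"
    if "\<And>i. i < Suc n \<Longrightarrow> u i \<in> carrier R" for u
    using that a by (subst lessThan_Suc, subst finsum_insert) auto
  have IH: "linked R x\<^sub>1 x\<^sub>2 y\<^sub>1 y\<^sub>2 (\<Oplus>i\<in>{..<n}. a i \<otimes> v i) (\<Oplus>i\<in>{..<n}. a i \<otimes> w i)"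
  proof (rule Suc.IH)
    show "linked R x\<^sub>1 x\<^sub>2 y\<^sub>1 y\<^sub>2 (v i) (w i)" if "i < n" for i using Suc.prems(1)[of i] that by simp
    show "a \<in> {..<n} \<rightarrow> carrier R" using Suc.prems(2) by auto
  qed
  show ?case unfolding s[of v, OF vw(1), simplified] s[of w, OF vw(2), simplified]
    by (rule linked_add[OF c linked_smult[OF c a Suc.prems(1)] IH]) auto
qed

lemma finsum_in_carrier:
  "\<lbrakk>c \<in> {..<n} \<rightarrow> carrier R; \<And>i. i < n \<Longrightarrow> b i \<in> carrier R\<rbrakk>
    \<Longrightarrow> (\<Oplus>i\<in>{..<n::nat}. c i \<otimes> b i) \<in> carrier R"
  by (intro finsum_closed) auto

text \<open>The linkage relation identifies the two socles, so it carries bases to bases.\<close>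

lemma socle_basis_linked:
  assumes rx: "regular_pair R x\<^sub>1 x\<^sub>2" and ry: "regular_pair R y\<^sub>1 y\<^sub>2"
    and xM: "x\<^sub>1 \<in> M" "x\<^sub>2 \<in> M" and yM: "y\<^sub>1 \<in> M" "y\<^sub>2 \<in> M" and M: "M \<subseteq> carrier R"
    and b: "socle_basis R M (Idl {x\<^sub>1, x\<^sub>2}) n b"
  shows "\<exists>b'. socle_basis R M (Idl {y\<^sub>1, y\<^sub>2}) n b'"
proof -
  have c: "x\<^sub>1 \<in> carrier R" "x\<^sub>2 \<in> carrier R" "y\<^sub>1 \<in> carrier R" "y\<^sub>2 \<in> carrier R" using xM yM M by auto
  note c' = c(3,4,1,2)
  have bc: "b i \<in> carrier R" "\<And>r. r \<in> M \<Longrightarrow> r \<otimes> b i \<in> Idl {x\<^sub>1, x\<^sub>2}" if "i < n" for i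
    using b that unfolding socle_basis_def by auto
  have "\<exists>w. linked R x\<^sub>1 x\<^sub>2 y\<^sub>1 y\<^sub>2 (b i) w" if "i < n" for i
    by (rule linked_ex[OF rx c(3,4) bc(1)[OF that] bc(2)[OF that yM(1)] bc(2)[OF that yM(2)]])
  then obtain b' where b': "\<And>i. i < n \<Longrightarrow> linked R x\<^sub>1 x\<^sub>2 y\<^sub>1 y\<^sub>2 (b i) (b' i)" by metis
  have b'c: "b' i \<in> carrier R" if "i < n" for i using b'[OF that] by (simp add: linked_def)
  have "socle_basis R M (Idl {y\<^sub>1, y\<^sub>2}) n b'" unfolding socle_basis_def
  proof (intro conjI allI impI ballI)
    fix i assume i: "i < n"
    show "b' i \<in> carrier R" by (rule b'c[OF i])
    fix r assume "r \<in> M"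
    then show "r \<otimes> b' i \<in> Idl {y\<^sub>1, y\<^sub>2}"
      using linked_colon[OF rx c(3,4) b'[OF i]] bc(2)[OF i] M by blast
  next
    fix w assume w: "w \<in> carrier R" "\<forall>r\<in>M. r \<otimes> w \<in> Idl {y\<^sub>1, y\<^sub>2}"
    obtain v where v: "linked R y\<^sub>1 y\<^sub>2 x\<^sub>1 x\<^sub>2 w v"
      using linked_ex[OF ry c(1,2) w(1)] w(2) xM by blast
    have vc: "v \<in> carrier R" using v by (simp add: linked_def)
    have "\<forall>r\<in>M. r \<otimes> v \<in> Idl {x\<^sub>1, x\<^sub>2}" using linked_colon[OF ry c(1,2) v] w(2) M by blast
    then obtain a where a: "a \<in> {..<n} \<rightarrow> carrier R" "v \<ominus> (\<Oplus>i\<in>{..<n}. a i \<otimes> b i) \<in> Idl {x\<^sub>1, x\<^sub>2}"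
      using b vc unfolding socle_basis_def by blast
    have lk: "linked R x\<^sub>1 x\<^sub>2 y\<^sub>1 y\<^sub>2 (v \<oplus> (\<ominus> \<one>) \<otimes> (\<Oplus>i\<in>{..<n}. a i \<otimes> b i)) (w \<oplus> (\<ominus> \<one>) \<otimes> (\<Oplus>i\<in>{..<n}. a i \<otimes> b' i))"
      by (intro linked_add linked_smult linked_sum c linked_sym[OF c' v] b' a(1)) auto
    have e: "u \<oplus> (\<ominus> \<one>) \<otimes> z = u \<ominus> z" if "u \<in> carrier R" "z \<in> carrier R" for u z
      using that by algebra
    have "w \<ominus> (\<Oplus>i\<in>{..<n}. a i \<otimes> b' i) \<in> Idl {y\<^sub>1, y\<^sub>2}"
      using linked_zero[OF rx c(3,4) lk] a(2) e[OF vc finsum_in_carrier[OF a(1) bc(1)]]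
        e[OF w(1) finsum_in_carrier[OF a(1) b'c]] by simp
    with a(1) show "\<exists>c\<in>{..<n} \<rightarrow> carrier R. w \<ominus> (\<Oplus>i\<in>{..<n}. c i \<otimes> b' i) \<in> Idl {y\<^sub>1, y\<^sub>2}" by blast
  next
    fix a i assume a: "a \<in> {..<n} \<rightarrow> carrier R" "(\<Oplus>i\<in>{..<n}. a i \<otimes> b' i) \<in> Idl {y\<^sub>1, y\<^sub>2}" and i: "i < n"
    have "linked R x\<^sub>1 x\<^sub>2 y\<^sub>1 y\<^sub>2 (\<Oplus>i\<in>{..<n}. a i \<otimes> b i) (\<Oplus>i\<in>{..<n}. a i \<otimes> b' i)"
      by (rule linked_sum[OF c b' a(1)])
    from linked_zero[OF ry c(1,2) linked_sym[OF c this] a(2)] show "a i \<in> M"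
      using b a(1) i unfolding socle_basis_def by blast
  qed
  then show ?thesis by blast
qed

end

subsection \<open>The socle as a vector space over the residue field\<close>

context cring begin

text \<open>
  The ideal \<open>m\<close> annihilates the socle, so the product of a scalar \<open>m + r\<close> with an element of the socle does not depend
  on the representative \<open>r\<close>.
\<close>

lemma socle_vectorspace:
  assumes maxm: "maximalideal m R" "max_ideal R = m" and I: "ideal I R" and Im: "I \<subseteq> m"
  shows "vectorspace (residue_field R) (socle R I)"
    and "\<And>r x. \<lbrakk>r \<in> carrier R; x \<in> carrier R; \<forall>s\<in>m. s \<otimes> x \<in> I\<rbrakk> \<Longrightarrow>
        (m +> r) \<odot>\<^bsub>socle R I\<^esub> (I +> x) = I +> (r \<otimes> x)"
    and "carrier (socle R I) = (+>) I ` {x \<in> carrier R. \<forall>s\<in>m. s \<otimes> x \<in> I}"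
proof -
  interpret m: maximalideal m R by fact
  interpret I: ideal I R by fact
  interpret Q: cring "R Quot I" by (rule I.quotient_is_cring[OF is_cring])
  have hmul: "(I +> x) \<otimes>\<^bsub>R Quot I\<^esub> (I +> y) = I +> (x \<otimes> y)"
    and hadd: "(I +> x) \<oplus>\<^bsub>R Quot I\<^esub> (I +> y) = I +> (x \<oplus> y)"
    if "x \<in> carrier R" "y \<in> carrier R" for x y
    using that ring_hom_mult[OF I.rcos_ring_hom] ring_hom_add[OF I.rcos_ring_hom] by auto
  interpret K: field "R Quot m" by (rule m.quotient_is_field[OF is_cring])
  let ?V = "socle R I"
  let ?S = "{x \<in> carrier R. \<forall>s\<in>m. s \<otimes> x \<in> I}"
  have Qc: "carrier (R Quot I) = (+>) I ` carrier R"
    by (auto simp: FactRing_def A_RCOSETS_def')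
  have Kc: "carrier (R Quot m) = (+>) m ` carrier R"
    by (auto simp: FactRing_def A_RCOSETS_def')
  have z: "I +> x = \<zero>\<^bsub>R Quot I\<^esub> \<longleftrightarrow> x \<in> I" if "x \<in> carrier R" for x
    using that I.rcos_const_imp_mem a_rcos_zero[OF I] by (auto simp: FactRing_def)
  have car: "carrier ?V = (+>) I ` ?S"
  proof -
    have "carrier ?V = {v \<in> (+>) I ` carrier R. \<forall>s\<in>m. (I +> s) \<otimes>\<^bsub>R Quot I\<^esub> v = \<zero>\<^bsub>R Quot I\<^esub>}"
      unfolding socle_def maxm(2) Qc by simp
    also have "\<dots> = (+>) I ` {x \<in> carrier R. \<forall>s\<in>m. (I +> s) \<otimes>\<^bsub>R Quot I\<^esub> (I +> x) = \<zero>\<^bsub>R Quot I\<^esub>}"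
      by blast
    also have "{x \<in> carrier R. \<forall>s\<in>m. (I +> s) \<otimes>\<^bsub>R Quot I\<^esub> (I +> x) = \<zero>\<^bsub>R Quot I\<^esub>} = ?S"
    proof (rule Collect_cong, rule conj_cong[OF refl])
      fix x assume x: "x \<in> carrier R"
      show "(\<forall>s\<in>m. (I +> s) \<otimes>\<^bsub>R Quot I\<^esub> (I +> x) = \<zero>\<^bsub>R Quot I\<^esub>) \<longleftrightarrow> (\<forall>s\<in>m. s \<otimes> x \<in> I)"
      proof (intro ball_cong refl)
        fix s assume "s \<in> m"
        then have sc: "s \<in> carrier R" by (rule m.Icarr)
        show "(I +> s) \<otimes>\<^bsub>R Quot I\<^esub> (I +> x) = \<zero>\<^bsub>R Quot I\<^esub> \<longleftrightarrow> s \<otimes> x \<in> I"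
          unfolding hmul[OF sc x] by (rule z) (use sc x in simp)
      qed
    qed
    finally show ?thesis .
  qed
  show "carrier ?V = (+>) I ` ?S" by (rule car)
  have sm: "(m +> r) \<odot>\<^bsub>?V\<^esub> (I +> x) = I +> (r \<otimes> x)"
    if r: "r \<in> carrier R" and x: "x \<in> carrier R" "\<forall>s\<in>m. s \<otimes> x \<in> I" for r x
  proof -
    have "(m +> r) \<odot>\<^bsub>?V\<^esub> (I +> x) = (\<Union>s\<in>m +> r. (I +> s) \<otimes>\<^bsub>R Quot I\<^esub> (I +> x))"
      by (simp add: socle_def)
    also have "\<dots> = (\<Union>s\<in>m +> r. I +> (r \<otimes> x))"
    proof (intro SUP_cong refl)
      fix s assume "s \<in> m +> r"
      then obtain t where t: "t \<in> m" "s = t \<oplus> r" by (auto simp: a_r_coset_def')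
      have tc: "t \<in> carrier R" using t m.Icarr by blast
      have sc: "s \<in> carrier R" using t tc r by simp
      have "s \<otimes> x \<ominus> r \<otimes> x = t \<otimes> x" unfolding t(2) using tc r x(1) by algebra
      then have "s \<otimes> x \<ominus> r \<otimes> x \<in> I" using x(2) t(1) by simp
      then show "(I +> s) \<otimes>\<^bsub>R Quot I\<^esub> (I +> x) = I +> (r \<otimes> x)"
        unfolding hmul[OF sc x(1)] using quotient_eq_iff_same_a_r_cos[OF I, of "s \<otimes> x" "r \<otimes> x"] sc r x(1) by simp
    qed
    also have "\<dots> = I +> (r \<otimes> x)"
      using m.a_rcos_self[OF r] by auto
    finally show ?thesis .
  qed
  show "(m +> r) \<odot>\<^bsub>?V\<^esub> (I +> x) = I +> (r \<otimes> x)"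
    if "r \<in> carrier R" "x \<in> carrier R" "\<forall>s\<in>m. s \<otimes> x \<in> I" for r x using sm that .
  have S0: "\<zero> \<in> ?S" using I.zero_closed m.Icarr by auto
  have Sadd: "x \<oplus> y \<in> ?S" if "x \<in> ?S" "y \<in> ?S" for x y
  proof -
    have "s \<otimes> (x \<oplus> y) \<in> I" if s: "s \<in> m" for s
      using I.a_closed[of "s \<otimes> x" "s \<otimes> y"] r_distr[of x y s] m.Icarr[OF s] s \<open>x \<in> ?S\<close> \<open>y \<in> ?S\<close> by simp
    then show ?thesis using that by simp
  qed
  have Sneg: "\<ominus> x \<in> ?S" if "x \<in> ?S" for x
  proof -
    have "s \<otimes> (\<ominus> x) \<in> I" if s: "s \<in> m" for s
      using I.a_inv_closed[of "s \<otimes> x"] r_minus[of s x] m.Icarr[OF s] s \<open>x \<in> ?S\<close> by simp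
    then show ?thesis using that by simp
  qed
  have Smul: "r \<otimes> x \<in> ?S" if "x \<in> ?S" "r \<in> carrier R" for r x
  proof -
    have "s \<otimes> (r \<otimes> x) \<in> I" if s: "s \<in> m" for s
    proof -
      have "s \<otimes> (r \<otimes> x) = r \<otimes> (s \<otimes> x)"
        using \<open>x \<in> ?S\<close> \<open>r \<in> carrier R\<close> m.Icarr[OF s] by (intro m_lcomm) auto
      then show ?thesis using I.I_l_closed[of "s \<otimes> x" r] \<open>x \<in> ?S\<close> \<open>r \<in> carrier R\<close> s by simp
    qed
    then show ?thesis using that by simp
  qed
  have Vadd: "(I +> x) \<oplus>\<^bsub>?V\<^esub> (I +> y) = I +> (x \<oplus> y)" if "x \<in> carrier R" "y \<in> carrier R" for x y
    using hadd[OF that] by (simp add: socle_def)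
  have Vzero: "\<zero>\<^bsub>?V\<^esub> = I +> \<zero>"
    using z[OF zero_closed] I.zero_closed by (simp add: socle_def)
  have ab: "abelian_group ?V"
  proof (rule abelian_groupI)
    show "\<exists>y\<in>carrier ?V. y \<oplus>\<^bsub>?V\<^esub> x = \<zero>\<^bsub>?V\<^esub>" if xV: "x \<in> carrier ?V" for x
    proof -
      obtain u where u: "u \<in> ?S" "x = I +> u" using xV unfolding car by blast
      then have "(I +> \<ominus> u) \<oplus>\<^bsub>?V\<^esub> x = \<zero>\<^bsub>?V\<^esub>"
        by (simp add: Vadd Vzero l_neg)
      then show ?thesis using Sneg[OF u(1)] car by blast
    qed
    show "\<zero>\<^bsub>?V\<^esub> \<in> carrier ?V" unfolding car Vzero using S0 by (rule imageI)
    fix u v assume "u \<in> carrier ?V" "v \<in> carrier ?V"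
    then obtain x y where x: "x \<in> ?S" "u = I +> x" and y: "y \<in> ?S" "v = I +> y" unfolding car by blast
    have xc: "x \<in> carrier R" "y \<in> carrier R" using x y by auto
    show "u \<oplus>\<^bsub>?V\<^esub> v \<in> carrier ?V"
      unfolding car x(2) y(2) Vadd[OF xc] using Sadd[OF x(1) y(1)] by (rule imageI)
    show "u \<oplus>\<^bsub>?V\<^esub> v = v \<oplus>\<^bsub>?V\<^esub> u"
      unfolding x(2) y(2) Vadd[OF xc] Vadd[OF xc(2,1)] using xc by (simp add: a_comm)
    show "\<zero>\<^bsub>?V\<^esub> \<oplus>\<^bsub>?V\<^esub> u = u" unfolding Vzero x(2) Vadd[OF zero_closed xc(1)] using xc by simp
    fix w assume "w \<in> carrier ?V"
    then obtain z where z: "z \<in> ?S" "w = I +> z" unfolding car by blast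
    then have zc: "z \<in> carrier R" by simp
    show "u \<oplus>\<^bsub>?V\<^esub> v \<oplus>\<^bsub>?V\<^esub> w = u \<oplus>\<^bsub>?V\<^esub> (v \<oplus>\<^bsub>?V\<^esub> w)"
      unfolding x(2) y(2) z(2) using xc zc by (simp add: Vadd a_assoc)
  qed
  have md: "module (R Quot m) ?V"
  proof (rule moduleI[OF K.is_cring ab])
    have hm: "(m +> r) \<oplus>\<^bsub>R Quot m\<^esub> (m +> s) = m +> (r \<oplus> s)" "(m +> r) \<otimes>\<^bsub>R Quot m\<^esub> (m +> s) = m +> (r \<otimes> s)"
      if "r \<in> carrier R" "s \<in> carrier R" for r s
      using that ring_hom_add[OF m.rcos_ring_hom] ring_hom_mult[OF m.rcos_ring_hom] by auto
    have rep: "\<exists>r. r \<in> carrier R \<and> A = m +> r" if "A \<in> carrier (R Quot m)" for A using that unfolding Kc by blast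
    have vrep: "\<exists>x. x \<in> ?S \<and> v = I +> x" if "v \<in> carrier ?V" for v using that unfolding car by blast
    { fix A v assume A: "A \<in> carrier (R Quot m)" and v: "v \<in> carrier ?V"
      obtain r where r: "r \<in> carrier R" "A = m +> r" using rep[OF A] by blast
      obtain x where x: "x \<in> ?S" "v = I +> x" using vrep[OF v] by blast
      have xc: "x \<in> carrier R" "\<forall>s\<in>m. s \<otimes> x \<in> I" using x(1) by auto
      have Av: "A \<odot>\<^bsub>?V\<^esub> v = I +> (r \<otimes> x)" unfolding r(2) x(2) by (rule sm[OF r(1) xc])
      show "A \<odot>\<^bsub>?V\<^esub> v \<in> carrier ?V" unfolding Av car using Smul[OF x(1) r(1)] by (rule imageI)
      { fix B assume B: "B \<in> carrier (R Quot m)"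
        obtain s where s: "s \<in> carrier R" "B = m +> s" using rep[OF B] by blast
        have Bv: "B \<odot>\<^bsub>?V\<^esub> v = I +> (s \<otimes> x)" unfolding s(2) x(2) by (rule sm[OF s(1) xc])
        have "(A \<oplus>\<^bsub>R Quot m\<^esub> B) \<odot>\<^bsub>?V\<^esub> v = I +> ((r \<oplus> s) \<otimes> x)"
          unfolding r(2) s(2) hm[OF r(1) s(1)] x(2) by (rule sm[OF _ xc]) (use r s in simp)
        then show "(A \<oplus>\<^bsub>R Quot m\<^esub> B) \<odot>\<^bsub>?V\<^esub> v = A \<odot>\<^bsub>?V\<^esub> v \<oplus>\<^bsub>?V\<^esub> B \<odot>\<^bsub>?V\<^esub> v"
          unfolding Av Bv using Vadd[of "r \<otimes> x" "s \<otimes> x"] r s xc by (simp add: l_distr)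
        have sx: "s \<otimes> x \<in> carrier R" "\<forall>t\<in>m. t \<otimes> (s \<otimes> x) \<in> I" using Smul[OF x(1) s(1)] by auto
        have "(A \<otimes>\<^bsub>R Quot m\<^esub> B) \<odot>\<^bsub>?V\<^esub> v = I +> ((r \<otimes> s) \<otimes> x)"
          unfolding r(2) s(2) hm[OF r(1) s(1)] x(2) by (rule sm[OF _ xc]) (use r s in simp)
        moreover have "A \<odot>\<^bsub>?V\<^esub> (B \<odot>\<^bsub>?V\<^esub> v) = I +> (r \<otimes> (s \<otimes> x))"
          unfolding Bv r(2) by (rule sm[OF r(1) sx])
        ultimately show "(A \<otimes>\<^bsub>R Quot m\<^esub> B) \<odot>\<^bsub>?V\<^esub> v = A \<odot>\<^bsub>?V\<^esub> (B \<odot>\<^bsub>?V\<^esub> v)"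
          using r s xc by (simp add: m_assoc) }
      { fix w assume w: "w \<in> carrier ?V"
        obtain y where y: "y \<in> ?S" "w = I +> y" using vrep[OF w] by blast
        have yc: "y \<in> carrier R" "\<forall>s\<in>m. s \<otimes> y \<in> I" using y(1) by auto
        have Aw: "A \<odot>\<^bsub>?V\<^esub> w = I +> (r \<otimes> y)" unfolding r(2) y(2) by (rule sm[OF r(1) yc])
        have xy: "x \<oplus> y \<in> carrier R" "\<forall>t\<in>m. t \<otimes> (x \<oplus> y) \<in> I" using Sadd[OF x(1) y(1)] by auto
        have "A \<odot>\<^bsub>?V\<^esub> (v \<oplus>\<^bsub>?V\<^esub> w) = I +> (r \<otimes> (x \<oplus> y))"
          unfolding x(2) y(2) Vadd[OF xc(1) yc(1)] r(2) by (rule sm[OF r(1) xy])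
        then show "A \<odot>\<^bsub>?V\<^esub> (v \<oplus>\<^bsub>?V\<^esub> w) = A \<odot>\<^bsub>?V\<^esub> v \<oplus>\<^bsub>?V\<^esub> A \<odot>\<^bsub>?V\<^esub> w"
          unfolding Av Aw using Vadd[of "r \<otimes> x" "r \<otimes> y"] r xc yc by (simp add: r_distr) } }
  next
    fix v assume "v \<in> carrier ?V"
    then obtain x where x: "x \<in> ?S" "v = I +> x" unfolding car by blast
    have "\<one>\<^bsub>R Quot m\<^esub> = m +> \<one>" by (simp add: FactRing_def)
    then show "\<one>\<^bsub>R Quot m\<^esub> \<odot>\<^bsub>?V\<^esub> v = v" using x sm[of \<one> x] by simp
  qed
  show "vectorspace (residue_field R) ?V"
    unfolding residue_field_def maxm(2) using md K.field_axioms by (simp add: vectorspace_def)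
qed

text \<open>
  The cosets of the representatives are a basis of the vector space.
\<close>

lemma socle_dim:
  assumes maxm: "maximalideal m R" "max_ideal R = m" and I: "ideal I R" and Im: "I \<subseteq> m"
    and b: "socle_basis R m I n b"
  shows "vectorspace.fin_dim (residue_field R) (socle R I) \<and>
     vectorspace.dim (residue_field R) (socle R I) = n"
proof -
  interpret m: maximalideal m R by fact
  interpret I: ideal I R by fact
  let ?V = "socle R I" and ?K = "residue_field R"
  note vs = socle_vectorspace[OF maxm I Im]
  interpret V: vectorspace ?K ?V by (rule vs(1))
  have Kdef: "?K = R Quot m" by (simp add: residue_field_def maxm(2))
  have Kc: "carrier ?K = (+>) m ` carrier R"
    by (auto simp: Kdef FactRing_def A_RCOSETS_def')
  have K0: "m +> r = \<zero>\<^bsub>?K\<^esub> \<longleftrightarrow> r \<in> m" if "r \<in> carrier R" for r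
    using that m.rcos_const_imp_mem a_rcos_zero[OF m.ideal_axioms] by (auto simp: Kdef FactRing_def)
  have V0: "I +> x = \<zero>\<^bsub>?V\<^esub> \<longleftrightarrow> x \<in> I" if "x \<in> carrier R" for x
    using that I.rcos_const_imp_mem a_rcos_zero[OF I] by (auto simp: socle_def FactRing_def)
  have bc: "b i \<in> carrier R" "\<And>r. r \<in> m \<Longrightarrow> r \<otimes> b i \<in> I" if "i < n" for i
    using b that unfolding socle_basis_def by auto
  have bV: "I +> b i \<in> carrier ?V" if "i < n" for i using bc[OF that] vs(3) by blast
  have span: "\<exists>c\<in>{..<n} \<rightarrow> carrier R. v \<ominus> (\<Oplus>i\<in>{..<n}. c i \<otimes> b i) \<in> I"
    if "v \<in> carrier R" "\<forall>r\<in>m. r \<otimes> v \<in> I" for v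
    using b that unfolding socle_basis_def by blast
  have indep: "c i \<in> m" if "c \<in> {..<n} \<rightarrow> carrier R" "(\<Oplus>i\<in>{..<n}. c i \<otimes> b i) \<in> I" "i < n" for c i
    using b that unfolding socle_basis_def by blast
  have Vsum: "(\<Oplus>\<^bsub>?V\<^esub>i\<in>{..<k}. (m +> c i) \<odot>\<^bsub>?V\<^esub> (I +> b i)) = I +> (\<Oplus>i\<in>{..<k}. c i \<otimes> b i)"
    if "c \<in> {..<n} \<rightarrow> carrier R" "k \<le> n" for c k
    using that(2)
  proof (induction k)
    case 0 then show ?case using V0[OF zero_closed] I.zero_closed by simp
  next
    case (Suc k)
    have cc: "c i \<in> carrier R" if "i < n" for i using \<open>c \<in> {..<n} \<rightarrow> carrier R\<close> that by auto
    have mc: "m +> c i \<in> carrier ?K" if "i < n" for i using cc[OF that] Kc by blast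
    have kn: "k < n" using Suc.prems by simp
    have "(\<Oplus>\<^bsub>?V\<^esub>i\<in>{..<Suc k}. (m +> c i) \<odot>\<^bsub>?V\<^esub> (I +> b i))
       = (m +> c k) \<odot>\<^bsub>?V\<^esub> (I +> b k) \<oplus>\<^bsub>?V\<^esub> (\<Oplus>\<^bsub>?V\<^esub>i\<in>{..<k}. (m +> c i) \<odot>\<^bsub>?V\<^esub> (I +> b i))"
      using kn mc bV by (subst lessThan_Suc, subst V.M.finsum_insert) auto
    also have "\<dots> = (I +> c k \<otimes> b k) \<oplus>\<^bsub>?V\<^esub> (I +> (\<Oplus>i\<in>{..<k}. c i \<otimes> b i))"
      using Suc vs(2)[OF cc[OF kn] bc(1)[OF kn]] bc(2)[OF kn] by auto
    also have "\<dots> = I +> (c k \<otimes> b k \<oplus> (\<Oplus>i\<in>{..<k}. c i \<otimes> b i))"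
    proof -
      have "c k \<otimes> b k \<in> carrier R" "(\<Oplus>i\<in>{..<k}. c i \<otimes> b i) \<in> carrier R"
        using cc bc(1) kn by (auto intro!: finsum_closed)
      then show ?thesis using ring_hom_add[OF I.rcos_ring_hom] by (simp add: socle_def)
    qed
    also have "c k \<otimes> b k \<oplus> (\<Oplus>i\<in>{..<k}. c i \<otimes> b i) = (\<Oplus>i\<in>{..<Suc k}. c i \<otimes> b i)"
      using kn cc bc(1) by (subst lessThan_Suc, subst finsum_insert) auto
    finally show ?case .
  qed
  have inj: "inj_on (\<lambda>i. I +> b i) {..<n}"
  proof (rule inj_onI, rule ccontr)
    fix i j assume ij: "i \<in> {..<n}" "j \<in> {..<n}" "I +> b i = I +> b j" "i \<noteq> j"
    define c where "c = (\<lambda>l. if l = i then \<one> else if l = j then \<ominus> \<one> else \<zero>)"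
    have cc: "c \<in> {..<n} \<rightarrow> carrier R" by (auto simp: c_def)
    have "(\<Oplus>l\<in>{..<n}. c l \<otimes> b l) = c i \<otimes> b i \<oplus> (\<Oplus>l\<in>{..<n} - {i}. c l \<otimes> b l)"
      using ij bc(1) cc by (subst finsum_insert[symmetric]) (auto simp: insert_absorb)
    also have "(\<Oplus>l\<in>{..<n} - {i}. c l \<otimes> b l) = c j \<otimes> b j \<oplus> (\<Oplus>l\<in>{..<n} - {i} - {j}. c l \<otimes> b l)"
    proof -
      have "{..<n} - {i} = insert j ({..<n} - {i} - {j})" using ij by auto
      then show ?thesis using bc(1) cc ij by (subst finsum_insert[symmetric]) auto
    qed
    also have "(\<Oplus>l\<in>{..<n} - {i} - {j}. c l \<otimes> b l) = \<zero>"
      by (rule finsum_all0) (use bc(1) in \<open>auto simp: c_def\<close>)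
    finally have eq: "(\<Oplus>l\<in>{..<n}. c l \<otimes> b l) = b i \<ominus> b j"
      using ij bc(1) by (auto simp: c_def l_minus minus_eq)
    have "b i \<ominus> b j \<in> I"
      using quotient_eq_iff_same_a_r_cos[OF I] ij bc(1) by simp
    then have "c i \<in> m" using indep[OF cc] ij(1) eq by simp
    then show False using m.one_imp_carrier m.I_notcarr by (simp add: c_def)
  qed
  let ?B = "(\<lambda>i. I +> b i) ` {..<n}"
  define g where "g = the_inv_into {..<n} (\<lambda>i. I +> b i)"
  have g: "g (I +> b i) = i" if "i < n" for i
    using the_inv_into_f_f[OF inj] that by (simp add: g_def)
  have finB: "finite ?B" by simp
  have BV: "?B \<subseteq> carrier ?V" using bV by auto
  have lin: "V.lincomb a ?B = (\<Oplus>\<^bsub>?V\<^esub>i\<in>{..<n}. a (I +> b i) \<odot>\<^bsub>?V\<^esub> (I +> b i))"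
    if "a \<in> ?B \<rightarrow> carrier ?K" for a
    unfolding V.lincomb_def
    using that bV by (subst V.M.finsum_reindex[OF _ inj]) auto
  have li: "V.lin_indpt ?B"
  proof (rule V.finite_lin_indpt2[OF finB BV])
    fix a assume a: "a \<in> ?B \<rightarrow> carrier ?K" "V.lincomb a ?B = \<zero>\<^bsub>?V\<^esub>"
    have "\<exists>r. r \<in> carrier R \<and> a (I +> b i) = m +> r" if "i < n" for i
    proof -
      have "a (I +> b i) \<in> carrier ?K" using a(1) that by auto
      then show ?thesis unfolding Kc by blast
    qed
    then obtain c where c: "\<And>i. i < n \<Longrightarrow> c i \<in> carrier R \<and> a (I +> b i) = m +> c i" by metis
    have cc: "c \<in> {..<n} \<rightarrow> carrier R" using c by auto
    have "V.lincomb a ?B = (\<Oplus>\<^bsub>?V\<^esub>i\<in>{..<n}. (m +> c i) \<odot>\<^bsub>?V\<^esub> (I +> b i))"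
      unfolding lin[OF a(1)] using c bV Kc by (intro V.M.finsum_cong') auto
    also have "\<dots> = I +> (\<Oplus>i\<in>{..<n}. c i \<otimes> b i)" by (rule Vsum[OF cc order_refl])
    finally have "I +> (\<Oplus>i\<in>{..<n}. c i \<otimes> b i) = \<zero>\<^bsub>?V\<^esub>" using a(2) by (rule trans[OF sym])
    then have "(\<Oplus>i\<in>{..<n}. c i \<otimes> b i) \<in> I"
      using V0[OF finsum_in_carrier[of c n b, OF cc bc(1)]] by blast
    then have "c i \<in> m" if "i < n" for i using indep[OF cc] that by blast
    then show "\<forall>v\<in>?B. a v = \<zero>\<^bsub>?K\<^esub>" using c K0 by auto
  qed
  have gen: "V.gen_set ?B"
  proof
    show "V.span ?B \<subseteq> carrier ?V" using V.span_is_subset2[OF BV] .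
    show "carrier ?V \<subseteq> V.span ?B"
    proof
      fix v assume "v \<in> carrier ?V"
      then obtain x where x: "x \<in> carrier R" "\<forall>s\<in>m. s \<otimes> x \<in> I" "v = I +> x" unfolding vs(3) by blast
      obtain c where c: "c \<in> {..<n} \<rightarrow> carrier R" "x \<ominus> (\<Oplus>i\<in>{..<n}. c i \<otimes> b i) \<in> I"
        using span[OF x(1,2)] by blast
      have v: "v = I +> (\<Oplus>i\<in>{..<n}. c i \<otimes> b i)"
        using quotient_eq_iff_same_a_r_cos[OF I x(1) finsum_in_carrier[OF c(1) bc(1)]] c(2) x(3) by simp
      define a where "a = (\<lambda>u. m +> c (g u))"
      have a: "a \<in> ?B \<rightarrow> carrier ?K" using c(1) g Kc by (auto simp: a_def)
      have "V.lincomb a ?B = (\<Oplus>\<^bsub>?V\<^esub>i\<in>{..<n}. (m +> c i) \<odot>\<^bsub>?V\<^esub> (I +> b i))"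
      proof (unfold lin[OF a], rule V.M.finsum_cong')
        have "m +> c i \<in> carrier ?K" if "i < n" for i using c(1) that Kc by auto
        then show "(\<lambda>i. (m +> c i) \<odot>\<^bsub>?V\<^esub> (I +> b i)) \<in> {..<n} \<rightarrow> carrier ?V" using bV by auto
      qed (auto simp: a_def g)
      also have "\<dots> = v" unfolding v by (rule Vsum[OF c(1) order_refl])
      finally show "v \<in> V.span ?B" unfolding V.span_def using a finB by blast
    qed
  qed
  have "V.basis ?B" unfolding V.basis_def using li gen BV by blast
  then have "V.dim = card ?B" by (rule V.dim_basis[OF finB])
  also have "\<dots> = n" using card_image[OF inj] by simp
  finally have "V.dim = n" .
  moreover have "V.fin_dim" unfolding V.fin_dim_def using finB BV gen by blast
  ultimately show ?thesis by blast
qed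

end

context two_dim_local begin

text \<open>
  All maximal regular sequences in \<open>m\<close> have length two, and a socle basis for one of them gives, by linkage,
  a socle basis of the same size for each.
\<close>

lemma cm_type_eq:
  assumes b: "socle_basis R m (Idl {x\<^sub>1, x\<^sub>2}) n b"
  shows "cm_type R = n"
proof -
  have "vectorspace.fin_dim (residue_field R) (socle R (Idl (set ys))) \<and>
        vectorspace.dim (residue_field R) (socle R (Idl (set ys))) = n"
    if ys: "regular_sequence R ys \<and> set ys \<subseteq> max_ideal R \<and> enat (length ys) = depth R" for ys
  proof -
    have len: "length ys = 2" using ys unfolding depth_eq by (simp add: numeral_eq_enat)
    have sub: "set ys \<subseteq> m" using ys max_ideal_eq by simp
    obtain y z where yz: "ys = [y, z]" using len by (auto simp: length_Suc_conv numeral_2_eq_2)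
    have ry: "regular_pair R y z" using ys regular_sequence_pair[OF sub len] by (simp add: yz)
    have ym: "y \<in> m" "z \<in> m" using sub yz by auto
    obtain b' where b': "socle_basis R m (Idl {y, z}) n b'"
      using socle_basis_linked[OF reg ry x_in_m ym m.a_subset b] by blast
    have s: "set ys = {y, z}" by (simp add: yz)
    have I: "ideal (Idl {y, z}) R" using ideal_pair m.Icarr ym by blast
    have Im: "Idl {y, z} \<subseteq> m" using ym by (intro genideal_minimal m.ideal_axioms) simp
    show ?thesis unfolding s by (rule socle_dim[OF maximal_m max_ideal_eq I Im b'])
  qed
  note all = this
  have r: "regular_sequence R [x\<^sub>1, x\<^sub>2] \<and> set [x\<^sub>1, x\<^sub>2] \<subseteq> max_ideal R \<and> enat (length [x\<^sub>1, x\<^sub>2]) = depth R"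
    using regular_sequence_pair[of "[x\<^sub>1, x\<^sub>2]"] x_in_m reg depth_eq max_ideal_eq
    by (simp add: numeral_eq_enat numeral_2_eq_2)
  show ?thesis unfolding cm_type_def
  proof (rule the_equality)
    fix k assume "\<forall>xs. regular_sequence R xs \<and> set xs \<subseteq> max_ideal R \<and> enat (length xs) = depth R \<longrightarrow>
        vectorspace.fin_dim (residue_field R) (socle R (Idl (set xs))) \<and>
        vectorspace.dim (residue_field R) (socle R (Idl (set xs))) = k"
    then show "k = n" using all[OF r] r by metis
  qed (use all in blast)
qed

end

section \<open>Localization of a noetherian domain at a prime ideal\<close>

locale localized_domain = noetherian_domain R + P: primeideal P R for R (structure) and P
begin

abbreviation "fr \<equiv> loc_frac R P"
abbreviation "L \<equiv> localization R P"

definition "denoms = carrier R - P"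

lemma denomsD: "s \<in> denoms \<Longrightarrow> s \<in> carrier R" "s \<in> denoms \<Longrightarrow> s \<notin> P" "s \<in> denoms \<Longrightarrow> s \<noteq> \<zero>"
  using P.zero_closed by (auto simp: denoms_def)

lemma one_denoms [simp]: "\<one> \<in> denoms"
  using P.one_imp_carrier P.I_notcarr by (auto simp: denoms_def)

lemma mult_denoms [simp]: "\<lbrakk>s \<in> denoms; t \<in> denoms\<rbrakk> \<Longrightarrow> s \<otimes> t \<in> denoms"
  using P.I_prime by (auto simp: denoms_def)

text \<open>
  In a domain the additional factor in the definition of the equality of fractions can be cancelled.
\<close>

lemma loc_rel_iff:
  "((r, s), (r', s')) \<in> loc_rel R P \<longleftrightarrow>
     r \<in> carrier R \<and> r' \<in> carrier R \<and> s \<in> denoms \<and> s' \<in> denoms \<and> r \<otimes> s' = r' \<otimes> s"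
proof -
  have "(\<exists>u\<in>denoms. u \<otimes> (r \<otimes> s' \<ominus> r' \<otimes> s) = \<zero>) \<longleftrightarrow> r \<otimes> s' = r' \<otimes> s"
    if c: "r \<in> carrier R" "r' \<in> carrier R" "s \<in> carrier R" "s' \<in> carrier R"
  proof
    assume "\<exists>u\<in>denoms. u \<otimes> (r \<otimes> s' \<ominus> r' \<otimes> s) = \<zero>"
    then obtain u where u: "u \<in> denoms" "u \<otimes> (r \<otimes> s' \<ominus> r' \<otimes> s) = \<zero>" by blast
    then have "r \<otimes> s' \<ominus> r' \<otimes> s = \<zero>"
      using integral[OF u(2)] denomsD[OF u(1)] c by auto
    then show "r \<otimes> s' = r' \<otimes> s" using c by simp
  next
    assume "r \<otimes> s' = r' \<otimes> s"
    then have "\<one> \<otimes> (r \<otimes> s' \<ominus> r' \<otimes> s) = \<zero>" using c by simp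
    then show "\<exists>u\<in>denoms. u \<otimes> (r \<otimes> s' \<ominus> r' \<otimes> s) = \<zero>" using one_denoms by blast
  qed
  then show ?thesis unfolding loc_rel_def using denomsD by (auto simp flip: denoms_def)
qed

lemma equiv_loc_rel: "equiv (carrier R \<times> denoms) (loc_rel R P)"
proof (rule equivI)
  show "loc_rel R P \<subseteq> (carrier R \<times> denoms) \<times> (carrier R \<times> denoms)" using loc_rel_iff by auto
  show "refl_on (carrier R \<times> denoms) (loc_rel R P)" by (rule refl_onI) (auto simp: loc_rel_iff)
  show "sym (loc_rel R P)" by (rule symI) (auto simp: loc_rel_iff)
  show "trans (loc_rel R P)"
  proof (rule transI)
    fix x y z assume xy: "(x, y) \<in> loc_rel R P" and yz: "(y, z) \<in> loc_rel R P"
    obtain r s where x: "x = (r, s)" by (cases x)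
    obtain r' s' where y: "y = (r', s')" by (cases y)
    obtain r'' s'' where z: "z = (r'', s'')" by (cases z)
    have c: "r \<in> carrier R" "r' \<in> carrier R" "r'' \<in> carrier R" "s \<in> denoms" "s' \<in> denoms" "s'' \<in> denoms"
      and e: "r \<otimes> s' = r' \<otimes> s" "r' \<otimes> s'' = r'' \<otimes> s'"
      using xy yz unfolding x y z loc_rel_iff by auto
    note d = denomsD(1)[OF c(4)] denomsD(1)[OF c(5)] denomsD(1)[OF c(6)]
    \<comment> \<open>transitivity after cancelling the middle denominator\<close>
    have "s' \<otimes> (r \<otimes> s'') = (r \<otimes> s') \<otimes> s''" using c(1-3) d by (simp add: m_ac)
    also have "\<dots> = s \<otimes> (r' \<otimes> s'')" unfolding e(1) using c(1-3) d by (simp add: m_ac)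
    also have "\<dots> = s' \<otimes> (r'' \<otimes> s)" unfolding e(2) using c(1-3) d by (simp add: m_ac)
    finally have "r \<otimes> s'' = r'' \<otimes> s" using m_lcancel[OF denomsD(3)[OF c(5)] d(2)] c(1-3) d by simp
    then show "(x, z) \<in> loc_rel R P" unfolding x z loc_rel_iff using c by simp
  qed
qed

lemma frac_eq:
  assumes "r \<in> carrier R" "s \<in> denoms" "r' \<in> carrier R" "s' \<in> denoms"
  shows "fr r s = fr r' s' \<longleftrightarrow> r \<otimes> s' = r' \<otimes> s"
  unfolding loc_frac_def using eq_equiv_class_iff[OF equiv_loc_rel, of "(r, s)" "(r', s')"] assms
  by (auto simp: loc_rel_iff)

lemma carrier_L: "carrier L = {fr r s | r s. r \<in> carrier R \<and> s \<in> denoms}"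
  unfolding localization_def loc_frac_def quotient_def denoms_def by auto

lemma frac_closed: "\<lbrakk>r \<in> carrier R; s \<in> denoms\<rbrakk> \<Longrightarrow> fr r s \<in> carrier L"
  unfolding carrier_L by blast

lemma carrier_L_E:
  assumes "x \<in> carrier L"
  obtains r s where "r \<in> carrier R" "s \<in> denoms" "x = fr r s"
  using assms unfolding carrier_L by blast

text \<open>
  The operations on fractions are unions over representatives. Such a union is the common value of its members.
\<close>

lemma UN_frac:
  assumes a: "r \<in> carrier R" "s \<in> denoms" "r' \<in> carrier R" "s' \<in> denoms"
    and F: "\<And>x y x' y'. \<lbrakk>x \<in> carrier R; y \<in> denoms; x' \<in> carrier R; y' \<in> denoms;
         r \<otimes> y = x \<otimes> s; r' \<otimes> y' = x' \<otimes> s'\<rbrakk> \<Longrightarrow> F x y x' y' = (C :: ('a \<times> 'a) set)"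
  shows "(\<Union>(x, y)\<in>fr r s. \<Union>(x', y')\<in>fr r' s'. F x y x' y') = C"
proof -
  have m: "(x, y) \<in> fr r s \<longleftrightarrow> x \<in> carrier R \<and> y \<in> denoms \<and> r \<otimes> y = x \<otimes> s"
    if "r \<in> carrier R" "s \<in> denoms" for x y r s
    using that unfolding loc_frac_def by (auto simp: loc_rel_iff)
  have FC: "F x y x' y' = C" if "(x, y) \<in> fr r s" "(x', y') \<in> fr r' s'" for x y x' y'
    using that F unfolding m[OF a(1,2)] m[OF a(3,4)] by blast
  have rs: "(r, s) \<in> fr r s" "(r', s') \<in> fr r' s'" using a by (auto simp: m)
  show ?thesis
  proof (intro equalityI subsetI)
    fix z assume "z \<in> (\<Union>(x, y)\<in>fr r s. \<Union>(x', y')\<in>fr r' s'. F x y x' y')"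
    then obtain x y x' y' where "(x, y) \<in> fr r s" "(x', y') \<in> fr r' s'" "z \<in> F x y x' y'" by blast
    then show "z \<in> C" using FC by simp
  next
    fix z assume "z \<in> C"
    then have "z \<in> F r s r' s'" using FC[OF rs] by simp
    then show "z \<in> (\<Union>(x, y)\<in>fr r s. \<Union>(x', y')\<in>fr r' s'. F x y x' y')" using rs by blast
  qed
qed

lemma mult_frac:
  assumes a: "r \<in> carrier R" "s \<in> denoms" "r' \<in> carrier R" "s' \<in> denoms"
  shows "fr r s \<otimes>\<^bsub>L\<^esub> fr r' s' = fr (r \<otimes> r') (s \<otimes> s')"
proof -
  have "fr r s \<otimes>\<^bsub>L\<^esub> fr r' s' = (\<Union>(x, y)\<in>fr r s. \<Union>(x', y')\<in>fr r' s'. fr (x \<otimes> x') (y \<otimes> y'))"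
    by (simp add: localization_def)
  also have "\<dots> = fr (r \<otimes> r') (s \<otimes> s')"
  proof (rule UN_frac[OF a])
    fix x y x' y' assume c: "x \<in> carrier R" "y \<in> denoms" "x' \<in> carrier R" "y' \<in> denoms"
      and e: "r \<otimes> y = x \<otimes> s" "r' \<otimes> y' = x' \<otimes> s'"
    note d = denomsD(1)[OF a(2)] denomsD(1)[OF a(4)] denomsD(1)[OF c(2)] denomsD(1)[OF c(4)]
    have "(x \<otimes> x') \<otimes> (s \<otimes> s') = (x \<otimes> s) \<otimes> (x' \<otimes> s')" using a c d by (simp add: m_ac)
    also have "\<dots> = (r \<otimes> r') \<otimes> (y \<otimes> y')" unfolding e[symmetric] using a c d by (simp add: m_ac)
    finally show "fr (x \<otimes> x') (y \<otimes> y') = fr (r \<otimes> r') (s \<otimes> s')"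
      using a c by (subst frac_eq) auto
  qed
  finally show ?thesis .
qed

lemma add_frac:
  assumes a: "r \<in> carrier R" "s \<in> denoms" "r' \<in> carrier R" "s' \<in> denoms"
  shows "fr r s \<oplus>\<^bsub>L\<^esub> fr r' s' = fr (r \<otimes> s' \<oplus> r' \<otimes> s) (s \<otimes> s')"
proof -
  have "fr r s \<oplus>\<^bsub>L\<^esub> fr r' s' = (\<Union>(x, y)\<in>fr r s. \<Union>(x', y')\<in>fr r' s'. fr (x \<otimes> y' \<oplus> x' \<otimes> y) (y \<otimes> y'))"
    by (simp add: localization_def)
  also have "\<dots> = fr (r \<otimes> s' \<oplus> r' \<otimes> s) (s \<otimes> s')"
  proof (rule UN_frac[OF a])
    fix x y x' y' assume c: "x \<in> carrier R" "y \<in> denoms" "x' \<in> carrier R" "y' \<in> denoms"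
      and e: "r \<otimes> y = x \<otimes> s" "r' \<otimes> y' = x' \<otimes> s'"
    note d = denomsD(1)[OF a(2)] denomsD(1)[OF a(4)] denomsD(1)[OF c(2)] denomsD(1)[OF c(4)]
    have "(x \<otimes> y' \<oplus> x' \<otimes> y) \<otimes> (s \<otimes> s') = (x \<otimes> s) \<otimes> (y' \<otimes> s') \<oplus> (x' \<otimes> s') \<otimes> (y \<otimes> s)"
      using a(1,3) c(1,3) d by algebra
    also have "\<dots> = (r \<otimes> s' \<oplus> r' \<otimes> s) \<otimes> (y \<otimes> y')"
      unfolding e[symmetric] using a(1,3) c(1,3) d by algebra
    finally show "fr (x \<otimes> y' \<oplus> x' \<otimes> y) (y \<otimes> y') = fr (r \<otimes> s' \<oplus> r' \<otimes> s) (s \<otimes> s')"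
      using a c d by (subst frac_eq) auto
  qed
  finally show ?thesis .
qed

lemma zero_L: "\<zero>\<^bsub>L\<^esub> = fr \<zero> \<one>" and one_L: "\<one>\<^bsub>L\<^esub> = fr \<one> \<one>"
  by (simp_all add: localization_def)

lemma frac_eq_zero:
  "\<lbrakk>r \<in> carrier R; s \<in> denoms\<rbrakk> \<Longrightarrow> fr r s = \<zero>\<^bsub>L\<^esub> \<longleftrightarrow> r = \<zero>"
  unfolding zero_L using denomsD(1)[of s] by (subst frac_eq) auto

lemma frac_cancel:
  "\<lbrakk>r \<in> carrier R; s \<in> denoms; t \<in> denoms\<rbrakk> \<Longrightarrow> fr (t \<otimes> r) (t \<otimes> s) = fr r s"
  using denomsD(1) by (subst frac_eq) (auto simp: m_ac)

lemma domain_L: "domain L"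
proof -
  have ab: "abelian_group L"
  proof (rule abelian_groupI)
    fix x y z assume xyz: "x \<in> carrier L" "y \<in> carrier L" "z \<in> carrier L"
    obtain r s where x: "r \<in> carrier R" "s \<in> denoms" "x = fr r s" using carrier_L_E[OF xyz(1)] by blast
    obtain r' s' where y: "r' \<in> carrier R" "s' \<in> denoms" "y = fr r' s'" using carrier_L_E[OF xyz(2)] by blast
    obtain r'' s'' where z: "r'' \<in> carrier R" "s'' \<in> denoms" "z = fr r'' s''" using carrier_L_E[OF xyz(3)] by blast
    note d = denomsD(1)[OF x(2)] denomsD(1)[OF y(2)] denomsD(1)[OF z(2)]
    show "x \<oplus>\<^bsub>L\<^esub> y \<oplus>\<^bsub>L\<^esub> z = x \<oplus>\<^bsub>L\<^esub> (y \<oplus>\<^bsub>L\<^esub> z)"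
    proof -
      have e: "(r \<otimes> s' \<oplus> r' \<otimes> s) \<otimes> s'' \<oplus> r'' \<otimes> (s \<otimes> s') = r \<otimes> (s' \<otimes> s'') \<oplus> (r' \<otimes> s'' \<oplus> r'' \<otimes> s') \<otimes> s"
        using x(1) y(1) z(1) d by algebra
      show ?thesis using x y z d e by (simp add: add_frac m_assoc)
    qed
  next
    fix x y assume xyz: "x \<in> carrier L" "y \<in> carrier L"
    obtain r s where x: "r \<in> carrier R" "s \<in> denoms" "x = fr r s" using carrier_L_E[OF xyz(1)] by blast
    obtain r' s' where y: "r' \<in> carrier R" "s' \<in> denoms" "y = fr r' s'" using carrier_L_E[OF xyz(2)] by blast
    note d = denomsD(1)[OF x(2)] denomsD(1)[OF y(2)]
    show "x \<oplus>\<^bsub>L\<^esub> y \<in> carrier L" using x y d by (simp add: add_frac frac_closed)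
    show "x \<oplus>\<^bsub>L\<^esub> y = y \<oplus>\<^bsub>L\<^esub> x" using x y d by (simp add: add_frac m_comm a_comm)
  next
    fix x assume "x \<in> carrier L"
    then obtain r s where x: "r \<in> carrier R" "s \<in> denoms" "x = fr r s" by (elim carrier_L_E)
    note d = denomsD(1)[OF x(2)]
    show "\<zero>\<^bsub>L\<^esub> \<oplus>\<^bsub>L\<^esub> x = x" using x d by (simp add: zero_L add_frac)
    have "fr (\<ominus> r) s \<oplus>\<^bsub>L\<^esub> x = \<zero>\<^bsub>L\<^esub>"
      using x d by (simp add: add_frac frac_eq_zero l_minus l_neg)
    then show "\<exists>y\<in>carrier L. y \<oplus>\<^bsub>L\<^esub> x = \<zero>\<^bsub>L\<^esub>"
      by (rule bexI) (use x frac_closed in simp)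
  qed (simp add: zero_L frac_closed)
  have cm: "comm_monoid L"
  proof (rule comm_monoidI)
    fix x y z assume xyz: "x \<in> carrier L" "y \<in> carrier L" "z \<in> carrier L"
    obtain r s where x: "r \<in> carrier R" "s \<in> denoms" "x = fr r s" using carrier_L_E[OF xyz(1)] by blast
    obtain r' s' where y: "r' \<in> carrier R" "s' \<in> denoms" "y = fr r' s'" using carrier_L_E[OF xyz(2)] by blast
    obtain r'' s'' where z: "r'' \<in> carrier R" "s'' \<in> denoms" "z = fr r'' s''" using carrier_L_E[OF xyz(3)] by blast
    note d = denomsD(1)[OF x(2)] denomsD(1)[OF y(2)] denomsD(1)[OF z(2)]
    show "x \<otimes>\<^bsub>L\<^esub> y \<otimes>\<^bsub>L\<^esub> z = x \<otimes>\<^bsub>L\<^esub> (y \<otimes>\<^bsub>L\<^esub> z)"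
      using x y z d by (simp add: mult_frac m_assoc)
  next
    fix x y assume xyz: "x \<in> carrier L" "y \<in> carrier L"
    obtain r s where x: "r \<in> carrier R" "s \<in> denoms" "x = fr r s" using carrier_L_E[OF xyz(1)] by blast
    obtain r' s' where y: "r' \<in> carrier R" "s' \<in> denoms" "y = fr r' s'" using carrier_L_E[OF xyz(2)] by blast
    note d = denomsD(1)[OF x(2)] denomsD(1)[OF y(2)]
    show "x \<otimes>\<^bsub>L\<^esub> y \<in> carrier L" using x y d by (simp add: mult_frac frac_closed)
    show "x \<otimes>\<^bsub>L\<^esub> y = y \<otimes>\<^bsub>L\<^esub> x" using x y d by (simp add: mult_frac m_comm)
  next
    fix x assume "x \<in> carrier L"
    then obtain r s where x: "r \<in> carrier R" "s \<in> denoms" "x = fr r s" by (elim carrier_L_E)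
    show "\<one>\<^bsub>L\<^esub> \<otimes>\<^bsub>L\<^esub> x = x" using x denomsD(1)[OF x(2)] by (simp add: one_L mult_frac)
  qed (simp add: one_L frac_closed)
  have cr: "cring L"
  proof (rule cringI[OF ab cm])
    fix x y z assume xyz: "x \<in> carrier L" "y \<in> carrier L" "z \<in> carrier L"
    obtain r s where x: "r \<in> carrier R" "s \<in> denoms" "x = fr r s" using carrier_L_E[OF xyz(1)] by blast
    obtain r' s' where y: "r' \<in> carrier R" "s' \<in> denoms" "y = fr r' s'" using carrier_L_E[OF xyz(2)] by blast
    obtain r'' s'' where z: "r'' \<in> carrier R" "s'' \<in> denoms" "z = fr r'' s''" using carrier_L_E[OF xyz(3)] by blast
    note d = denomsD(1)[OF x(2)] denomsD(1)[OF y(2)] denomsD(1)[OF z(2)]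
    have "((r \<otimes> s' \<oplus> r' \<otimes> s) \<otimes> r'') \<otimes> ((s \<otimes> s'') \<otimes> (s' \<otimes> s''))
        = ((r \<otimes> r'') \<otimes> (s' \<otimes> s'') \<oplus> (r' \<otimes> r'') \<otimes> (s \<otimes> s'')) \<otimes> ((s \<otimes> s') \<otimes> s'')"
      using x(1) y(1) z(1) d by algebra
    then show "(x \<oplus>\<^bsub>L\<^esub> y) \<otimes>\<^bsub>L\<^esub> z = x \<otimes>\<^bsub>L\<^esub> z \<oplus>\<^bsub>L\<^esub> y \<otimes>\<^bsub>L\<^esub> z"
      using x y z d by (simp add: add_frac mult_frac frac_eq)
  qed
  show ?thesis
  proof (rule domainI[OF cr])
    show "\<one>\<^bsub>L\<^esub> \<noteq> \<zero>\<^bsub>L\<^esub>" unfolding one_L using frac_eq_zero[of \<one> \<one>] by simp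
    fix x y assume xy: "x \<otimes>\<^bsub>L\<^esub> y = \<zero>\<^bsub>L\<^esub>" and xyz: "x \<in> carrier L" "y \<in> carrier L"
    obtain r s where x: "r \<in> carrier R" "s \<in> denoms" "x = fr r s" using carrier_L_E[OF xyz(1)] by blast
    obtain r' s' where y: "r' \<in> carrier R" "s' \<in> denoms" "y = fr r' s'" using carrier_L_E[OF xyz(2)] by blast
    have "r \<otimes> r' = \<zero>" using xy x y by (simp add: mult_frac frac_eq_zero)
    then show "x = \<zero>\<^bsub>L\<^esub> \<or> y = \<zero>\<^bsub>L\<^esub>" using integral x y by (auto simp: frac_eq_zero)
  qed
qed

sublocale L: "domain" L by (rule domain_L)

definition "emb r = fr r \<one>"

lemma emb_hom: "ring_hom_cring R L emb"
proof -
  interpret ring_hom_ring R L emb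
    by (rule ring_hom_ringI)
      (auto simp: emb_def frac_closed mult_frac add_frac one_L ring_axioms L.ring_axioms)
  show ?thesis by (rule ring_hom_cringI[OF is_cring L.is_cring homh])
qed

sublocale emb: ring_hom_cring R L emb by (rule emb_hom)

lemma frac_emb: "\<lbrakk>r \<in> carrier R; s \<in> denoms\<rbrakk> \<Longrightarrow> fr r s = fr \<one> s \<otimes>\<^bsub>L\<^esub> emb r"
  using denomsD(1) by (simp add: emb_def mult_frac)

lemma emb_frac: "\<lbrakk>r \<in> carrier R; s \<in> denoms\<rbrakk> \<Longrightarrow> emb r = emb s \<otimes>\<^bsub>L\<^esub> fr r s"
  using denomsD(1) frac_cancel[of r \<one> s] by (simp add: emb_def mult_frac)

definition "mL = {fr r s | r s. r \<in> P \<and> s \<in> denoms}"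

lemma frac_in_mL: "\<lbrakk>r \<in> carrier R; s \<in> denoms\<rbrakk> \<Longrightarrow> fr r s \<in> mL \<longleftrightarrow> r \<in> P"
proof
  assume rs: "r \<in> carrier R" "s \<in> denoms" and "fr r s \<in> mL"
  then obtain p t where p: "p \<in> P" "t \<in> denoms" "fr r s = fr p t" unfolding mL_def by blast
  then have "r \<otimes> t = p \<otimes> s" using rs P.Icarr by (simp add: frac_eq)
  also have "\<dots> \<in> P" using p(1) rs denomsD(1) by (intro P.I_r_closed) auto
  finally show "r \<in> P" using P.I_prime[of r t] rs denomsD(1,2)[OF p(2)] by blast
qed (auto simp: mL_def)

lemma unit_outside_mL:
  assumes "x \<in> carrier L" "x \<notin> mL"
  shows "x \<in> Units L"
proof -
  obtain r s where x: "r \<in> carrier R" "s \<in> denoms" "x = fr r s" using assms(1) by (rule carrier_L_E)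
  then have r: "r \<in> denoms" using assms(2) frac_in_mL by (simp add: denoms_def)
  have "fr s r \<otimes>\<^bsub>L\<^esub> x = \<one>\<^bsub>L\<^esub>"
    unfolding one_L x(3) using x r denomsD(1)[OF x(2)] by (simp add: mult_frac frac_eq m_comm)
  then show ?thesis using assms(1) frac_closed[of s r] denomsD(1)[OF x(2)] r
    using L.m_comm[of x "fr s r"] unfolding Units_def by auto
qed

lemma maximal_mL: "maximalideal mL L"
proof -
  have sub: "mL \<subseteq> carrier L" unfolding mL_def using frac_closed P.Icarr by blast
  have I: "ideal mL L"
  proof (rule idealI[OF L.ring_axioms])
    show "subgroup mL (add_monoid L)"
    proof (rule L.add.subgroupI)
      show "mL \<subseteq> carrier L" by (rule sub)
      show "mL \<noteq> {}" using frac_in_mL[OF zero_closed one_denoms] P.zero_closed by blast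
      fix x assume "x \<in> mL"
      then obtain p t where p: "p \<in> P" "t \<in> denoms" "x = fr p t" unfolding mL_def by blast
      have pc: "p \<in> carrier R" using p(1) P.Icarr by blast
      have "fr (\<ominus> p) t \<oplus>\<^bsub>L\<^esub> x = \<zero>\<^bsub>L\<^esub>"
        using p(2,3) pc denomsD(1)[OF p(2)] by (simp add: add_frac frac_eq_zero l_minus l_neg)
      then have "\<ominus>\<^bsub>L\<^esub> x = fr (\<ominus> p) t"
        using L.minus_equality[of "fr (\<ominus> p) t" x] p pc frac_closed by simp
      then show "\<ominus>\<^bsub>L\<^esub> x \<in> mL"
        using frac_in_mL[of "\<ominus> p" t] p pc by simp
      fix y assume "y \<in> mL"
      then obtain q u where q: "q \<in> P" "u \<in> denoms" "y = fr q u" unfolding mL_def by blast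
      have qc: "q \<in> carrier R" using q(1) P.Icarr by blast
      have d: "t \<in> carrier R" "u \<in> carrier R" using denomsD(1) p(2) q(2) by auto
      have "p \<otimes> u \<oplus> q \<otimes> t \<in> P" using p(1) q(1) d P.I_r_closed by simp
      then show "x \<oplus>\<^bsub>L\<^esub> y \<in> mL"
        unfolding p(3) q(3) add_frac[OF pc p(2) qc q(2)] using p(2) q(2) unfolding mL_def by force
    qed
    fix x y assume "x \<in> mL" and y: "y \<in> carrier L"
    then obtain p t where p: "p \<in> P" "t \<in> denoms" "x = fr p t" unfolding mL_def by blast
    have pc: "p \<in> carrier R" using p(1) P.Icarr by blast
    obtain r s where r: "r \<in> carrier R" "s \<in> denoms" "y = fr r s" using y by (rule carrier_L_E)
    have "fr (r \<otimes> p) (s \<otimes> t) \<in> mL" using frac_in_mL p r pc P.I_l_closed by simp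
    then show yx: "y \<otimes>\<^bsub>L\<^esub> x \<in> mL" unfolding p(3) r(3) mult_frac[OF r(1,2) pc p(2)] .
    then show "x \<otimes>\<^bsub>L\<^esub> y \<in> mL" using L.m_comm[OF y] sub \<open>x \<in> mL\<close> by auto
  qed
  interpret mL: ideal mL L by fact
  show ?thesis
  proof (rule maximalidealI[OF I])
    show "carrier L \<noteq> mL"
    proof
      assume "carrier L = mL"
      then have "fr \<one> \<one> \<in> mL" using frac_closed by auto
      then show False using frac_in_mL[of \<one> \<one>] denomsD(2)[OF one_denoms] by simp
    qed
    fix J assume J: "ideal J L" "mL \<subseteq> J" "J \<subseteq> carrier L"
    interpret J: ideal J L by fact
    show "J = mL \<or> J = carrier L"
    proof (cases "J \<subseteq> mL")
      case False
      then obtain x where x: "x \<in> J" "x \<notin> mL" by blast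
      then have u: "x \<in> Units L" using unit_outside_mL J.Icarr by blast
      have "inv\<^bsub>L\<^esub> x \<otimes>\<^bsub>L\<^esub> x \<in> J" by (rule J.I_l_closed[OF x(1) L.Units_inv_closed[OF u]])
      then have "\<one>\<^bsub>L\<^esub> \<in> J" using u by simp
      then show ?thesis using J.one_imp_carrier by blast
    qed (use J in blast)
  qed
qed

lemma noetherian_L: "noetherian_ring L"
proof (rule L.noetherian_ringI)
  fix J assume J: "ideal J L"
  interpret J: ideal J L by fact
  let ?I = "{r \<in> carrier R. emb r \<in> J}"
  have "ideal ?I R" by (rule emb.ring.ideal_vimage[OF J])
  then obtain A where A: "A \<subseteq> carrier R" "finite A" "?I = Idl A" using finetely_gen by blast
  have AJ: "emb ` A \<subseteq> J" using A(3) genideal_self[OF A(1)] by blast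
  have eA: "emb ` A \<subseteq> carrier L" using A(1) emb.hom_closed by blast
  interpret K: ideal "Idl\<^bsub>L\<^esub> (emb ` A)" L by (rule L.genideal_ideal[OF eA])
  have IK: "?I \<subseteq> {r \<in> carrier R. emb r \<in> Idl\<^bsub>L\<^esub> (emb ` A)}"
    unfolding A(3)
  proof (rule genideal_minimal)
    show "ideal {r \<in> carrier R. emb r \<in> Idl\<^bsub>L\<^esub> (emb ` A)} R" by (rule emb.ring.ideal_vimage[OF K.ideal_axioms])
    show "A \<subseteq> {r \<in> carrier R. emb r \<in> Idl\<^bsub>L\<^esub> (emb ` A)}" using A(1) L.genideal_self[OF eA] by auto
  qed
  have "J = Idl\<^bsub>L\<^esub> (emb ` A)"
  proof
    show "Idl\<^bsub>L\<^esub> (emb ` A) \<subseteq> J" by (rule L.genideal_minimal[OF J AJ])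
    show "J \<subseteq> Idl\<^bsub>L\<^esub> (emb ` A)"
    proof
      fix x assume x: "x \<in> J"
      then obtain r s where r: "r \<in> carrier R" "s \<in> denoms" "x = fr r s" using carrier_L_E J.Icarr by blast
      have "emb r \<in> J" unfolding emb_frac[OF r(1,2)] using x r denomsD(1)
        by (intro J.I_l_closed) auto
      then have "emb r \<in> Idl\<^bsub>L\<^esub> (emb ` A)" using IK r(1) by blast
      then show "x \<in> Idl\<^bsub>L\<^esub> (emb ` A)" unfolding r(3) frac_emb[OF r(1,2)]
        using frac_closed r(2) by (intro K.I_l_closed) auto
    qed
  qed
  then show "\<exists>B\<subseteq>carrier L. finite B \<and> J = Idl\<^bsub>L\<^esub> B" using eA A(2) by blast
qed

text \<open>
  An ideal of the localization is generated by its contraction, so contraction preserves strict inclusions.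
\<close>

lemma contract_prime_mono:
  assumes "ideal J L" "ideal J' L" "J \<subset> J'"
  shows "{r \<in> carrier R. emb r \<in> J} \<subset> {r \<in> carrier R. emb r \<in> J'}"
proof -
  interpret J: ideal J L by fact
  interpret J': ideal J' L by fact
  obtain x where x: "x \<in> J'" "x \<notin> J" using assms(3) by blast
  obtain r s where r: "r \<in> carrier R" "s \<in> denoms" "x = fr r s" using carrier_L_E J'.Icarr[OF x(1)] by blast
  have "emb r \<in> J'" unfolding emb_frac[OF r(1,2)] using x(1) r denomsD(1) by (intro J'.I_l_closed) auto
  moreover have "emb r \<notin> J"
  proof
    assume "emb r \<in> J"
    then have "x \<in> J" unfolding r(3) frac_emb[OF r(1,2)] using frac_closed r(2) by (intro J.I_l_closed) auto
    with x(2) show False ..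
  qed
  ultimately show ?thesis using assms(3) r(1) by blast
qed

lemma contract_prime:
  assumes J: "primeideal J L"
  shows "primeideal {r \<in> carrier R. emb r \<in> J} R"
proof -
  interpret J: primeideal J L by fact
  show ?thesis
  proof (rule primeidealI[OF emb.ring.ideal_vimage[OF J.ideal_axioms] is_cring])
    have "\<one> \<notin> {r \<in> carrier R. emb r \<in> J}" using J.one_imp_carrier J.I_notcarr by auto
    then show "carrier R \<noteq> {r \<in> carrier R. emb r \<in> J}" using one_closed by metis
    fix x y assume xy: "x \<in> carrier R" "y \<in> carrier R" "x \<otimes> y \<in> {r \<in> carrier R. emb r \<in> J}"
    then have "emb x \<otimes>\<^bsub>L\<^esub> emb y \<in> J" by simp
    then show "x \<in> {r \<in> carrier R. emb r \<in> J} \<or> y \<in> {r \<in> carrier R. emb r \<in> J}"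
      using J.I_prime[of "emb x" "emb y"] xy by auto
  qed
qed

lemma regular_pair_L:
  assumes reg: "regular_pair R x y"
  shows "regular_pair L (emb x) (emb y)"
proof -
  have c: "x \<in> carrier R" "y \<in> carrier R" using reg by (auto simp: regular_pair_def)
  show ?thesis unfolding regular_pair_def
  proof (intro conjI ballI impI)
    fix a assume a: "a \<in> carrier L" "a \<otimes>\<^bsub>L\<^esub> emb x = \<zero>\<^bsub>L\<^esub>"
    obtain r s where r: "r \<in> carrier R" "s \<in> denoms" "a = fr r s" using a(1) by (rule carrier_L_E)
    have "r \<otimes> x = \<zero>" using a(2) r c denomsD(1)[OF r(2)] by (simp add: emb_def mult_frac frac_eq_zero)
    then show "a = \<zero>\<^bsub>L\<^esub>" using reg r unfolding regular_pair_def by (simp add: frac_eq_zero)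
  next
    fix a b assume ab: "a \<in> carrier L" "b \<in> carrier L" "a \<otimes>\<^bsub>L\<^esub> emb y = b \<otimes>\<^bsub>L\<^esub> emb x"
    obtain r s where r: "r \<in> carrier R" "s \<in> denoms" "a = fr r s" using ab(1) by (rule carrier_L_E)
    obtain r' s' where r': "r' \<in> carrier R" "s' \<in> denoms" "b = fr r' s'" using ab(2) by (rule carrier_L_E)
    note d = denomsD(1)[OF r(2)] denomsD(1)[OF r'(2)]
    have "fr (r \<otimes> y) s = fr (r' \<otimes> x) s'"
      using ab(3) r r' c d by (simp add: emb_def mult_frac)
    then have "(r \<otimes> y) \<otimes> s' = (r' \<otimes> x) \<otimes> s" using r r' c by (simp add: frac_eq)
    then have "(r \<otimes> s') \<otimes> y = (r' \<otimes> s) \<otimes> x" using r(1) r'(1) c d by (simp add: m_ac)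
    then obtain t where t: "t \<in> carrier R" "r \<otimes> s' = t \<otimes> x"
      using regular_pair_quotient[OF reg, of "r \<otimes> s'" "r' \<otimes> s"] r(1) r'(1) d by auto
    have "a = fr (s' \<otimes> r) (s' \<otimes> s)" unfolding r(3) using frac_cancel r r' by simp
    also have "s' \<otimes> r = t \<otimes> x" using t d r by (simp add: m_comm)
    also have "fr (t \<otimes> x) (s' \<otimes> s) = fr t (s' \<otimes> s) \<otimes>\<^bsub>L\<^esub> emb x"
      using t(1) c r(2) r'(2) d by (simp add: emb_def mult_frac)
    finally show "\<exists>t\<in>carrier L. a = t \<otimes>\<^bsub>L\<^esub> emb x"
      using frac_closed[OF t(1) mult_denoms[OF r'(2) r(2)]] by blast
  qed (use c in auto)
qed

lemma finsum_frac:
  assumes "c \<in> {..<n} \<rightarrow> carrier R" "b \<in> {..<n} \<rightarrow> carrier R" "s \<in> denoms"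
  shows "(\<Oplus>\<^bsub>L\<^esub>i\<in>{..<n::nat}. fr (c i) s \<otimes>\<^bsub>L\<^esub> emb (b i)) = fr (\<Oplus>i\<in>{..<n}. c i \<otimes> b i) s"
  using assms(1,2)
proof (induction n)
  case 0 then show ?case using assms(3) frac_eq_zero[of \<zero> s] by simp
next
  case (Suc n)
  have c: "c i \<in> carrier R" "b i \<in> carrier R" if "i < Suc n" for i using Suc.prems that by auto
  have sc: "s \<in> carrier R" by (rule denomsD(1)[OF assms(3)])
  have IH: "(\<Oplus>\<^bsub>L\<^esub>i\<in>{..<n}. fr (c i) s \<otimes>\<^bsub>L\<^esub> emb (b i)) = fr (\<Oplus>i\<in>{..<n}. c i \<otimes> b i) s"
    by (rule Suc.IH) (use c in auto)
  have S: "(\<Oplus>i\<in>{..<n}. c i \<otimes> b i) \<in> carrier R" using c by (intro finsum_closed) auto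
  have L: "fr (c i) s \<otimes>\<^bsub>L\<^esub> emb (b i) \<in> carrier L" if "i < Suc n" for i
    using c[OF that] frac_closed assms(3) by auto
  have "(\<Oplus>\<^bsub>L\<^esub>i\<in>{..<Suc n}. fr (c i) s \<otimes>\<^bsub>L\<^esub> emb (b i))
      = fr (c n) s \<otimes>\<^bsub>L\<^esub> emb (b n) \<oplus>\<^bsub>L\<^esub> fr (\<Oplus>i\<in>{..<n}. c i \<otimes> b i) s"
    unfolding IH[symmetric] lessThan_Suc using L by (subst L.finsum_insert) auto
  also have "\<dots> = fr (s \<otimes> (c n \<otimes> b n \<oplus> (\<Oplus>i\<in>{..<n}. c i \<otimes> b i))) (s \<otimes> s)"
  proof -
    have "fr (c n) s \<otimes>\<^bsub>L\<^esub> emb (b n) = fr (c n \<otimes> b n) s"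
      using c[of n] sc assms(3) by (simp add: emb_def mult_frac)
    moreover have "(c n \<otimes> b n) \<otimes> s \<oplus> (\<Oplus>i\<in>{..<n}. c i \<otimes> b i) \<otimes> s = s \<otimes> (c n \<otimes> b n \<oplus> (\<Oplus>i\<in>{..<n}. c i \<otimes> b i))"
      using c[of n] S sc by (simp add: r_distr m_comm[of s])
    ultimately show ?thesis using add_frac[OF _ assms(3) S assms(3), of "c n \<otimes> b n"] c[of n] by simp
  qed
  also have "\<dots> = fr (c n \<otimes> b n \<oplus> (\<Oplus>i\<in>{..<n}. c i \<otimes> b i)) s"
    by (rule frac_cancel) (use c[of n] S assms(3) in auto)
  also have "c n \<otimes> b n \<oplus> (\<Oplus>i\<in>{..<n}. c i \<otimes> b i) = (\<Oplus>i\<in>{..<Suc n}. c i \<otimes> b i)"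
    unfolding lessThan_Suc using c by (subst finsum_insert) auto
  finally show ?case .
qed

lemma common_denominator:
  assumes "c \<in> {..<n::nat} \<rightarrow> carrier L"
  shows "\<exists>s\<in>denoms. \<exists>r\<in>{..<n} \<rightarrow> carrier R. \<forall>i<n. c i = fr (r i) s"
  using assms
proof (induction n)
  case 0 show ?case by (intro bexI[OF _ one_denoms]) auto
next
  case (Suc n)
  have "c \<in> {..<n} \<rightarrow> carrier L" using Suc.prems by auto
  from Suc.IH[OF this] obtain s r where s: "s \<in> denoms" "r \<in> {..<n} \<rightarrow> carrier R" "\<forall>i<n. c i = fr (r i) s"
    by blast
  obtain q t where q: "q \<in> carrier R" "t \<in> denoms" "c n = fr q t"
    using carrier_L_E[of "c n"] Suc.prems by auto
  have d: "s \<in> carrier R" "t \<in> carrier R" using denomsD(1) s(1) q(2) by auto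
  define r' where "r' = (\<lambda>i. if i = n then s \<otimes> q else t \<otimes> r i)"
  have "c i = fr (r' i) (t \<otimes> s)" if "i < Suc n" for i
  proof (cases "i = n")
    case True
    have "fr (s \<otimes> q) (t \<otimes> s) = fr (s \<otimes> q) (s \<otimes> t)" using d by (simp add: m_comm)
    also have "\<dots> = c i" using frac_cancel[OF q(1,2) s(1)] q(3) True by simp
    finally show ?thesis using True by (simp add: r'_def)
  next
    case False
    then have "i < n" using that by simp
    then show ?thesis using frac_cancel[of "r i" s t] s q(2) False by (auto simp: r'_def)
  qed
  moreover have "r' \<in> {..<Suc n} \<rightarrow> carrier R"
  proof
    fix i assume i: "i \<in> {..<Suc n}"
    show "r' i \<in> carrier R"
    proof (cases "i = n")
      case False
      then have "r i \<in> carrier R" using i s(2) by auto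
      then show ?thesis using False d by (simp add: r'_def)
    qed (use q(1) d in \<open>simp add: r'_def\<close>)
  qed
  ultimately show ?case using mult_denoms[OF q(2) s(1)] by blast
qed

lemma frac_in_ext:
  assumes c: "x \<in> carrier R" "y \<in> carrier R" and r: "r \<in> carrier R" "s \<in> denoms"
  shows "fr r s \<in> Idl\<^bsub>L\<^esub> {emb x, emb y} \<longleftrightarrow> (\<exists>t\<in>denoms. t \<otimes> r \<in> Idl {x, y})"
proof
  have ec: "emb x \<in> carrier L" "emb y \<in> carrier L" using c by auto
  interpret K: ideal "Idl\<^bsub>L\<^esub> {emb x, emb y}" L by (rule L.ideal_pair[OF ec])
  { assume "\<exists>t\<in>denoms. t \<otimes> r \<in> Idl {x, y}"
    then obtain t p q where t: "t \<in> denoms" "p \<in> carrier R" "q \<in> carrier R" "t \<otimes> r = p \<otimes> x \<oplus> q \<otimes> y"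
      unfolding Idl_pair[OF c] by blast
    have "fr r s = fr (t \<otimes> r) (t \<otimes> s)" by (rule frac_cancel[OF r t(1), symmetric])
    also have "\<dots> = fr \<one> (t \<otimes> s) \<otimes>\<^bsub>L\<^esub> emb (t \<otimes> r)"
      by (rule frac_emb) (use t(1) r denomsD(1) in simp_all)
    also have "emb (t \<otimes> r) = emb p \<otimes>\<^bsub>L\<^esub> emb x \<oplus>\<^bsub>L\<^esub> emb q \<otimes>\<^bsub>L\<^esub> emb y"
      unfolding t(4) using t c by simp
    finally have e: "fr r s = fr \<one> (t \<otimes> s) \<otimes>\<^bsub>L\<^esub> (emb p \<otimes>\<^bsub>L\<^esub> emb x \<oplus>\<^bsub>L\<^esub> emb q \<otimes>\<^bsub>L\<^esub> emb y)" .
    have "emb p \<otimes>\<^bsub>L\<^esub> emb x \<oplus>\<^bsub>L\<^esub> emb q \<otimes>\<^bsub>L\<^esub> emb y \<in> Idl\<^bsub>L\<^esub> {emb x, emb y}"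
      unfolding L.Idl_pair[OF ec] using emb.hom_closed t(2,3) by blast
    then show "fr r s \<in> Idl\<^bsub>L\<^esub> {emb x, emb y}"
      unfolding e using frac_closed t(1) r by (intro K.I_l_closed) auto }
  assume "fr r s \<in> Idl\<^bsub>L\<^esub> {emb x, emb y}"
  then obtain a b where ab: "a \<in> carrier L" "b \<in> carrier L" "fr r s = a \<otimes>\<^bsub>L\<^esub> emb x \<oplus>\<^bsub>L\<^esub> b \<otimes>\<^bsub>L\<^esub> emb y"
    unfolding L.Idl_pair[OF ec] by blast
  obtain p u where p: "p \<in> carrier R" "u \<in> denoms" "a = fr p u" using ab(1) by (rule carrier_L_E)
  obtain q v where q: "q \<in> carrier R" "v \<in> denoms" "b = fr q v" using ab(2) by (rule carrier_L_E)
  note d = denomsD(1)[OF r(2)] denomsD(1)[OF p(2)] denomsD(1)[OF q(2)]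
  have "fr r s = fr ((p \<otimes> x) \<otimes> v \<oplus> (q \<otimes> y) \<otimes> u) (u \<otimes> v)"
    unfolding ab(3) p(3) q(3) emb_def using p q c d by (simp add: mult_frac add_frac)
  then have "r \<otimes> (u \<otimes> v) = ((p \<otimes> x) \<otimes> v \<oplus> (q \<otimes> y) \<otimes> u) \<otimes> s"
    using r p q c d by (simp add: frac_eq)
  also have "\<dots> = ((p \<otimes> v) \<otimes> s) \<otimes> x \<oplus> ((q \<otimes> u) \<otimes> s) \<otimes> y" using p(1) q(1) c d by algebra
  also have "\<dots> \<in> Idl {x, y}" unfolding Idl_pair[OF c] using p(1) q(1) d by blast
  finally have "(u \<otimes> v) \<otimes> r \<in> Idl {x, y}" using r d by (simp add: m_comm)
  then show "\<exists>t\<in>denoms. t \<otimes> r \<in> Idl {x, y}" using p(2) q(2) mult_denoms by blast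
qed

text \<open>
  Clearing the denominators of the finitely many equations \<open>a v \<in> I L\<close>, for \<open>a\<close> in a generating
  set of \<open>P\<close>, lifts an element of the socle of the localized quotient to the ring itself.
\<close>

lemma socle_lift:
  assumes c: "x \<in> carrier R" "y \<in> carrier R" and v: "v \<in> carrier L"
    and soc: "\<And>r. r \<in> mL \<Longrightarrow> r \<otimes>\<^bsub>L\<^esub> v \<in> Idl\<^bsub>L\<^esub> {emb x, emb y}"
  shows "\<exists>w s. w \<in> carrier R \<and> s \<in> denoms \<and> v = fr w s \<and> (\<forall>r\<in>P. r \<otimes> w \<in> Idl {x, y})"
proof -
  let ?I = "Idl {x, y}"
  interpret I: ideal ?I R by (rule ideal_pair[OF c])
  obtain z s where z: "z \<in> carrier R" "s \<in> denoms" "v = fr z s" using v by (rule carrier_L_E)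
  obtain A where A: "A \<subseteq> carrier R" "finite A" "P = Idl A" using finetely_gen[OF P.ideal_axioms] by blast
  have AP: "A \<subseteq> P" using A genideal_self by blast
  have "\<exists>t\<in>denoms. \<forall>r\<in>A. r \<otimes> (t \<otimes> z) \<in> ?I"
    using A(2) AP
  proof (induction A rule: finite_induct)
    case empty then show ?case using one_denoms by blast
  next
    case (insert r A)
    then obtain t where t: "t \<in> denoms" "\<And>a. a \<in> A \<Longrightarrow> a \<otimes> (t \<otimes> z) \<in> ?I" by auto
    have rP: "r \<in> P" "r \<in> carrier R" using insert.prems P.Icarr by auto
    have "emb r \<in> mL" unfolding emb_def using frac_in_mL rP by simp
    then have "emb r \<otimes>\<^bsub>L\<^esub> v \<in> Idl\<^bsub>L\<^esub> {emb x, emb y}" by (rule soc)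
    moreover have "emb r \<otimes>\<^bsub>L\<^esub> v = fr (r \<otimes> z) s"
      using rP z denomsD(1)[OF z(2)] by (simp add: emb_def mult_frac)
    ultimately obtain u where u: "u \<in> denoms" "u \<otimes> (r \<otimes> z) \<in> ?I"
      using frac_in_ext[OF c, of "r \<otimes> z" s] rP(2) z(1,2) by auto
    have d: "t \<in> carrier R" "u \<in> carrier R" using denomsD(1) t(1) u(1) by auto
    have "a \<otimes> ((u \<otimes> t) \<otimes> z) \<in> ?I" if a: "a \<in> insert r A" for a
    proof (cases "a = r")
      case True
      have "a \<otimes> ((u \<otimes> t) \<otimes> z) = t \<otimes> (u \<otimes> (r \<otimes> z))" using True d z(1) rP(2) by (simp add: m_ac)
      then show ?thesis using I.I_l_closed[OF u(2) d(1)] by simp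
    next
      case False
      then have aA: "a \<in> A" using a by simp
      then have ac: "a \<in> carrier R" using insert.prems P.Icarr by auto
      have "a \<otimes> ((u \<otimes> t) \<otimes> z) = u \<otimes> (a \<otimes> (t \<otimes> z))" using d z(1) ac by (simp add: m_ac)
      then show ?thesis using I.I_l_closed[OF t(2)[OF aA] d(2)] by simp
    qed
    then show ?case using mult_denoms[OF u(1) t(1)] by blast
  qed
  then obtain t where t: "t \<in> denoms" "\<And>r. r \<in> A \<Longrightarrow> r \<otimes> (t \<otimes> z) \<in> ?I" by blast
  have tz: "t \<otimes> z \<in> carrier R" using denomsD(1)[OF t(1)] z(1) by simp
  have "P \<subseteq> {r \<in> carrier R. r \<otimes> (t \<otimes> z) \<in> ?I}"
    unfolding A(3) using t(2) A(1)
    by (intro genideal_minimal colon_ideal[OF I.ideal_axioms tz]) auto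
  then have "\<forall>r\<in>P. r \<otimes> (t \<otimes> z) \<in> ?I" by blast
  moreover have "v = fr (t \<otimes> z) (t \<otimes> s)" using frac_cancel[OF z(1,2) t(1)] z(3) by simp
  ultimately show ?thesis using tz mult_denoms[OF t(1) z(2)] by blast
qed

text \<open>
  An element of the socle of the localized quotient lifts to the ring, and independence survives because a product
  \<open>t r\<close> lies in \<open>P\<close> with \<open>t \<notin> P\<close> only if \<open>r\<close> does. The type at \<open>P\<close> can therefore be computed in the ring itself.
\<close>

lemma socle_basis_L:
  assumes c: "x \<in> carrier R" "y \<in> carrier R" and b: "socle_basis R P (Idl {x, y}) n b"
  shows "socle_basis L mL (Idl\<^bsub>L\<^esub> {emb x, emb y}) n (\<lambda>i. emb (b i))"
proof -
  let ?I = "Idl {x, y}" and ?J = "Idl\<^bsub>L\<^esub> {emb x, emb y}"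
  have ext: "fr r s \<in> ?J" if "r \<in> carrier R" "s \<in> denoms" "t \<in> denoms" "t \<otimes> r \<in> ?I" for r s t
    using frac_in_ext[OF c that(1,2)] that(3,4) by blast
  have bc: "b i \<in> carrier R" "\<And>r. r \<in> P \<Longrightarrow> r \<otimes> b i \<in> ?I" if "i < n" for i
    using b that unfolding socle_basis_def by auto
  have bn: "b \<in> {..<n} \<rightarrow> carrier R" using bc(1) by auto
  show ?thesis unfolding socle_basis_def
  proof (intro conjI allI impI ballI)
    fix i assume i: "i < n"
    show "emb (b i) \<in> carrier L" using bc(1)[OF i] by simp
    fix r assume "r \<in> mL"
    then obtain p s where p: "p \<in> P" "s \<in> denoms" "r = fr p s" unfolding mL_def by blast
    have pc: "p \<in> carrier R" using P.Icarr[OF p(1)] .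
    have "r \<otimes>\<^bsub>L\<^esub> emb (b i) = fr (p \<otimes> b i) s"
      using p(2,3) pc bc(1)[OF i] denomsD(1)[OF p(2)] by (simp add: emb_def mult_frac)
    also have "\<dots> \<in> ?J"
      by (rule ext[of _ _ \<one>]) (use pc bc[OF i] p(1,2) in auto)
    finally show "r \<otimes>\<^bsub>L\<^esub> emb (b i) \<in> ?J" .
  next
    fix v assume v: "v \<in> carrier L" "\<forall>r\<in>mL. r \<otimes>\<^bsub>L\<^esub> v \<in> ?J"
    obtain w s where w: "w \<in> carrier R" "s \<in> denoms" "v = fr w s" "\<forall>r\<in>P. r \<otimes> w \<in> ?I"
      using socle_lift[OF c v(1)] v(2) by blast
    obtain a where a: "a \<in> {..<n} \<rightarrow> carrier R" "w \<ominus> (\<Oplus>i\<in>{..<n}. a i \<otimes> b i) \<in> ?I"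
      using b w(1,4) unfolding socle_basis_def by blast
    define S where "S = (\<Oplus>i\<in>{..<n}. a i \<otimes> b i)"
    have Sc: "S \<in> carrier R" unfolding S_def by (rule finsum_in_carrier[OF a(1) bc(1)])
    have sc: "s \<in> carrier R" by (rule denomsD(1)[OF w(2)])
    have "fr (w \<ominus> S) s \<oplus>\<^bsub>L\<^esub> fr S s = fr (s \<otimes> w) (s \<otimes> s)"
    proof -
      have "(w \<ominus> S) \<otimes> s \<oplus> S \<otimes> s = s \<otimes> w" using w(1) Sc sc by algebra
      then show ?thesis using w(1,2) Sc by (simp add: add_frac)
    qed
    then have "fr (w \<ominus> S) s \<oplus>\<^bsub>L\<^esub> fr S s = v" using frac_cancel[OF w(1,2,2)] w(3) by simp
    then have v_eq: "v = fr (w \<ominus> S) s \<oplus>\<^bsub>L\<^esub> fr S s" by (rule sym)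
    have "fr (w \<ominus> S) s \<in> carrier L" "fr S s \<in> carrier L" using w(1,2) Sc by (auto intro: frac_closed)
    then have "v \<ominus>\<^bsub>L\<^esub> fr S s = fr (w \<ominus> S) s"
      unfolding v_eq by (simp add: L.minus_eq L.a_assoc L.r_neg)
    also have "\<dots> \<in> ?J" by (rule ext[of _ _ \<one>]) (use w Sc a(2) in \<open>auto simp: S_def\<close>)
    finally have "v \<ominus>\<^bsub>L\<^esub> (\<Oplus>\<^bsub>L\<^esub>i\<in>{..<n}. fr (a i) s \<otimes>\<^bsub>L\<^esub> emb (b i)) \<in> ?J"
      unfolding finsum_frac[OF a(1) bn w(2)] S_def .
    moreover have "(\<lambda>i. fr (a i) s) \<in> {..<n} \<rightarrow> carrier L" using a(1) w(2) frac_closed by auto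
    ultimately show "\<exists>c\<in>{..<n} \<rightarrow> carrier L. v \<ominus>\<^bsub>L\<^esub> (\<Oplus>\<^bsub>L\<^esub>i\<in>{..<n}. c i \<otimes>\<^bsub>L\<^esub> emb (b i)) \<in> ?J"
      by (rule bexI[of _ "\<lambda>i. fr (a i) s"])
  next
    fix a i assume a: "a \<in> {..<n} \<rightarrow> carrier L" "(\<Oplus>\<^bsub>L\<^esub>i\<in>{..<n}. a i \<otimes>\<^bsub>L\<^esub> emb (b i)) \<in> ?J" and i: "i < n"
    obtain s r where s: "s \<in> denoms" "r \<in> {..<n} \<rightarrow> carrier R" "\<And>i. i < n \<Longrightarrow> a i = fr (r i) s"
      using common_denominator[OF a(1)] by blast
    have "(\<Oplus>\<^bsub>L\<^esub>i\<in>{..<n}. a i \<otimes>\<^bsub>L\<^esub> emb (b i)) = (\<Oplus>\<^bsub>L\<^esub>i\<in>{..<n}. fr (r i) s \<otimes>\<^bsub>L\<^esub> emb (b i))"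
    proof (rule L.finsum_cong')
      show "(\<lambda>i. fr (r i) s \<otimes>\<^bsub>L\<^esub> emb (b i)) \<in> {..<n} \<rightarrow> carrier L"
      proof
        fix i assume "i \<in> {..<n}"
        then have "r i \<in> carrier R" "b i \<in> carrier R" using s(2) bn by auto
        then show "fr (r i) s \<otimes>\<^bsub>L\<^esub> emb (b i) \<in> carrier L" using frac_closed[OF _ s(1)] by simp
      qed
    qed (simp_all add: s(3))
    also have "\<dots> = fr (\<Oplus>i\<in>{..<n}. r i \<otimes> b i) s" by (rule finsum_frac[OF s(2) bn s(1)])
    finally have "fr (\<Oplus>i\<in>{..<n}. r i \<otimes> b i) s \<in> ?J" using a(2) by simp
    then obtain t where t: "t \<in> denoms" "t \<otimes> (\<Oplus>i\<in>{..<n}. r i \<otimes> b i) \<in> ?I"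
      using frac_in_ext[OF c finsum_in_carrier[of r n b, OF s(2) bc(1)] s(1)] by blast
    have tc: "t \<in> carrier R" by (rule denomsD(1)[OF t(1)])
    have tr: "(\<lambda>i. t \<otimes> r i) \<in> {..<n} \<rightarrow> carrier R" using tc s(2) by auto
    have "t \<otimes> (\<Oplus>i\<in>{..<n}. r i \<otimes> b i) = (\<Oplus>i\<in>{..<n}. t \<otimes> (r i \<otimes> b i))"
      using tc s(2) bn by (intro finsum_rdistr) auto
    also have "\<dots> = (\<Oplus>i\<in>{..<n}. (t \<otimes> r i) \<otimes> b i)"
    proof (rule finsum_cong')
      show "(\<lambda>i. (t \<otimes> r i) \<otimes> b i) \<in> {..<n} \<rightarrow> carrier R" using tr bn by auto
      fix i assume "i \<in> {..<n}"
      then have "r i \<in> carrier R" "b i \<in> carrier R" using s(2) bn by auto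
      then show "t \<otimes> (r i \<otimes> b i) = (t \<otimes> r i) \<otimes> b i" using tc by (simp add: m_assoc)
    qed simp
    finally have "(\<Oplus>i\<in>{..<n}. (t \<otimes> r i) \<otimes> b i) \<in> ?I" using t(2) by simp
    moreover have "\<forall>c\<in>{..<n} \<rightarrow> carrier R. (\<Oplus>i\<in>{..<n}. c i \<otimes> b i) \<in> ?I \<longrightarrow> (\<forall>i<n. c i \<in> P)"
      using b unfolding socle_basis_def by (elim conjE)
    ultimately have "t \<otimes> r i \<in> P" using tr i by (auto dest!: bspec[OF _ tr])
    moreover have ri: "r i \<in> carrier R" using s(2) i by auto
    ultimately have "r i \<in> P" using P.I_prime[OF tc ri] denomsD(2)[OF t(1)] by blast
    then show "a i \<in> mL" using s(3)[OF i] frac_in_mL[OF ri s(1)] by simp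
  qed
qed

lemma two_dim_local_L:
  assumes chain: "\<And>Q. \<lbrakk>\<And>i. i \<le> 3 \<Longrightarrow> primeideal (Q i) R; \<And>i. i < (3::nat) \<Longrightarrow> Q i \<subset> Q (Suc i)\<rbrakk> \<Longrightarrow> False"
    and reg: "regular_pair R x y" and xy: "x \<in> P" "y \<in> P"
  shows "two_dim_local L mL (emb x) (emb y)"
proof -
  have nd: "noetherian_domain L"
    using noetherian_L domain_L unfolding noetherian_domain_def by blast
  show ?thesis
  proof (intro two_dim_local.intro two_dim_local_axioms.intro nd)
    show "maximalideal mL L" by (rule maximal_mL)
    show "a \<in> Units L" if "a \<in> carrier L" "a \<notin> mL" for a by (rule unit_outside_mL[OF that])
    show "regular_pair L (emb x) (emb y)" by (rule regular_pair_L[OF reg])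
    show "emb x \<in> mL" "emb y \<in> mL" unfolding emb_def using frac_in_mL xy P.Icarr by auto
    fix Q assume p: "\<And>i. i \<le> 3 \<Longrightarrow> primeideal (Q i) L" and s: "\<And>i. i < (3::nat) \<Longrightarrow> Q i \<subset> Q (Suc i)"
    show False
    proof (rule chain[of "\<lambda>i. {r \<in> carrier R. emb r \<in> Q i}"])
      show "primeideal {r \<in> carrier R. emb r \<in> Q i} R" if "i \<le> 3" for i by (rule contract_prime[OF p[OF that]])
      show "{r \<in> carrier R. emb r \<in> Q i} \<subset> {r \<in> carrier R. emb r \<in> Q (Suc i)}" if "i < 3" for i
        by (rule contract_prime_mono) (use p[of i] p[of "Suc i"] s[OF that] that in \<open>auto intro: primeideal.axioms(1)\<close>)
    qed
  qed
qed

end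

section \<open>Polynomials in two variables\<close>

text \<open>
  With the lexicographic order on exponents, an ordered cancellative monoid, leading monomials
  multiply; in particular the polynomial ring becomes an instance of the class of integral domains.
\<close>

instance prod :: (linordered_cancel_ab_semigroup_add, ordered_ab_semigroup_add) ordered_ab_semigroup_add
  by standard (auto simp: less_eq_prod_def add_strict_left_mono add_left_mono)

instance prod :: ("{linordered_cancel_ab_semigroup_add, cancel_comm_monoid_add}",
    "{ordered_cancel_ab_semigroup_add, cancel_comm_monoid_add}") ordered_cancel_comm_monoid_add ..

type_synonym 'k bipoly = "(nat \<times> nat) \<Rightarrow>\<^sub>0 'k"

abbreviation "cf \<equiv> Poly_Mapping.lookup"
abbreviation "supp \<equiv> Poly_Mapping.keys"
abbreviation mon :: "nat \<times> nat \<Rightarrow> 'k::field \<Rightarrow> 'k bipoly" where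
  "mon \<equiv> Poly_Mapping.single"

lemma nscale_simps [simp]: "nscale 0 v = 0" "nscale (Suc n) v = v + nscale n v" "nscale n 0 = 0"
  by (auto simp: nscale_def zero_prod_def plus_prod_def)

lemma nscale_add: "nscale (m + n) v = nscale m v + nscale n v"
  by (simp add: nscale_def algebra_simps)

lemma sum_monomials: "p = (\<Sum>x\<in>supp p. mon x (cf p x))"
proof (rule poly_mapping_eqI)
  fix y
  have "cf (\<Sum>x\<in>supp p. mon x (cf p x)) y = (\<Sum>x\<in>supp p. if x = y then cf p x else 0)"
    unfolding lookup_sum by (intro sum.cong refl) (auto simp: lookup_single when_def)
  also have "\<dots> = cf p y" by (auto simp: in_keys_iff)
  finally show "cf p y = cf (\<Sum>x\<in>supp p. mon x (cf p x)) y" by simp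
qed

lemma cf_times: "cf (p * q) s = (\<Sum>x\<in>supp p. \<Sum>y\<in>supp q. if x + y = s then cf p x * cf q y else 0)"
  for p q :: "'k::field bipoly"
proof -
  have "p * q = (\<Sum>x\<in>supp p. mon x (cf p x)) * (\<Sum>y\<in>supp q. mon y (cf q y))"
    using sum_monomials[of p] sum_monomials[of q] by simp
  also have "\<dots> = (\<Sum>x\<in>supp p. \<Sum>y\<in>supp q. mon (x + y) (cf p x * cf q y))"
    by (simp add: sum_product mult_single)
  finally have "cf (p * q) s = (\<Sum>x\<in>supp p. \<Sum>y\<in>supp q. cf (mon (x + y) (cf p x * cf q y)) s)"
    by (simp add: lookup_sum)
  then show ?thesis by (simp add: lookup_single when_def)
qed

lemma cf_times_unique:
  fixes p q :: "'k::field bipoly"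
  assumes "\<And>x' y'. \<lbrakk>x' \<in> supp p; y' \<in> supp q; x' + y' = x + y\<rbrakk> \<Longrightarrow> x' = x \<and> y' = y"
  shows "cf (p * q) (x + y) = cf p x * cf q y"
proof -
  have "cf (p * q) (x + y) = (\<Sum>x'\<in>supp p. \<Sum>y'\<in>supp q. if x' = x then if y' = y then cf p x * cf q y else 0 else 0)"
    unfolding cf_times using assms by (intro sum.cong refl) auto
  also have "\<dots> = (\<Sum>x'\<in>supp p. if x' = x then \<Sum>y'\<in>supp q. if y' = y then cf p x * cf q y else 0 else 0)"
    by (intro sum.cong refl) auto
  also have "\<dots> = cf p x * cf q y" by (auto simp: in_keys_iff)
  finally show ?thesis .
qed

lemma cf_mon_times: "cf (mon t c * p) (t + x) = c * cf p x" for p :: "'k::field bipoly"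
proof -
  have "cf (mon t c * p) (t + x) = cf (mon t c) t * cf p x"
  proof (rule cf_times_unique)
    fix x' y' assume "x' \<in> supp (mon t c)" "x' + y' = t + x"
    then have "x' = t" "t + y' = t + x" by (auto split: if_splits)
    then show "x' = t \<and> y' = x" by (simp only: add_left_cancel)
  qed
  then show ?thesis by simp
qed

lemma supp_mon_times: "supp (mon t c * p) \<subseteq> (+) t ` supp p" for p :: "'k::field bipoly"
proof
  fix x assume "x \<in> supp (mon t c * p)"
  then obtain y z where "y \<in> supp (mon t c)" "z \<in> supp p" "x = y + z" using keys_mult[of "mon t c" p] by blast
  then show "x \<in> (+) t ` supp p" by (simp split: if_splits)
qed

lemma supp_times_subset:
  "\<lbrakk>supp p \<subseteq> A; supp q \<subseteq> B; \<And>x y. x \<in> A \<Longrightarrow> y \<in> B \<Longrightarrow> x + y \<in> C\<rbrakk> \<Longrightarrow> supp (p * q) \<subseteq> C"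
  for p q :: "'k::field bipoly"
  using keys_mult[of p q] by blast

lemma supp_diff_subset: "\<lbrakk>supp p \<subseteq> A; supp q \<subseteq> A\<rbrakk> \<Longrightarrow> supp (p - q) \<subseteq> A" for p q :: "'k::field bipoly"
  using keys_diff[of p q] by blast

lemma supp_add_subset: "\<lbrakk>supp p \<subseteq> A; supp q \<subseteq> A\<rbrakk> \<Longrightarrow> supp (p + q) \<subseteq> A" for p q :: "'k::field bipoly"
  using keys_add[of p q] by blast

lemma supp_sum_subset: "(\<And>i. i \<in> I \<Longrightarrow> supp (f i) \<subseteq> A) \<Longrightarrow> supp (sum f I) \<subseteq> A" for f :: "'i \<Rightarrow> 'k::field bipoly"
  using keys_sum[of f I] by blast

text \<open>The action of the constants makes the general theory of vector spaces applicable to polynomials.\<close>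

definition cscale :: "'k::field \<Rightarrow> 'k bipoly \<Rightarrow> 'k bipoly" where
  "cscale c p = mon 0 c * p"

lemma cf_cscale [simp]: "cf (cscale c p) x = c * cf p x"
  using cf_mon_times[of 0 c p x] by (simp add: cscale_def)

interpretation bipoly: vector_space cscale
  by unfold_locales (auto intro!: poly_mapping_eqI simp: lookup_add algebra_simps)

lemma supp_cscale: "supp (cscale c p) \<subseteq> supp p"
  by (auto simp: in_keys_iff)

lemma mon_eq_cscale: "mon x c = cscale c (mon x 1)"
  by (simp add: cscale_def mult_single)

lemma more_polynomials_than_monomials:
  fixes f :: "'i \<Rightarrow> 'k::field bipoly"
  assumes "finite I" "finite T" "card T < card I" and T: "\<And>i. i \<in> I \<Longrightarrow> supp (f i) \<subseteq> T"
  shows "\<exists>c. (\<exists>i\<in>I. c i \<noteq> 0) \<and> (\<Sum>i\<in>I. cscale (c i) (f i)) = 0"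
proof (cases "inj_on f I")
  case False
  then obtain i j where ij: "i \<in> I" "j \<in> I" "f i = f j" "i \<noteq> j" by (auto simp: inj_on_def)
  define c where "c = (\<lambda>l. if l = i then 1 else if l = j then -1 else (0::'k))"
  have "(\<Sum>l\<in>I. cscale (c l) (f l)) = (\<Sum>l\<in>{i, j}. cscale (c l) (f l))"
    using assms(1) ij by (intro sum.mono_neutral_right) (auto simp: c_def)
  also have "\<dots> = 0" using ij by (simp add: c_def bipoly.scale_left_distrib[symmetric])
  finally show ?thesis using ij(1) by (intro exI[of _ c]) (auto simp: c_def)
next
  case True
  have "f ` I \<subseteq> bipoly.span ((\<lambda>x. mon x 1) ` T)"
  proof
    fix p assume "p \<in> f ` I"
    then have "supp p \<subseteq> T" using T by auto
    then have "(\<Sum>x\<in>supp p. cscale (cf p x) (mon x 1)) \<in> bipoly.span ((\<lambda>x. mon x 1) ` T)"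
      by (intro bipoly.span_sum bipoly.span_scale bipoly.span_base) auto
    then show "p \<in> bipoly.span ((\<lambda>x. mon x 1) ` T)"
      using sum_monomials[of p] by (simp flip: mon_eq_cscale)
  qed
  then have "bipoly.dependent (f ` I)"
    using bipoly.independent_span_bound[of "(\<lambda>x. mon x 1) ` T" "f ` I"] assms(2,3)
      card_image_le[OF assms(2), of "\<lambda>x. mon x (1::'k)"] card_image[OF True] by force
  then obtain u where u: "\<exists>p\<in>f ` I. u p \<noteq> 0" "(\<Sum>p\<in>f ` I. cscale (u p) p) = 0"
    using bipoly.dependent_finite[of "f ` I"] assms(1) by auto
  show ?thesis
    by (rule exI[of _ "\<lambda>i. u (f i)"]) (use u in \<open>auto simp: sum.reindex[OF True]\<close>)
qed

section \<open>The semigroup ring of a submonoid of the plane\<close>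

locale plane_monoid =
  fixes S :: "(nat \<times> nat) set" and K :: "'k::field itself"
  assumes zero_S: "0 \<in> S" and add_S: "\<And>x y. \<lbrakk>x \<in> S; y \<in> S\<rbrakk> \<Longrightarrow> x + y \<in> S"
begin

abbreviation "KS \<equiv> semigroup_ring S :: 'k bipoly ring"

lemma carrier_KS: "p \<in> carrier KS \<longleftrightarrow> supp p \<subseteq> S"
  by (simp add: semigroup_ring_def)

lemma KS_ops [simp]: "monoid.mult KS = (*)" "ring.add KS = (+)" "\<one>\<^bsub>KS\<^esub> = 1" "\<zero>\<^bsub>KS\<^esub> = 0"
  by (simp_all add: semigroup_ring_def)

lemma KS_closed [intro]:
  "\<lbrakk>p \<in> carrier KS; q \<in> carrier KS\<rbrakk> \<Longrightarrow> p + q \<in> carrier KS"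
  "\<lbrakk>p \<in> carrier KS; q \<in> carrier KS\<rbrakk> \<Longrightarrow> p - q \<in> carrier KS"
  "\<lbrakk>p \<in> carrier KS; q \<in> carrier KS\<rbrakk> \<Longrightarrow> p * q \<in> carrier KS"
  "x \<in> S \<Longrightarrow> mon x c \<in> carrier KS"
  "p \<in> carrier KS \<Longrightarrow> - p \<in> carrier KS"
  "0 \<in> carrier KS" "1 \<in> carrier KS"
  "(\<And>i. i \<in> I \<Longrightarrow> f i \<in> carrier KS) \<Longrightarrow> sum f I \<in> carrier KS"
  unfolding carrier_KS
  by (erule (1) supp_add_subset, erule (1) supp_diff_subset, erule (1) supp_times_subset, erule (1) add_S,
      simp, simp add: in_keys_iff subset_iff, simp, simp add: zero_S, rule supp_sum_subset, blast)

lemma KS_power: "p \<in> carrier KS \<Longrightarrow> p ^ n \<in> carrier KS"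
  by (induction n) auto

lemma KS_cscale: "p \<in> carrier KS \<Longrightarrow> cscale c p \<in> carrier KS"
  unfolding carrier_KS using supp_cscale[of c p] by blast

lemma domain_KS: "domain KS"
proof -
  have ab: "abelian_group KS"
  proof (rule abelian_groupI)
    fix p assume "p \<in> carrier KS"
    then show "\<exists>q\<in>carrier KS. q \<oplus>\<^bsub>KS\<^esub> p = \<zero>\<^bsub>KS\<^esub>" by (intro bexI[of _ "- p"]) auto
  qed (auto simp: add_ac)
  have cm: "comm_monoid KS" by (rule comm_monoidI) (auto simp: mult_ac)
  have cr: "cring KS" by (rule cringI[OF ab cm]) (simp add: algebra_simps)
  show ?thesis by (rule domainI[OF cr]) auto
qed

sublocale KS: "domain" KS by (rule domain_KS)

lemma KS_minus [simp]: "p \<in> carrier KS \<Longrightarrow> \<ominus>\<^bsub>KS\<^esub> p = - p"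
  by (rule KS.minus_equality) auto

lemma KS_diff [simp]: "q \<in> carrier KS \<Longrightarrow> p \<ominus>\<^bsub>KS\<^esub> q = p - q"
  by (simp add: a_minus_def)

lemma KS_finsum: "\<lbrakk>finite I; \<And>i. i \<in> I \<Longrightarrow> f i \<in> carrier KS\<rbrakk> \<Longrightarrow> finsum KS f I = sum f I"
proof (induction I rule: finite_induct)
  case (insert i I)
  then show ?case by (subst KS.finsum_insert) auto
qed simp

lemma ideal_KS:
  assumes "ideal I KS"
  shows "p \<in> I \<Longrightarrow> p \<in> carrier KS" and "0 \<in> I"
    and "\<lbrakk>p \<in> I; q \<in> I\<rbrakk> \<Longrightarrow> p + q \<in> I" and "\<lbrakk>p \<in> I; q \<in> I\<rbrakk> \<Longrightarrow> p - q \<in> I"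
    and "\<lbrakk>p \<in> I; r \<in> carrier KS\<rbrakk> \<Longrightarrow> r * p \<in> I" and "\<lbrakk>p \<in> I; r \<in> carrier KS\<rbrakk> \<Longrightarrow> p * r \<in> I"
    and "(\<And>i. i \<in> J \<Longrightarrow> f i \<in> I) \<Longrightarrow> sum f J \<in> I"
proof -
  interpret I: ideal I KS by fact
  show c: "p \<in> carrier KS" if "p \<in> I" for p using I.Icarr that .
  show z: "0 \<in> I" using I.zero_closed by simp
  show a: "p + q \<in> I" if "p \<in> I" "q \<in> I" for p q using I.a_closed[OF that] by simp
  show l: "r * p \<in> I" if "p \<in> I" "r \<in> carrier KS" for p r using I.I_l_closed[OF that] by simp
  show "p * r \<in> I" if "p \<in> I" "r \<in> carrier KS" for p r using I.I_r_closed[OF that] by simp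
  have "- q \<in> I" if "q \<in> I" for q using l[OF that, of "- 1"] by auto
  then show "p - q \<in> I" if "p \<in> I" "q \<in> I" for p q using a[of p "- q"] that by simp
  show "(\<And>i. i \<in> J \<Longrightarrow> f i \<in> I) \<Longrightarrow> sum f J \<in> I" by (induction J rule: infinite_finite_induct) (auto intro: z a)
qed

subsection \<open>Chains of prime ideals\<close>

text \<open>
  In a relation \<open>\<Sum> a\<^sub>i x\<^sup>i \<in> Q\<close> with \<open>x \<notin> Q\<close>, the powers of \<open>x\<close> in front of the lowest term can be
  cancelled, after which that term is left modulo \<open>x\<close>.
\<close>

lemma lowest_coefficient_in_prime:
  assumes Q: "primeideal Q KS" and Q': "ideal Q' KS" "Q \<subseteq> Q'" and x: "x \<notin> Q" "x \<in> Q'"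
    and a: "\<And>i. a i \<in> carrier KS" "(\<Sum>i\<le>n. a i * x ^ i) \<in> Q" and e: "e \<le> n" "\<And>i. i < e \<Longrightarrow> a i = 0"
  shows "a e \<in> Q'"
proof -
  interpret Q: primeideal Q KS by fact
  have xc: "x \<in> carrier KS" using ideal_KS(1)[OF Q'(1) x(2)] .
  have pw: "x ^ i \<notin> Q" for i
  proof (induction i)
    case 0 show ?case using Q.one_imp_carrier Q.I_notcarr by auto
  next
    case (Suc i) then show ?case using Q.I_prime[of x "x ^ i"] xc x(1) KS_power[OF xc, of i] by auto
  qed
  have "(\<Sum>i\<le>n. a i * x ^ i) = (\<Sum>i\<in>{e..n}. a i * x ^ i)"
    using e(2) by (intro sum.mono_neutral_right) auto
  also have "\<dots> = (\<Sum>i\<le>n - e. a (e + i) * x ^ (e + i))"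
    using sum.atLeastAtMost_shift_bounds[of "\<lambda>i. a i * x ^ i" 0 e "n - e"] e(1)
    by (simp add: atLeast0AtMost add.commute)
  also have "\<dots> = x ^ e * (\<Sum>i\<le>n - e. a (e + i) * x ^ i)"
    by (simp add: sum_distrib_left power_add mult_ac)
  finally have "x ^ e * (\<Sum>i\<le>n - e. a (e + i) * x ^ i) \<in> Q" using a(2) by simp
  moreover have sc: "(\<Sum>i\<le>n - e. a (e + i) * x ^ i) \<in> carrier KS" using a(1) KS_power[OF xc] by auto
  ultimately have "(\<Sum>i\<le>n - e. a (e + i) * x ^ i) \<in> Q"
    using Q.I_prime[of "x ^ e"] pw KS_power[OF xc] by auto
  then have inQ': "(\<Sum>i\<le>n - e. a (e + i) * x ^ i) \<in> Q'" using Q'(2) by blast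
  have split: "(\<Sum>i\<le>n - e. a (e + i) * x ^ i) = a e + (\<Sum>i\<in>{1..n - e}. a (e + i) * x ^ i)"
  proof -
    have "{..n - e} = insert 0 {1..n - e}" by auto
    then show ?thesis by simp
  qed
  have rest: "(\<Sum>i\<in>{1..n - e}. a (e + i) * x ^ i) \<in> Q'"
  proof (rule ideal_KS(7)[OF Q'(1)])
    fix i assume "i \<in> {1..n - e}"
    then obtain i' where "i = Suc i'" by (cases i) auto
    then have "(a (e + i) * x ^ (i - 1)) * x = a (e + i) * x ^ i" by (simp add: mult_ac)
    moreover have "(a (e + i) * x ^ (i - 1)) * x \<in> Q'"
      by (intro ideal_KS(5)[OF Q'(1) x(2)] KS_closed(3) a(1) KS_power[OF xc])
    ultimately show "a (e + i) * x ^ i \<in> Q'" by (simp only:)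
  qed
  show ?thesis using ideal_KS(4)[OF Q'(1) inQ' rest] by (simp add: split)
qed

text \<open>
  Three polynomials in two variables are algebraically dependent: there are more monomials in them
  than monomials in the variables of the corresponding degree. Choosing one new element from each
  step of a chain of four primes, the lexicographically lowest coefficient of a relation
  would lie in the largest prime.
\<close>

lemma no_long_prime_chain:
  assumes prime: "\<And>i. i \<le> 3 \<Longrightarrow> primeideal (P i) KS"
    and strict: "\<And>i. i < (3::nat) \<Longrightarrow> P i \<subset> P (Suc i)"
  shows False
proof -
  have id: "ideal (P i) KS" if "i \<le> 3" for i using prime[OF that] by (rule primeideal.axioms(1))
  have "\<exists>x. x \<in> P (Suc i) \<and> x \<notin> P i" if "i < 3" for i using strict[OF that] by blast
  then obtain x where x: "\<And>i. i < 3 \<Longrightarrow> x i \<in> P (Suc i) \<and> x i \<notin> P i" by metis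
  have xc: "x i \<in> carrier KS" if "i < 3" for i using x[OF that] id[of "Suc i"] ideal_KS(1) that by auto
  define B where "B = (\<Union>i<3. supp (x i))"
  have finB: "finite B" by (simp add: B_def)
  obtain D where D: "\<And>s. s \<in> B \<Longrightarrow> fst s \<le> D \<and> snd s \<le> D"
  proof
    fix s assume "s \<in> B"
    then show "fst s \<le> Max (insert 0 (fst ` B)) + Max (insert 0 (snd ` B)) \<and>
        snd s \<le> Max (insert 0 (fst ` B)) + Max (insert 0 (snd ` B))"
      using finB by (intro conjI trans_le_add1 trans_le_add2 Max_ge) auto
  qed
  define Box :: "nat \<Rightarrow> (nat \<times> nat) set" where "Box = (\<lambda>n. {..n} \<times> {..n})"
  have box: "supp (p * q) \<subseteq> Box (m + n)" if "supp p \<subseteq> Box m" "supp q \<subseteq> Box n" for p q :: "'k bipoly" and m n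
    by (rule supp_times_subset[OF that]) (auto simp: Box_def)
  have pbox: "supp (x i ^ n) \<subseteq> Box (D * n)" if "i < 3" for i n
  proof (induction n)
    case 0 then show ?case by (auto simp: Box_def zero_prod_def)
  next
    case (Suc n)
    have "supp (x i) \<subseteq> Box D"
    proof
      fix s assume "s \<in> supp (x i)"
      then have "s \<in> B" using that by (auto simp: B_def)
      from D[OF this] show "s \<in> Box D" by (cases s) (simp add: Box_def)
    qed
    from box[OF this Suc] show ?case by (simp add: algebra_simps)
  qed
  \<comment> \<open>for degrees up to \<open>N\<close> in each \<open>x i\<close> there are \<open>(N + 1)\<^sup>3\<close> products, all in a box with \<open>(3 D N + 1)\<^sup>2\<close> monomials;
      \<open>N = (3 D + 1)\<^sup>2\<close> makes the first number larger\<close>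
  define M where "M = 3 * D + 1"
  define N where "N = M\<^sup>2"
  define f where "f = (\<lambda>(i, j, l). x 0 ^ i * (x 1 ^ j * x 2 ^ l))"
  define I where "I = {..N} \<times> {..N} \<times> {..N}"
  have "card (Box (3 * D * N)) = (3 * D * N + 1)\<^sup>2" by (simp add: Box_def power2_eq_square)
  also have "\<dots> \<le> (N * M)\<^sup>2"
  proof (rule power_mono)
    have "1 \<le> N" by (simp add: N_def M_def)
    then show "3 * D * N + 1 \<le> N * M" by (simp add: M_def algebra_simps)
  qed simp
  also have "\<dots> = N ^ 3" by (simp add: N_def power3_eq_cube power2_eq_square mult_ac)
  also have "\<dots> < (N + 1) ^ 3" by (rule power_strict_mono) auto
  also have "\<dots> = card I" by (simp add: I_def power3_eq_cube)
  finally have card: "card (Box (3 * D * N)) < card I" .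
  have fI: "supp (f t) \<subseteq> Box (3 * D * N)" if "t \<in> I" for t
  proof -
    obtain i j l where t: "t = (i, j, l)" by (cases t) auto
    have "supp (f t) \<subseteq> Box (D * i + (D * j + D * l))"
      unfolding t f_def by (simp add: box pbox)
    also have "D * i + (D * j + D * l) \<le> 3 * D * N"
    proof -
      have "D * i + (D * j + D * l) \<le> D * N + (D * N + D * N)"
        by (intro add_mono mult_le_mono2) (use that in \<open>auto simp: t I_def\<close>)
      then show ?thesis by simp
    qed
    then have "Box (D * i + (D * j + D * l)) \<subseteq> Box (3 * D * N)" unfolding Box_def by auto
    finally show ?thesis .
  qed
  obtain c where c: "\<exists>t\<in>I. c t \<noteq> 0" "(\<Sum>t\<in>I. cscale (c t) (f t)) = 0"
    using more_polynomials_than_monomials[of I "Box (3 * D * N)" f] card fI by (auto simp: I_def Box_def)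
  define C where "C = (\<lambda>i j l. if i \<le> N \<and> j \<le> N \<and> l \<le> N then c (i, j, l) else 0)"
  define a2 where "a2 = (\<lambda>i j. \<Sum>l\<le>N. mon 0 (C i j l) * x 2 ^ l)"
  define a1 where "a1 = (\<lambda>i. \<Sum>j\<le>N. a2 i j * x 1 ^ j)"
  have mc: "mon 0 e \<in> carrier KS" for e using zero_S by auto
  have a2c: "a2 i j \<in> carrier KS" for i j unfolding a2_def using mc KS_power[OF xc[of 2]] by auto
  have a1c: "a1 i \<in> carrier KS" for i
    unfolding a1_def by (intro KS_closed(8) KS_closed(3) a2c KS_power xc) simp
  have "(\<Sum>i\<le>N. a1 i * x 0 ^ i) = (\<Sum>i\<le>N. \<Sum>j\<le>N. \<Sum>l\<le>N. cscale (c (i, j, l)) (f (i, j, l)))"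
    unfolding a1_def a2_def sum_distrib_right
    by (intro sum.cong refl) (simp add: C_def f_def cscale_def mult_ac)
  also have "\<dots> = (\<Sum>t\<in>I. cscale (c t) (f t))"
    unfolding I_def by (simp add: sum.cartesian_product)
  finally have rel: "(\<Sum>i\<le>N. a1 i * x 0 ^ i) \<in> P 0" using c(2) ideal_KS(2)[OF id[of 0]] by simp
  \<comment> \<open>\<open>(i0, j0, l0)\<close> is the lexicographically lowest exponent of the relation\<close>
  define i0 where "i0 = (LEAST i. \<exists>j l. C i j l \<noteq> 0)"
  have ex: "\<exists>i j l. C i j l \<noteq> 0" using c(1) by (force simp: I_def C_def)
  then have i0: "\<exists>j l. C i0 j l \<noteq> 0" unfolding i0_def by (rule LeastI_ex)
  define j0 where "j0 = (LEAST j. \<exists>l. C i0 j l \<noteq> 0)"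
  have j0: "\<exists>l. C i0 j0 l \<noteq> 0" unfolding j0_def using i0 by (rule LeastI_ex)
  define l0 where "l0 = (LEAST l. C i0 j0 l \<noteq> 0)"
  have l0: "C i0 j0 l0 \<noteq> 0" unfolding l0_def using j0 by (rule LeastI_ex)
  have le: "i0 \<le> N" "j0 \<le> N" "l0 \<le> N" using l0 by (auto simp: C_def split: if_splits)
  have z1: "a1 i = 0" if "i < i0" for i
    using not_less_Least[OF that[unfolded i0_def]] by (simp add: a1_def a2_def)
  have z2: "a2 i0 j = 0" if "j < j0" for j
    using not_less_Least[OF that[unfolded j0_def]] by (simp add: a2_def)
  have z3: "mon 0 (C i0 j0 l) = 0" if "l < l0" for l
    using not_less_Least[OF that[unfolded l0_def]] by simp
  have "a1 i0 \<in> P 1"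
    using lowest_coefficient_in_prime[OF prime[of 0] id[of 1] _ _ _ a1c rel le(1) z1] strict[of 0] x[of 0] by auto
  then have "a2 i0 j0 \<in> P 2"
    using lowest_coefficient_in_prime[of "P 1" "P 2" "x 1" "a2 i0" N j0] prime[of 1] id[of 2] a2c le(2) z2
      strict[of 1] x[of 1] by (simp add: a1_def psubset_imp_subset numeral_2_eq_2)
  then have "mon 0 (C i0 j0 l0) \<in> P 3"
    using lowest_coefficient_in_prime[of "P 2" "P 3" "x 2" "\<lambda>l. mon 0 (C i0 j0 l)" N l0] prime[of 2] id[of 3] mc
      le(3) z3 strict[of 2] x[of 2] by (simp add: a2_def psubset_imp_subset numeral_2_eq_2 numeral_3_eq_3)
  then have "mon 0 (inverse (C i0 j0 l0)) * mon 0 (C i0 j0 l0) \<in> P 3"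
    by (intro ideal_KS(5)[OF id] mc) auto
  then have "\<one>\<^bsub>KS\<^esub> \<in> P 3" using l0 by (simp add: mult_single)
  then show False
    using ideal.one_imp_carrier[OF id[of 3]] primeideal.I_notcarr[OF prime[of 3]] by auto
qed

end

section \<open>Monoids that are free over two of their elements\<close>

text \<open>
  Dickson's lemma. An element \<open>(x0, y0)\<close> of \<open>E\<close> leaves only the finitely many columns \<open>x < x0\<close> and rows \<open>y < y0\<close> to be
  considered, and each of them has a least element.
\<close>

lemma dickson:
  fixes E :: "(nat \<times> nat) set"
  shows "\<exists>F. finite F \<and> F \<subseteq> E \<and> (\<forall>s\<in>E. \<exists>t\<in>F. fst t \<le> fst s \<and> snd t \<le> snd s)"
proof (cases "E = {}")
  case False
  then obtain x0 y0 where xy: "(x0, y0) \<in> E" by auto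
  define F1 where "F1 = (\<lambda>x. (x, LEAST y. (x, y) \<in> E)) ` {x. x < x0 \<and> (\<exists>y. (x, y) \<in> E)}"
  define F2 where "F2 = (\<lambda>y. (LEAST x. (x, y) \<in> E, y)) ` {y. y < y0 \<and> (\<exists>x. (x, y) \<in> E)}"
  show ?thesis
  proof (intro exI[of _ "insert (x0, y0) (F1 \<union> F2)"] conjI ballI)
    show "finite (insert (x0, y0) (F1 \<union> F2))" by (simp add: F1_def F2_def)
    show "insert (x0, y0) (F1 \<union> F2) \<subseteq> E" using xy by (auto simp: F1_def F2_def intro: LeastI)
    fix s assume s: "s \<in> E"
    obtain x y where s_eq: "s = (x, y)" by (cases s)
    consider "x < x0" | "y < y0" | "x0 \<le> x" "y0 \<le> y" by linarith
    then show "\<exists>t\<in>insert (x0, y0) (F1 \<union> F2). fst t \<le> fst s \<and> snd t \<le> snd s"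
    proof cases
      case 1
      then have "(x, LEAST y. (x, y) \<in> E) \<in> F1" using s unfolding F1_def s_eq by blast
      moreover have "(LEAST y. (x, y) \<in> E) \<le> y" using s unfolding s_eq by (rule Least_le)
      ultimately show ?thesis unfolding s_eq by (intro bexI[of _ "(x, LEAST y. (x, y) \<in> E)"]) auto
    next
      case 2
      then have "(LEAST x. (x, y) \<in> E, y) \<in> F2" using s unfolding F2_def s_eq by blast
      moreover have "(LEAST x. (x, y) \<in> E) \<le> x" using s unfolding s_eq by (rule Least_le)
      ultimately show ?thesis unfolding s_eq by (intro bexI[of _ "(LEAST x. (x, y) \<in> E, y)"]) auto
    next
      case 3 then show ?thesis unfolding s_eq by (intro bexI[of _ "(x0, y0)"]) auto
    qed
  qed
qed auto

text \<open>
  The map \<open>(n, m, w) \<mapsto> n u + m v + w\<close> is a bijection from \<open>\<nat> \<times> \<nat> \<times> W\<close> to \<open>S\<close>, with inverse \<open>(\<alpha>, \<beta>, \<omega>)\<close>. For the ring this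
  means that \<open>K[S]\<close> is free over the polynomial ring \<open>K[u, v]\<close>, with the monomials of \<open>W\<close> as a basis. In the
  comments, vectors also stand for the corresponding monomials.
\<close>

locale free_plane_monoid = plane_monoid S K for S :: "(nat \<times> nat) set" and K :: "'k::field itself" +
  fixes u v :: "nat \<times> nat" and W :: "(nat \<times> nat) set"
    and \<alpha> \<beta> :: "nat \<times> nat \<Rightarrow> nat" and \<omega> :: "nat \<times> nat \<Rightarrow> nat \<times> nat"
  assumes finite_W: "finite W" and zero_W: "0 \<in> W"
    and rep: "w \<in> W \<Longrightarrow> nscale n u + nscale m v + w \<in> S \<and> \<alpha> (nscale n u + nscale m v + w) = n \<and>
      \<beta> (nscale n u + nscale m v + w) = m \<and> \<omega> (nscale n u + nscale m v + w) = w"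
    and decomp: "s \<in> S \<Longrightarrow> \<omega> s \<in> W \<and> s = nscale (\<alpha> s) u + nscale (\<beta> s) v + \<omega> s"
begin

lemma swapped: "free_plane_monoid S v u W \<beta> \<alpha> \<omega>"
proof unfold_locales
  show "w \<in> W \<Longrightarrow> nscale n v + nscale m u + w \<in> S \<and> \<beta> (nscale n v + nscale m u + w) = n \<and>
      \<alpha> (nscale n v + nscale m u + w) = m \<and> \<omega> (nscale n v + nscale m u + w) = w" for w n m
    using rep[of w m n] by (simp add: add.commute)
  show "s \<in> S \<Longrightarrow> \<omega> s \<in> W \<and> s = nscale (\<beta> s) v + nscale (\<alpha> s) u + \<omega> s" for s
    using decomp[of s] by (simp add: add.commute)
qed (rule finite_W zero_W)+

lemma shift:
  assumes "s \<in> S"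
  shows "nscale n u + nscale m v + s \<in> S" "\<alpha> (nscale n u + nscale m v + s) = n + \<alpha> s"
    "\<beta> (nscale n u + nscale m v + s) = m + \<beta> s" "\<omega> (nscale n u + nscale m v + s) = \<omega> s"
proof -
  have w: "\<omega> s \<in> W" and s: "s = nscale (\<alpha> s) u + nscale (\<beta> s) v + \<omega> s" using decomp[OF assms] by auto
  have "nscale n u + nscale m v + s = nscale (n + \<alpha> s) u + nscale (m + \<beta> s) v + \<omega> s"
    using arg_cong[OF s, of "\<lambda>t. nscale n u + nscale m v + t"] by (simp add: nscale_add add_ac)
  then show "nscale n u + nscale m v + s \<in> S" "\<alpha> (nscale n u + nscale m v + s) = n + \<alpha> s"
    "\<beta> (nscale n u + nscale m v + s) = m + \<beta> s" "\<omega> (nscale n u + nscale m v + s) = \<omega> s"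
    using rep[OF w, of "n + \<alpha> s" "m + \<beta> s"] by simp_all
qed

lemmas shift_u = shift[where m = 0, simplified] and shift_v = shift[where n = 0, simplified]

lemma basis_S: "w \<in> W \<Longrightarrow> w \<in> S" "w \<in> W \<Longrightarrow> \<alpha> w = 0" "w \<in> W \<Longrightarrow> \<beta> w = 0" "w \<in> W \<Longrightarrow> \<omega> w = w"
  using rep[of w 0 0] by auto

lemma coord_zero [simp]: "\<alpha> 0 = 0" "\<beta> 0 = 0" "\<omega> 0 = 0"
  using basis_S[OF zero_W] by auto

lemma uv_S: "nscale n u + nscale m v \<in> S" "\<alpha> (nscale n u + nscale m v) = n" "\<beta> (nscale n u + nscale m v) = m"
  "\<omega> (nscale n u + nscale m v) = 0"
  using rep[OF zero_W, of n m] by auto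

lemmas u_S = uv_S[where m = 0, simplified] and v_S = uv_S[where n = 0, simplified]

lemma u_nonzero: "u \<noteq> 0"
  using u_S(2)[of 1] by auto

lemma nscale_u_eq: "nscale n u = nscale m u \<longleftrightarrow> n = m"
  using u_S(2) by metis

subsection \<open>Noetherianity\<close>

text \<open>
  Hilbert's basis theorem by leading monomials. For each \<open>w \<in> W\<close>, Dickson's lemma selects finitely many elements of
  the ideal whose leading monomials lie in the class of \<open>w\<close>. Their multiples reach all leading monomials of the ideal, and
  subtracting such a multiple lowers the leading monomial.
\<close>

lemma noetherian_KS: "noetherian_ring KS"
proof (rule KS.noetherian_ringI)
  fix I assume I: "ideal I KS"
  note closed = ideal_KS[OF I]
  define lead where "lead = (\<lambda>p :: 'k bipoly. Max (supp p))"
  have lead: "lead p \<in> supp p" "\<And>x. x \<in> supp p \<Longrightarrow> x \<le> lead p" if "p \<noteq> 0" for p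
    using that by (auto simp: lead_def intro: Max_in)
  define E where "E = (\<lambda>w. {(\<alpha> (lead p), \<beta> (lead p)) | p. p \<in> I \<and> p \<noteq> 0 \<and> \<omega> (lead p) = w})"
  have "\<exists>F. \<forall>w. finite (F w) \<and> F w \<subseteq> E w \<and> (\<forall>s\<in>E w. \<exists>t\<in>F w. fst t \<le> fst s \<and> snd t \<le> snd s)"
    by (rule choice) (use dickson in blast)
  then obtain F where F: "\<And>w. finite (F w)" "\<And>w. F w \<subseteq> E w"
    "\<And>w s. s \<in> E w \<Longrightarrow> \<exists>t\<in>F w. fst t \<le> fst s \<and> snd t \<le> snd s" by blast
  define g where "g = (\<lambda>w t. SOME p. p \<in> I \<and> p \<noteq> 0 \<and> \<omega> (lead p) = w \<and> \<alpha> (lead p) = fst t \<and> \<beta> (lead p) = snd t)"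
  have g: "g w t \<in> I \<and> g w t \<noteq> 0 \<and> \<omega> (lead (g w t)) = w \<and> \<alpha> (lead (g w t)) = fst t \<and> \<beta> (lead (g w t)) = snd t"
    if "t \<in> F w" for w t
    unfolding g_def
  proof (rule someI_ex)
    show "\<exists>p. p \<in> I \<and> p \<noteq> 0 \<and> \<omega> (lead p) = w \<and> \<alpha> (lead p) = fst t \<and> \<beta> (lead p) = snd t"
    proof -
      have "t \<in> E w" using F(2) that by blast
      then obtain p where "t = (\<alpha> (lead p), \<beta> (lead p))" "p \<in> I" "p \<noteq> 0" "\<omega> (lead p) = w"
        unfolding E_def by blast
      then show ?thesis by (intro exI[of _ p]) simp
    qed
  qed
  define G where "G = (\<Union>w\<in>W. g w ` F w)"
  have finG: "finite G" using finite_W F(1) by (simp add: G_def)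
  have GI: "G \<subseteq> I" using g by (auto simp: G_def)
  have Gc: "G \<subseteq> carrier KS" using GI closed(1) by blast
  note J = KS.genideal_ideal[OF Gc]
  have "p \<in> I \<Longrightarrow> p \<noteq> 0 \<Longrightarrow> lead p = s \<Longrightarrow> p \<in> Idl\<^bsub>KS\<^esub> G" for s p
  proof (induction s arbitrary: p rule: less_induct)
    case (less s)
    have sS: "s \<in> S" using lead(1)[OF less.prems(2)] closed(1)[OF less.prems(1)] less.prems(3) by (auto simp: carrier_KS)
    have "(\<alpha> s, \<beta> s) \<in> E (\<omega> s)" using less.prems by (auto simp: E_def)
    then obtain t where t: "t \<in> F (\<omega> s)" "fst t \<le> \<alpha> s" "snd t \<le> \<beta> s" using F(3) by fastforce
    define h where "h = g (\<omega> s) t"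
    define s' where "s' = lead h"
    have h: "h \<in> I" "h \<noteq> 0" "\<omega> s' = \<omega> s" "\<alpha> s' \<le> \<alpha> s" "\<beta> s' \<le> \<beta> s"
      using g[OF t(1)] t(2,3) by (auto simp: h_def s'_def)
    have hG: "h \<in> G" using t(1) decomp[OF sS] by (auto simp: G_def h_def)
    have s'S: "s' \<in> S" using lead(1)[OF h(2)] closed(1)[OF h(1)] by (auto simp: s'_def carrier_KS)
    define \<delta> where "\<delta> = nscale (\<alpha> s - \<alpha> s') u + nscale (\<beta> s - \<beta> s') v"
    have \<delta>S: "\<delta> \<in> S" unfolding \<delta>_def by (rule uv_S)
    have s_eq: "s = \<delta> + s'"
    proof -
      have "s = nscale ((\<alpha> s - \<alpha> s') + \<alpha> s') u + nscale ((\<beta> s - \<beta> s') + \<beta> s') v + \<omega> s"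
        using decomp[OF sS] h(4,5) by simp
      also have "\<dots> = \<delta> + (nscale (\<alpha> s') u + nscale (\<beta> s') v + \<omega> s')"
        unfolding \<delta>_def h(3) by (simp only: nscale_add add_ac)
      also have "\<dots> = \<delta> + s'" using decomp[OF s'S] by simp
      finally show ?thesis .
    qed
    define c where "c = cf p s / cf h s'"
    define q where "q = p - mon \<delta> c * h"
    have hc: "cf h s' \<noteq> 0" using lead(1)[OF h(2)] by (simp add: s'_def in_keys_iff)
    have mI: "mon \<delta> c * h \<in> I" using closed(5)[OF h(1)] \<delta>S by blast
    have mJ: "mon \<delta> c * h \<in> Idl\<^bsub>KS\<^esub> G"
      using ideal_KS(5)[OF J, of h "mon \<delta> c"] KS.genideal_self[OF Gc] hG \<delta>S by blast
    have qI: "q \<in> I" unfolding q_def by (rule closed(4)[OF less.prems(1) mI])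
    have qs: "cf q s = 0" unfolding q_def using cf_mon_times[of \<delta> c h s'] hc
      by (simp add: lookup_minus c_def s_eq)
    have small: "x < s" if "x \<in> supp q" for x
    proof -
      have "x \<in> supp p \<or> x \<in> supp (mon \<delta> c * h)" using that keys_diff[of p "mon \<delta> c * h"] by (auto simp: q_def)
      then have "x \<le> s"
      proof
        assume "x \<in> supp p" then show ?thesis using lead(2)[OF less.prems(2)] less.prems(3) by blast
      next
        assume "x \<in> supp (mon \<delta> c * h)"
        then obtain y where "y \<in> supp h" "x = \<delta> + y" using supp_mon_times[of \<delta> c h] by blast
        then show ?thesis using lead(2)[OF h(2)] by (simp add: s_eq s'_def add_left_mono)
      qed
      moreover have "x \<noteq> s" using that qs by (auto simp: in_keys_iff)
      ultimately show ?thesis by simp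
    qed
    have "q \<in> Idl\<^bsub>KS\<^esub> G"
    proof (cases "q = 0")
      case True then show ?thesis using ideal_KS(2)[OF J] by simp
    next
      case False then show ?thesis using less.IH[OF small[OF lead(1)[OF False]] qI False refl] by blast
    qed
    moreover have "p = q + mon \<delta> c * h" by (simp add: q_def)
    ultimately show ?case using ideal_KS(3)[OF J _ mJ] by simp
  qed
  then have "p \<in> Idl\<^bsub>KS\<^esub> G" if "p \<in> I" for p
    using that ideal_KS(2)[OF J] by (cases "p = 0") blast+
  then have "I \<subseteq> Idl\<^bsub>KS\<^esub> G" by blast
  then have "I = Idl\<^bsub>KS\<^esub> G" using KS.genideal_minimal[OF I GI] by blast
  then show "\<exists>A\<subseteq>carrier KS. finite A \<and> I = Idl\<^bsub>KS\<^esub> A" using finG Gc by blast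
qed

lemma noetherian_domain_KS: "noetherian_domain KS"
  using noetherian_KS domain_KS by (simp add: noetherian_domain_def)

subsection \<open>Polynomials in one of the two elements\<close>

definition Ku :: "'k bipoly set" where "Ku = {p. supp p \<subseteq> range (\<lambda>n. nscale n u)}"

lemma Ku_carrier: "p \<in> Ku \<Longrightarrow> p \<in> carrier KS"
  unfolding Ku_def carrier_KS using u_S(1) by auto

lemma Ku_degree:
  assumes "p \<in> Ku" "p \<noteq> 0"
  obtains d where "cf p (nscale d u) \<noteq> 0" "\<And>x. x \<in> supp p \<Longrightarrow> \<exists>i\<le>d. x = nscale i u"
proof -
  have sub: "supp p \<subseteq> range (\<lambda>n. nscale n u)" using assms by (simp add: Ku_def)
  have ne: "\<alpha> ` supp p \<noteq> {}" using assms(2) by simp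
  have "Max (\<alpha> ` supp p) \<in> \<alpha> ` supp p" using ne by (intro Max_in) auto
  then obtain x where x: "x \<in> supp p" "\<alpha> x = Max (\<alpha> ` supp p)" by auto
  then obtain d where d: "x = nscale d u" using sub by auto
  show thesis
  proof (rule that[of d])
    show "cf p (nscale d u) \<noteq> 0" using x(1) d by (simp add: in_keys_iff)
    fix y assume y: "y \<in> supp p"
    then obtain i where i: "y = nscale i u" using sub by auto
    have "\<alpha> y \<le> \<alpha> x" unfolding x(2) using y by (intro Max_ge) auto
    then have "i \<le> d" unfolding i d u_S(2) .
    then show "\<exists>i\<le>d. y = nscale i u" using i by blast
  qed
qed

text \<open>
  Division with remainder in the variable \<open>u\<close>. It creates no new degrees in \<open>v\<close>, so that divisions by a polynomial in \<open>u\<close>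
  and by one in \<open>v\<close> can be performed after each other.
\<close>

lemma division_by_Ku:
  assumes p: "p \<in> Ku" and d: "cf p (nscale d u) \<noteq> 0" "\<And>x. x \<in> supp p \<Longrightarrow> \<exists>i\<le>d. x = nscale i u"
    and r: "r \<in> carrier KS"
  shows "\<exists>t r'. t \<in> carrier KS \<and> r' \<in> carrier KS \<and> r = t * p + r' \<and> (\<forall>x\<in>supp r'. \<alpha> x < d \<and> \<beta> x \<in> \<beta> ` supp r)"
proof -
  let ?D = "\<lambda>r B. \<exists>t r'. t \<in> carrier KS \<and> r' \<in> carrier KS \<and> r = t * p + r' \<and> (\<forall>x\<in>supp r'. \<alpha> x < d \<and> \<beta> x \<in> B)"
  have Dsum: "?D (sum f J) B" if "finite J" "\<And>j. j \<in> J \<Longrightarrow> ?D (f j) B" for f :: "'c \<Rightarrow> 'k bipoly" and J B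
    using that
  proof (induction J rule: finite_induct)
    case empty then show ?case by (intro exI[of _ 0]) auto
  next
    case (insert j J)
    obtain t r where 1: "t \<in> carrier KS" "r \<in> carrier KS" "f j = t * p + r" "\<forall>x\<in>supp r. \<alpha> x < d \<and> \<beta> x \<in> B"
      using insert.prems[of j] by auto
    obtain t' r' where 2: "t' \<in> carrier KS" "r' \<in> carrier KS" "sum f J = t' * p + r'" "\<forall>x\<in>supp r'. \<alpha> x < d \<and> \<beta> x \<in> B"
      using insert.IH insert.prems by blast
    have "sum f (insert j J) = (t + t') * p + (r + r')" using insert.hyps 1 2 by (simp add: algebra_simps)
    moreover have "\<forall>x\<in>supp (r + r'). \<alpha> x < d \<and> \<beta> x \<in> B" using 1(4) 2(4) keys_add[of r r'] by blast
    ultimately show ?case using 1(1,2) 2(1,2) by (intro exI[of _ "t + t'"] exI[of _ "r + r'"]) auto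
  qed
  have Dmon: "?D (mon x c) {\<beta> x}" if "x \<in> S" for x c
    using that
  proof (induction "\<alpha> x" arbitrary: x c rule: less_induct)
    case less
    show ?case
    proof (cases "\<alpha> x < d")
      case True
      then show ?thesis using less.prems by (intro exI[of _ 0] exI[of _ "mon x c"]) auto
    next
      case False
      define y where "y = nscale (\<alpha> x - d) u + nscale (\<beta> x) v + \<omega> x"
      have yS: "y \<in> S" and ya: "\<alpha> y = \<alpha> x - d" "\<beta> y = \<beta> x"
        using rep decomp[OF less.prems] by (auto simp: y_def)
      have xy: "x = nscale d u + y"
      proof -
        have "nscale d u + y = nscale (d + (\<alpha> x - d)) u + nscale (\<beta> x) v + \<omega> x"
          unfolding y_def by (simp only: nscale_add add_ac)
        then show ?thesis using False decomp[OF less.prems] by simp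
      qed
      define e where "e = c / cf p (nscale d u)"
      define J where "J = {i. i < d \<and> nscale i u \<in> supp p}"
      have sp: "p = mon (nscale d u) (cf p (nscale d u)) + (\<Sum>i\<in>J. mon (nscale i u) (cf p (nscale i u)))"
      proof -
        have inj: "inj_on (\<lambda>i. nscale i u) (insert d J)" using nscale_u_eq by (auto intro: inj_onI)
        have "supp p = (\<lambda>i. nscale i u) ` insert d J"
        proof (intro equalityI subsetI)
          fix z assume z: "z \<in> supp p"
          then obtain i where "i \<le> d" "z = nscale i u" using d(2) by blast
          then show "z \<in> (\<lambda>i. nscale i u) ` insert d J" using z by (cases "i = d") (auto simp: J_def)
        qed (use d(1) in \<open>auto simp: J_def in_keys_iff\<close>)
        then have "p = (\<Sum>i\<in>insert d J. mon (nscale i u) (cf p (nscale i u)))"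
          using sum_monomials[of p] by (simp only: sum.reindex[OF inj] o_def)
        then show ?thesis by (simp add: J_def)
      qed
      have "mon y e * p = mon y e * (mon (nscale d u) (cf p (nscale d u)) + (\<Sum>i\<in>J. mon (nscale i u) (cf p (nscale i u))))"
        using sp by simp
      also have "\<dots> = mon x c + (\<Sum>i\<in>J. mon (nscale i u + y) (e * cf p (nscale i u)))"
        using d(1) by (simp add: distrib_left sum_distrib_left mult_single xy e_def add.commute)
      finally have eq: "mon x c = mon y e * p + (\<Sum>i\<in>J. mon (nscale i u + y) (- e * cf p (nscale i u)))"
        by (simp add: sum_negf single_uminus algebra_simps)
      have "?D (\<Sum>i\<in>J. mon (nscale i u + y) (- e * cf p (nscale i u))) {\<beta> x}"
      proof (rule Dsum)
        fix i assume i: "i \<in> J"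
        have "\<alpha> (nscale i u + y) < \<alpha> x" "nscale i u + y \<in> S" "\<beta> (nscale i u + y) = \<beta> x"
          using shift_u[OF yS, of i] i False by (auto simp: J_def ya)
        then show "?D (mon (nscale i u + y) (- e * cf p (nscale i u))) {\<beta> x}"
          using less.hyps[of "nscale i u + y"] by auto
      qed (auto simp: J_def)
      then obtain t r' where tr: "t \<in> carrier KS" "r' \<in> carrier KS" "\<forall>x'\<in>supp r'. \<alpha> x' < d \<and> \<beta> x' \<in> {\<beta> x}"
        "(\<Sum>i\<in>J. mon (nscale i u + y) (- e * cf p (nscale i u))) = t * p + r'" by blast
      have "mon x c = (mon y e + t) * p + r'" unfolding eq tr(4) by (simp add: algebra_simps)
      then show ?thesis using tr(1-3) yS by (intro exI[of _ "mon y e + t"] exI[of _ r']) auto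
    qed
  qed
  have "?D (\<Sum>x\<in>supp r. mon x (cf r x)) (\<beta> ` supp r)"
  proof (rule Dsum)
    fix x assume x: "x \<in> supp r"
    then have "x \<in> S" using r by (auto simp: carrier_KS)
    from Dmon[OF this] obtain t r' where "t \<in> carrier KS" "r' \<in> carrier KS" "mon x (cf r x) = t * p + r'"
       "\<forall>x'\<in>supp r'. \<alpha> x' < d \<and> \<beta> x' \<in> {\<beta> x}" by blast
    then show "?D (mon x (cf r x)) (\<beta> ` supp r)" using x by (intro exI[of _ t] exI[of _ r']) auto
  qed simp
  then show ?thesis using sum_monomials[of r] by simp
qed

text \<open>
  The coefficient of the highest power of \<open>u\<close> in \<open>p\<close> is a constant, so the terms of highest degree in \<open>u\<close> of \<open>t\<close> survive in
  the product.
\<close>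

lemma multiple_of_Ku_degree:
  assumes d: "cf p (nscale d u) \<noteq> 0" "\<And>x. x \<in> supp p \<Longrightarrow> \<exists>i\<le>d. x = nscale i u"
    and t: "t \<in> carrier KS" "t \<noteq> 0"
  shows "\<exists>x\<in>supp (t * p). d \<le> \<alpha> x"
proof -
  have "Max (\<alpha> ` supp t) \<in> \<alpha> ` supp t" using t(2) by (intro Max_in) auto
  then obtain x where x: "x \<in> supp t" "\<alpha> x = Max (\<alpha> ` supp t)" by auto
  have le: "\<alpha> y \<le> \<alpha> x" if "y \<in> supp t" for y unfolding x(2) using that by (intro Max_ge) auto
  have xS: "y \<in> S" if "y \<in> supp t" for y using that t(1) by (auto simp: carrier_KS)
  have "cf (t * p) (x + nscale d u) = cf t x * cf p (nscale d u)"
  proof (rule cf_times_unique)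
    fix x' y' assume h: "x' \<in> supp t" "y' \<in> supp p" "x' + y' = x + nscale d u"
    obtain i where i: "i \<le> d" "y' = nscale i u" using d(2)[OF h(2)] by blast
    have "\<alpha> x' + i = \<alpha> x + d"
      using arg_cong[OF h(3), of \<alpha>] shift_u(2)[OF xS[OF h(1)], of i] shift_u(2)[OF xS[OF x(1)], of d] i(2)
      by (simp add: add.commute)
    then have "i = d" using i(1) le[OF h(1)] by simp
    then show "x' = x \<and> y' = nscale d u" using h(3) i(2) by simp
  qed
  then have "x + nscale d u \<in> supp (t * p)" using x(1) d(1) by (simp add: in_keys_iff)
  moreover have "d \<le> \<alpha> (x + nscale d u)" using shift_u(2)[OF xS[OF x(1)], of d] by (simp add: add.commute)
  ultimately show ?thesis by blast
qed

end

context free_plane_monoid begin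

interpretation sw: free_plane_monoid S K v u W \<beta> \<alpha> \<omega> by (rule swapped)

abbreviation "Kv \<equiv> sw.Ku"

text \<open>
  Multiplication by a polynomial in \<open>v\<close> does not change degrees in \<open>u\<close>, so it cannot turn a nonzero
  remainder of the division by \<open>p\<close> into a multiple of \<open>p\<close>.
\<close>

lemma regular_pair_Ku_Kv:
  assumes p: "p \<in> Ku" "p \<noteq> 0" and q: "q \<in> Kv" "q \<noteq> 0"
  shows "regular_pair KS p q"
proof -
  have pc: "p \<in> carrier KS" "q \<in> carrier KS" using Ku_carrier p sw.Ku_carrier q by auto
  obtain d where d: "cf p (nscale d u) \<noteq> 0" "\<And>x. x \<in> supp p \<Longrightarrow> \<exists>i\<le>d. x = nscale i u"
    using Ku_degree[OF p] by blast
  show ?thesis unfolding regular_pair_def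
  proof (intro conjI ballI impI pc)
    fix r assume "r \<otimes>\<^bsub>KS\<^esub> p = \<zero>\<^bsub>KS\<^esub>" then show "r = \<zero>\<^bsub>KS\<^esub>" using p(2) by simp
  next
    fix r s assume r: "r \<in> carrier KS" and s: "s \<in> carrier KS" and e: "r \<otimes>\<^bsub>KS\<^esub> q = s \<otimes>\<^bsub>KS\<^esub> p"
    obtain t r' where t: "t \<in> carrier KS" "r' \<in> carrier KS" "r = t * p + r'" "\<forall>x\<in>supp r'. \<alpha> x < d"
      using division_by_Ku[OF p(1) d r] by blast
    have e': "r' * q = (s - t * q) * p" using e unfolding t(3) by (simp add: algebra_simps)
    have "r' = 0"
    proof (rule ccontr)
      assume "r' \<noteq> 0"
      then have "(s - t * q) * p \<noteq> 0" using q(2) e'[symmetric] by simp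
      then have "s - t * q \<noteq> 0" by auto
      moreover have "s - t * q \<in> carrier KS" using s t(1) pc by blast
      ultimately obtain x where x: "x \<in> supp (r' * q)" "d \<le> \<alpha> x"
        unfolding e' using multiple_of_Ku_degree[OF d, of "s - t * q"] by blast
      obtain y z where y: "y \<in> supp r'" "z \<in> supp q" "x = y + z" using x(1) keys_mult[of r' q] by blast
      obtain j where z: "z = nscale j v" using y(2) q(1) by (auto simp: sw.Ku_def)
      have "y \<in> S" using y(1) t(2) by (auto simp: carrier_KS)
      then have "\<alpha> x = \<alpha> y" using shift_v(2)[of y j] by (simp add: y(3) z add.commute)
      then show False using x(2) t(4) y(1) by auto
    qed
    then show "\<exists>t\<in>carrier KS. r = t \<otimes>\<^bsub>KS\<^esub> p" using t by auto
  qed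
qed

end

section \<open>Maximal ideals contain polynomials in one variable\<close>

context plane_monoid begin

definition subalgebra :: "'k bipoly set \<Rightarrow> bool" where
  "subalgebra B \<longleftrightarrow> B \<subseteq> carrier KS \<and> 1 \<in> B \<and> (\<forall>x\<in>B. \<forall>y\<in>B. x + y \<in> B \<and> x - y \<in> B \<and> x * y \<in> B)"

lemma subalgebraD:
  assumes "subalgebra B"
  shows "x \<in> B \<Longrightarrow> x \<in> carrier KS" "1 \<in> B" "\<lbrakk>x \<in> B; y \<in> B\<rbrakk> \<Longrightarrow> x + y \<in> B"
    "\<lbrakk>x \<in> B; y \<in> B\<rbrakk> \<Longrightarrow> x - y \<in> B" "\<lbrakk>x \<in> B; y \<in> B\<rbrakk> \<Longrightarrow> x * y \<in> B" "0 \<in> B" "x \<in> B \<Longrightarrow> x ^ n \<in> B"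
    "(\<And>i. i \<in> I \<Longrightarrow> f i \<in> B) \<Longrightarrow> sum f I \<in> B"
proof -
  show *: "x \<in> B \<Longrightarrow> x \<in> carrier KS" "1 \<in> B" "\<lbrakk>x \<in> B; y \<in> B\<rbrakk> \<Longrightarrow> x + y \<in> B"
    "\<lbrakk>x \<in> B; y \<in> B\<rbrakk> \<Longrightarrow> x - y \<in> B" "\<lbrakk>x \<in> B; y \<in> B\<rbrakk> \<Longrightarrow> x * y \<in> B" for x y
    using assms by (auto simp: subalgebra_def)
  show z: "0 \<in> B" using *(4)[OF *(2,2)] by simp
  show "x \<in> B \<Longrightarrow> x ^ n \<in> B" by (induction n) (simp_all add: *)
  show "(\<And>i. i \<in> I \<Longrightarrow> f i \<in> B) \<Longrightarrow> sum f I \<in> B"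
    by (induction I rule: infinite_finite_induct) (simp_all add: * z)
qed

lemma subalgebra_supp:
  assumes "T \<subseteq> S" "0 \<in> T" "\<And>x y. \<lbrakk>x \<in> T; y \<in> T\<rbrakk> \<Longrightarrow> x + y \<in> T"
  shows "subalgebra {p :: 'k bipoly. supp p \<subseteq> T}"
  unfolding subalgebra_def
proof (intro conjI ballI)
  fix x y :: "'k bipoly" assume "x \<in> {p. supp p \<subseteq> T}" "y \<in> {p. supp p \<subseteq> T}"
  then have "supp x \<subseteq> T" "supp y \<subseteq> T" by auto
  then show "x + y \<in> {p. supp p \<subseteq> T}" "x - y \<in> {p. supp p \<subseteq> T}" "x * y \<in> {p. supp p \<subseteq> T}"
    using supp_add_subset[of x T y] supp_diff_subset[of x T y] supp_times_subset[of x T y T T] assms(3) by simp_all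
qed (use assms in \<open>auto simp: carrier_KS\<close>)

text \<open>
  A consequence of the Cayley-Hamilton theorem, obtained by eliminating the unknowns \<open>g i\<close> one by one from the system
  \<open>(1 + q b) g = q A g\<close>. The case of interest is \<open>b = 0\<close>; the factor \<open>1 + q b\<close> keeps the form of the system
  stable under an elimination step.
\<close>

lemma determinant_trick:
  assumes m: "ideal m KS" and B: "subalgebra B" and q: "q \<in> B"
  shows "\<lbrakk>finite J; \<And>i. i \<in> J \<Longrightarrow> g i \<in> carrier KS; \<And>i j. i \<in> J \<Longrightarrow> j \<in> J \<Longrightarrow> a i j \<in> B; b \<in> B;
    \<And>i. i \<in> J \<Longrightarrow> (1 + q * b) * g i - q * (\<Sum>j\<in>J. a i j * g j) \<in> m\<rbrakk>
    \<Longrightarrow> \<exists>b'\<in>B. \<forall>i\<in>J. (1 + q * b') * g i \<in> m"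
proof (induction J arbitrary: a b rule: finite_induct)
  case empty then show ?case using subalgebraD(2)[OF B] by auto
next
  case (insert n J)
  note Bc = subalgebraD[OF B] and mc = ideal_KS[OF m]
  define b1 where "b1 = b - a n n"
  define d where "d = 1 + q * b"
  define d' where "d' = 1 + q * b1"
  define a' where "a' = (\<lambda>i j. q * a i n * a n j + d' * a i j)"
  define b2 where "b2 = b + b1 + q * b * b1"
  have b1B: "b1 \<in> B" "d' \<in> B" unfolding b1_def d'_def using insert.prems(2,3) q by (auto intro!: Bc)
  have hn: "d' * g n - q * (\<Sum>j\<in>J. a n j * g j) \<in> m"
    using insert.prems(4)[of n] insert.hyps by (simp add: d'_def b1_def algebra_simps)
  have hi: "(1 + q * b2) * g i - q * (\<Sum>j\<in>J. a' i j * g j) \<in> m" if i: "i \<in> J" for i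
  proof -
    have "d * g i - q * (a i n * g n + (\<Sum>j\<in>J. a i j * g j)) \<in> m"
      using insert.prems(4)[of i] insert.hyps i by (simp add: d_def)
    then have "d' * (d * g i - q * (a i n * g n + (\<Sum>j\<in>J. a i j * g j))) \<in> m"
      using mc(5) Bc(1)[OF b1B(2)] by blast
    moreover have "q * a i n * (d' * g n - q * (\<Sum>j\<in>J. a n j * g j)) \<in> m"
    proof (rule mc(5)[OF hn])
      have "a i n \<in> B" using insert.prems(2)[of i n] i by simp
      then show "q * a i n \<in> carrier KS" using q by (intro Bc(1) Bc(5))
    qed
    ultimately have "d' * (d * g i - q * (a i n * g n + (\<Sum>j\<in>J. a i j * g j))) +
        q * a i n * (d' * g n - q * (\<Sum>j\<in>J. a n j * g j)) \<in> m" by (rule mc(3))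
    also have "d' * (d * g i - q * (a i n * g n + (\<Sum>j\<in>J. a i j * g j))) +
        q * a i n * (d' * g n - q * (\<Sum>j\<in>J. a n j * g j))
      = d' * d * g i - q * (q * a i n * (\<Sum>j\<in>J. a n j * g j) + d' * (\<Sum>j\<in>J. a i j * g j))"
      by (simp add: algebra_simps)
    also have "q * a i n * (\<Sum>j\<in>J. a n j * g j) + d' * (\<Sum>j\<in>J. a i j * g j) = (\<Sum>j\<in>J. a' i j * g j)"
      by (simp add: a'_def sum_distrib_left sum.distrib[symmetric] algebra_simps)
    also have "d' * d = 1 + q * b2" by (simp add: d_def d'_def b2_def algebra_simps)
    finally show ?thesis .
  qed
  have "\<exists>b3\<in>B. \<forall>i\<in>J. (1 + q * b3) * g i \<in> m"
  proof (rule insert.IH[of a' b2])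
    show "a' i j \<in> B" if "i \<in> J" "j \<in> J" for i j
      unfolding a'_def using insert.prems(2) that b1B q by (intro Bc) auto
    show "b2 \<in> B" unfolding b2_def using insert.prems(3) b1B q by (intro Bc) auto
    show "g i \<in> carrier KS" if "i \<in> J" for i using insert.prems(1) that by simp
    show "(1 + q * b2) * g i - q * (\<Sum>j\<in>J. a' i j * g j) \<in> m" if "i \<in> J" for i by (rule hi[OF that])
  qed
  then obtain b3 where b3: "b3 \<in> B" "\<And>i. i \<in> J \<Longrightarrow> (1 + q * b3) * g i \<in> m" by blast
  define b' where "b' = b3 + b1 + q * b3 * b1"
  have b': "1 + q * b' = (1 + q * b3) * d'" by (simp add: b'_def d'_def algebra_simps)
  have b3B: "1 + q * b3 \<in> B" using b3(1) q by (intro Bc) auto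
  show ?case
  proof (intro bexI[of _ b'] ballI)
    show "b' \<in> B" unfolding b'_def using b3 b1B q by (intro Bc) auto
    fix i assume "i \<in> insert n J"
    then show "(1 + q * b') * g i \<in> m"
    proof
      assume i: "i = n"
      have "(1 + q * b3) * (d' * g n - q * (\<Sum>j\<in>J. a n j * g j)) \<in> m" using mc(5)[OF hn] Bc(1)[OF b3B] by blast
      moreover have "(\<Sum>j\<in>J. (q * a n j) * ((1 + q * b3) * g j)) \<in> m"
      proof (rule mc(7), rule mc(5)[OF b3(2)])
        fix j assume j: "j \<in> J"
        then have "a n j \<in> B" using insert.prems(2)[of n j] by simp
        then show "q * a n j \<in> carrier KS" using q by (intro Bc(1) Bc(5))
      qed
      ultimately have "(1 + q * b3) * (d' * g n - q * (\<Sum>j\<in>J. a n j * g j)) +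
         (\<Sum>j\<in>J. (q * a n j) * ((1 + q * b3) * g j)) \<in> m" by (rule mc(3))
      also have "(\<Sum>j\<in>J. (q * a n j) * ((1 + q * b3) * g j)) = (1 + q * b3) * (q * (\<Sum>j\<in>J. a n j * g j))"
        by (simp only: sum_distrib_left) (intro sum.cong refl, simp add: algebra_simps)
      also have "(1 + q * b3) * (d' * g n - q * (\<Sum>j\<in>J. a n j * g j)) + \<dots> = (1 + q * b') * g n"
        unfolding b' by (simp add: algebra_simps)
      finally show ?thesis using i by simp
    next
      assume i: "i \<in> J"
      have "d' * ((1 + q * b3) * g i) \<in> m" using mc(5)[OF b3(2)[OF i]] Bc(1)[OF b1B(2)] by blast
      then show ?thesis unfolding b' by (simp add: mult_ac)
    qed
  qed
qed

text \<open>
  A form of Zariski's lemma. Modulo the maximal ideal \<open>m\<close> the ring is a field that contains \<open>B\<close>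
  and, up to powers of \<open>c\<close>, is generated by finitely many elements as a \<open>B\<close>-module. Then an element \<open>q\<close>
  that is coprime to \<open>c\<close> and invertible in the field is already invertible in \<open>B\<close>.
\<close>

lemma unit_of_finitely_generated:
  assumes m: "maximalideal m KS" and B: "subalgebra B" and Bm: "\<And>x. \<lbrakk>x \<in> B; x \<in> m\<rbrakk> \<Longrightarrow> x = 0"
    and q: "q \<in> B" "q \<notin> m" and c: "c \<in> B"
    and J: "finite J" "\<And>i. i \<in> J \<Longrightarrow> g i \<in> carrier KS" "i0 \<in> J" "g i0 = 1"
    and gen: "\<And>r. r \<in> carrier KS \<Longrightarrow> \<exists>N a. (\<forall>j\<in>J. a j \<in> B) \<and> c ^ N * r - (\<Sum>j\<in>J. a j * g j) \<in> m"
    and comax: "\<And>N. \<exists>x\<in>B. \<exists>y\<in>B. x * c ^ N + y * q = 1"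
  shows "\<exists>x\<in>B. q * x = 1"
proof -
  interpret m: maximalideal m KS by fact
  note Bc = subalgebraD[OF B] and mc = ideal_KS[OF m.ideal_axioms]
  have qc: "q \<in> carrier KS" by (rule Bc(1)[OF q(1)])
  have "\<exists>y0\<in>carrier KS. q * y0 - 1 \<in> m"
  proof -
    have id: "ideal (m <+>\<^bsub>KS\<^esub> PIdl\<^bsub>KS\<^esub> q) KS"
      by (rule KS.add_ideals[OF m.ideal_axioms KS.cgenideal_ideal[OF qc]])
    have eq: "m <+>\<^bsub>KS\<^esub> PIdl\<^bsub>KS\<^esub> q = {x + r * q | x r. x \<in> m \<and> r \<in> carrier KS}"
      unfolding set_add_def' cgenideal_def by auto
    have sub: "m \<subseteq> m <+>\<^bsub>KS\<^esub> PIdl\<^bsub>KS\<^esub> q"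
    proof
      fix x assume "x \<in> m"
      then have "x + 0 * q \<in> m <+>\<^bsub>KS\<^esub> PIdl\<^bsub>KS\<^esub> q" unfolding eq using KS_closed(6) by blast
      then show "x \<in> m <+>\<^bsub>KS\<^esub> PIdl\<^bsub>KS\<^esub> q" by simp
    qed
    have "0 + 1 * q \<in> m <+>\<^bsub>KS\<^esub> PIdl\<^bsub>KS\<^esub> q" unfolding eq using mc(2) KS_closed(7) by blast
    then have "m <+>\<^bsub>KS\<^esub> PIdl\<^bsub>KS\<^esub> q \<noteq> m" using q(2) by auto
    then have "m <+>\<^bsub>KS\<^esub> PIdl\<^bsub>KS\<^esub> q = carrier KS"
      using m.I_maximal[OF id sub] ideal_KS(1)[OF id] by blast
    then have "1 \<in> m <+>\<^bsub>KS\<^esub> PIdl\<^bsub>KS\<^esub> q" using KS_closed(7) by simp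
    then obtain x r where x: "x \<in> m" "r \<in> carrier KS" "1 = x + r * q" unfolding eq by blast
    have "q * r - 1 = 0 - x" unfolding x(3) by (simp add: mult.commute)
    then have "q * r - 1 \<in> m" using mc(4)[OF mc(2) x(1)] by simp
    then show ?thesis using x(2) by blast
  qed
  then obtain y0 where y0: "y0 \<in> carrier KS" "q * y0 - 1 \<in> m" by blast
  have "\<exists>a. (\<forall>j\<in>J. a j \<in> B) \<and> g i - q * (\<Sum>j\<in>J. a j * g j) \<in> m" if i: "i \<in> J" for i
  proof -
    obtain N a where a: "\<forall>j\<in>J. a j \<in> B" "c ^ N * (y0 * g i) - (\<Sum>j\<in>J. a j * g j) \<in> m"
      using gen[OF KS_closed(3)[OF y0(1) J(2)[OF i]]] by blast
    obtain x y where xy: "x \<in> B" "y \<in> B" "x * c ^ N + y * q = 1" using comax by blast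
    define a' where "a' = (\<lambda>j. x * a j + (if j = i then y else 0))"
    have xc: "x \<in> carrier KS" "c ^ N \<in> carrier KS" using Bc(1) xy(1) Bc(7)[OF c] by auto
    have "x * q * (c ^ N * (y0 * g i) - (\<Sum>j\<in>J. a j * g j)) \<in> m"
      by (rule mc(5)[OF a(2) KS_closed(3)[OF xc(1) qc]])
    moreover have "x * c ^ N * g i * (q * y0 - 1) \<in> m"
      by (rule mc(5)[OF y0(2) KS_closed(3)[OF KS_closed(3)[OF xc] J(2)[OF i]]])
    ultimately have "x * q * (c ^ N * (y0 * g i) - (\<Sum>j\<in>J. a j * g j)) - x * c ^ N * g i * (q * y0 - 1) \<in> m"
      by (rule mc(4))
    also have "x * q * (c ^ N * (y0 * g i) - (\<Sum>j\<in>J. a j * g j)) - x * c ^ N * g i * (q * y0 - 1)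
       = (x * c ^ N) * g i - q * (x * (\<Sum>j\<in>J. a j * g j))" by (simp add: algebra_simps)
    also have "x * c ^ N = 1 - y * q" using xy(3) by (simp add: algebra_simps)
    also have "(1 - y * q) * g i - q * (x * (\<Sum>j\<in>J. a j * g j)) = g i - q * (x * (\<Sum>j\<in>J. a j * g j) + y * g i)"
      by (simp add: algebra_simps)
    also have "x * (\<Sum>j\<in>J. a j * g j) + y * g i = (\<Sum>j\<in>J. a' j * g j)"
    proof -
      have "y * g i = (\<Sum>j\<in>J. (if j = i then y else 0) * g j)"
      proof -
        have "(\<Sum>j\<in>J. (if j = i then y else 0) * g j) = (\<Sum>j\<in>J. if j = i then y * g j else 0)"
          by (intro sum.cong refl) auto
        then show ?thesis using J(1) i by simp
      qed
      then show ?thesis by (simp add: a'_def sum_distrib_left sum.distrib[symmetric] algebra_simps)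
    qed
    finally have "g i - q * (\<Sum>j\<in>J. a' j * g j) \<in> m" .
    moreover have "\<forall>j\<in>J. a' j \<in> B" unfolding a'_def using a(1) xy(1,2) Bc(3,5,6) by auto
    ultimately show ?thesis by blast
  qed
  then have "\<exists>a. \<forall>i\<in>J. (\<forall>j\<in>J. a i j \<in> B) \<and> g i - q * (\<Sum>j\<in>J. a i j * g j) \<in> m" by (intro bchoice) blast
  then obtain a where a: "\<And>i j. i \<in> J \<Longrightarrow> j \<in> J \<Longrightarrow> a i j \<in> B"
    "\<And>i. i \<in> J \<Longrightarrow> g i - q * (\<Sum>j\<in>J. a i j * g j) \<in> m" by blast
  have "\<exists>b'\<in>B. \<forall>i\<in>J. (1 + q * b') * g i \<in> m"
    by (rule determinant_trick[where a = a and b = 0, OF m.ideal_axioms B q(1) J(1,2) a(1) Bc(6)])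
      (simp_all add: a(2))
  then obtain b' where b': "b' \<in> B" "1 + q * b' \<in> m" using J(3,4) by fastforce
  then have "1 + q * b' = 0" using Bm[of "1 + q * b'"] q(1) by (auto intro: Bc)
  then have "q * (0 - b') = 1" by (simp add: add_eq_0_iff)
  then show ?thesis using b'(1) Bc(4,6) by blast
qed

end

context free_plane_monoid begin

interpretation sw: free_plane_monoid S K v u W \<beta> \<alpha> \<omega> by (rule swapped)

lemma subalgebra_Ku: "subalgebra Ku"
  unfolding Ku_def
proof (rule subalgebra_supp)
  show "range (\<lambda>n. nscale n u) \<subseteq> S" using u_S(1) by auto
  show "0 \<in> range (\<lambda>n. nscale n u)" by (rule range_eqI[of _ _ 0]) simp
  show "x + y \<in> range (\<lambda>n. nscale n u)" if xy: "x \<in> range (\<lambda>n. nscale n u)" "y \<in> range (\<lambda>n. nscale n u)" for x y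
    using xy by (auto simp flip: nscale_add)
qed

definition Kuv :: "'k bipoly set" where
  "Kuv = {p. supp p \<subseteq> range (\<lambda>(n, m). nscale n u + nscale m v)}"

lemma subalgebra_Kuv: "subalgebra Kuv"
  unfolding Kuv_def
proof (rule subalgebra_supp)
  show "range (\<lambda>(n, m). nscale n u + nscale m v) \<subseteq> S" using uv_S(1) by auto
  show "0 \<in> range (\<lambda>(n, m). nscale n u + nscale m v)" by (rule range_eqI[of _ _ "(0, 0)"]) simp
  fix x y assume "x \<in> range (\<lambda>(n, m). nscale n u + nscale m v)" "y \<in> range (\<lambda>(n, m). nscale n u + nscale m v)"
  then obtain n m n' m' where "x = nscale n u + nscale m v" "y = nscale n' u + nscale m' v" by auto
  then have "x + y = (\<lambda>(n, m). nscale n u + nscale m v) (n + n', m + m')" by (simp add: nscale_add add_ac)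
  then show "x + y \<in> range (\<lambda>(n, m). nscale n u + nscale m v)" by (rule range_eqI)
qed

lemma mon_u_Ku: "mon (nscale n u) c \<in> Ku" and mon_uv_Kuv: "mon (nscale n u + nscale m v) c \<in> Kuv"
  by (auto simp: Ku_def Kuv_def)

lemma mon_decomp:
  "s \<in> S \<Longrightarrow> mon s c = mon (nscale (\<alpha> s) u + nscale (\<beta> s) v) c * mon (\<omega> s) 1"
  using decomp[of s] by (simp add: mult_single)

text \<open>
  First suppose that no nonzero polynomial in \<open>u, v\<close> lies in \<open>m\<close>. The field is then finitely
  generated as a module over \<open>K[u, v]\<close>, and \<open>v\<close> would be a unit of \<open>K[u, v]\<close>.
\<close>

lemma maximal_meets_Kuv:
  assumes m: "maximalideal m KS"
  shows "\<exists>h\<in>m. h \<noteq> 0 \<and> h \<in> Kuv"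
proof (rule ccontr)
  assume "\<not> ?thesis"
  then have Bm: "\<And>x. x \<in> Kuv \<Longrightarrow> x \<in> m \<Longrightarrow> x = 0" by blast
  interpret m: maximalideal m KS by fact
  note Bc = subalgebraD[OF subalgebra_Kuv] and mc = ideal_KS[OF m.ideal_axioms]
  define q :: "'k bipoly" where "q = mon v 1"
  have qB: "q \<in> Kuv" using mon_uv_Kuv[of 0 1 1] by (simp add: q_def)
  have "cf q v = 1" by (simp add: q_def)
  then have q0: "q \<noteq> 0" by auto
  have "\<exists>x\<in>Kuv. q * x = 1"
  proof (rule unit_of_finitely_generated[OF m subalgebra_Kuv Bm qB, where c = 1 and J = W and g = "\<lambda>w. mon w 1" and ?i0.0 = 0])
    show "q \<notin> m" using Bm[OF qB] q0 by blast
    show "\<exists>x\<in>Kuv. \<exists>y\<in>Kuv. x * 1 ^ N + y * q = 1" for N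
      by (intro bexI[of _ 1] bexI[of _ 0]) (use Bc(2,6) in auto)
    fix r assume r: "r \<in> carrier KS"
    define a where "a = (\<lambda>w. \<Sum>s\<in>{s \<in> supp r. \<omega> s = w}. mon (nscale (\<alpha> s) u + nscale (\<beta> s) v) (cf r s))"
    have rS: "s \<in> S" if "s \<in> supp r" for s using r that by (auto simp: carrier_KS)
    have "(\<Sum>w\<in>W. a w * mon w 1) = (\<Sum>w\<in>W. \<Sum>s\<in>{s \<in> supp r. \<omega> s = w}. mon s (cf r s))"
    proof (intro sum.cong refl)
      fix w
      have "a w * mon w 1 = (\<Sum>s\<in>{s \<in> supp r. \<omega> s = w}. mon (nscale (\<alpha> s) u + nscale (\<beta> s) v) (cf r s) * mon (\<omega> s) 1)"
        unfolding a_def sum_distrib_right by (intro sum.cong refl) auto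
      also have "\<dots> = (\<Sum>s\<in>{s \<in> supp r. \<omega> s = w}. mon s (cf r s))"
        by (intro sum.cong refl mon_decomp[symmetric]) (simp add: rS)
      finally show "a w * mon w 1 = (\<Sum>s\<in>{s \<in> supp r. \<omega> s = w}. mon s (cf r s))" .
    qed
    also have "\<dots> = (\<Sum>s\<in>supp r. mon s (cf r s))"
      by (rule sum.group) (use finite_W decomp rS in auto)
    also have "\<dots> = r" using sum_monomials[of r] by simp
    finally have "1 ^ 0 * r - (\<Sum>w\<in>W. a w * mon w 1) \<in> m" using mc(2) by simp
    moreover have "\<forall>w\<in>W. a w \<in> Kuv" unfolding a_def by (intro ballI Bc(8) mon_uv_Kuv)
    ultimately show "\<exists>N a. (\<forall>w\<in>W. a w \<in> Kuv) \<and> 1 ^ N * r - (\<Sum>w\<in>W. a w * mon w 1) \<in> m"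
      by (intro exI[of _ 0] exI[of _ a] conjI)
  next
    show "mon w 1 \<in> carrier KS" if "w \<in> W" for w using basis_S(1)[OF that] by blast
    show "1 \<in> Kuv" by (rule Bc(2))
  qed (use finite_W zero_W in simp_all)
  then obtain x where x: "q * x = 1" by blast
  have "0 \<in> supp (q * x)" unfolding x by simp
  then obtain y where "0 = v + y" using supp_mon_times[of v 1 x] by (auto simp: q_def)
  then have "v = 0" by (cases v, cases y) (auto simp: zero_prod_def plus_prod_def)
  then show False using sw.u_nonzero by simp
qed

text \<open>
  Leading monomials multiply, so the leading monomial of a unit is \<open>1\<close>; but \<open>1 + u c\<close> contains a larger one.
\<close>

lemma Ku_unit:
  assumes c: "c \<in> Ku" "c \<noteq> 0" and x: "x \<in> Ku" "(1 + mon u 1 * c) * x = 1"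
  shows False
proof -
  define q where "q = 1 + mon u 1 * c"
  have B: "q \<in> Ku" unfolding q_def using subalgebraD[OF subalgebra_Ku] c mon_u_Ku[of 1 1] by simp
  have nz: "q \<noteq> 0" "x \<noteq> 0" using x by (auto simp: q_def)
  have Mle: "Max (supp p) \<in> supp p" "\<And>y. y \<in> supp p \<Longrightarrow> y \<le> Max (supp p)" if "p \<noteq> 0" for p :: "'k bipoly"
    using that by (auto intro: Max_in)
  have "cf (q * x) (Max (supp q) + Max (supp x)) = cf q (Max (supp q)) * cf x (Max (supp x))"
  proof (rule cf_times_unique)
    fix x' y' assume h: "x' \<in> supp q" "y' \<in> supp x" "x' + y' = Max (supp q) + Max (supp x)"
    have le: "x' \<le> Max (supp q)" "y' \<le> Max (supp x)" using Mle(2) nz h by auto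
    have "\<not> x' < Max (supp q)"
    proof
      assume "x' < Max (supp q)"
      then have "x' + y' < Max (supp q) + Max (supp x)" using le(2) by (rule add_less_le_mono)
      then show False using h(3) by simp
    qed
    then have "x' = Max (supp q)" using le(1) by simp
    then show "x' = Max (supp q) \<and> y' = Max (supp x)" using h(3) by simp
  qed
  also have "\<dots> \<noteq> 0" using Mle(1)[OF nz(1)] Mle(1)[OF nz(2)] by (simp add: in_keys_iff)
  finally have "Max (supp q) + Max (supp x) \<in> supp (q * x)" by (rule iffD2[OF in_keys_iff])
  moreover have "q * x = 1" unfolding q_def by (rule x(2))
  ultimately have "Max (supp q) + Max (supp x) = 0" by simp
  then have "Max (supp q) = 0" by (cases "Max (supp q)", cases "Max (supp x)") (simp add: zero_prod_def)
  then have q0: "y \<le> 0" if "y \<in> supp q" for y using Mle(2)[OF nz(1) that] by simp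
  have un: "u + y \<noteq> 0" for y using u_nonzero by (cases u, cases y) (auto simp: zero_prod_def)
  have y: "Max (supp c) \<in> supp c" by (rule Mle(1)[OF c(2)])
  then have "cf q (u + Max (supp c)) \<noteq> 0"
    unfolding q_def using un[of "Max (supp c)"] cf_mon_times[of u 1 c "Max (supp c)"]
    by (simp add: lookup_add lookup_one in_keys_iff)
  then have "u + Max (supp c) \<le> 0" by (intro q0) (simp add: in_keys_iff)
  then have "u + Max (supp c) = 0" by (cases "u + Max (supp c)") (simp add: zero_prod_def less_eq_prod_def)
  then show False using un by blast
qed

text \<open>
  Now let \<open>h \<in> m\<close> be a nonzero polynomial in \<open>u, v\<close>, of degree \<open>e\<close> in \<open>v\<close> and with leading coefficient
  \<open>c \<in> K[u]\<close>. If \<open>m\<close> met \<open>K[u]\<close> in zero only, the field would be generated over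
  \<open>K[u]\<close>, up to powers of \<open>c\<close>, by the products of the powers of \<open>v\<close> below \<open>e\<close> with the basis \<open>W\<close>, and
  \<open>1 + u c\<close>, which is coprime to \<open>c\<close>, would be a unit of \<open>K[u]\<close>.
\<close>

lemma maximal_meets_Ku:
  assumes m: "maximalideal m KS"
  shows "\<exists>p\<in>m. p \<noteq> 0 \<and> p \<in> Ku"
proof (rule ccontr)
  assume "\<not> ?thesis"
  then have Bm: "\<And>x. x \<in> Ku \<Longrightarrow> x \<in> m \<Longrightarrow> x = 0" by blast
  interpret m: maximalideal m KS by fact
  note Bc = subalgebraD[OF subalgebra_Ku] and mc = ideal_KS[OF m.ideal_axioms]
  obtain h where h: "h \<in> m" "h \<noteq> 0" "h \<in> Kuv" using maximal_meets_Kuv[OF m] by blast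
  have hS: "s \<in> S" if "s \<in> supp h" for s using mc(1)[OF h(1)] that by (auto simp: carrier_KS)
  have hw: "s = nscale (\<alpha> s) u + nscale (\<beta> s) v" if s: "s \<in> supp h" for s
  proof -
    obtain n k where "s = nscale n u + nscale k v" using h(3) s by (auto simp: Kuv_def)
    then show ?thesis using uv_S(2,3)[of n k] by simp
  qed
  define e where "e = Max (\<beta> ` supp h)"
  define C where "C = (\<lambda>i. \<Sum>s\<in>{s \<in> supp h. \<beta> s = i}. mon (nscale (\<alpha> s) u) (cf h s))"
  define vp :: "nat \<Rightarrow> 'k bipoly" where "vp = (\<lambda>i. mon (nscale i v) 1)"
  have vp_add: "vp (i + j) = vp i * vp j" for i j by (simp add: vp_def nscale_add mult_single)
  have vpc: "vp i \<in> carrier KS" for i using v_S(1) by (auto simp: vp_def)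
  have CB: "C i \<in> Ku" for i unfolding C_def by (intro Bc(8) mon_u_Ku)
  have hsum: "h = C e * vp e + (\<Sum>i<e. C i * vp i)"
  proof -
    have "h = (\<Sum>s\<in>supp h. mon s (cf h s))" by (rule sum_monomials)
    also have "\<dots> = (\<Sum>i\<in>{..e}. \<Sum>s\<in>{s \<in> supp h. \<beta> s = i}. mon s (cf h s))"
    proof (rule sum.group[symmetric])
      show "\<beta> ` supp h \<subseteq> {..e}" by (auto simp: e_def intro!: Max_ge)
    qed auto
    also have "\<dots> = (\<Sum>i\<in>{..e}. C i * vp i)"
    proof (intro sum.cong refl)
      fix i
      have "C i * vp i = (\<Sum>s\<in>{s \<in> supp h. \<beta> s = i}. mon (nscale (\<alpha> s) u + nscale (\<beta> s) v) (cf h s))"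
        unfolding C_def vp_def sum_distrib_right by (intro sum.cong refl) (auto simp: mult_single)
      also have "\<dots> = (\<Sum>s\<in>{s \<in> supp h. \<beta> s = i}. mon s (cf h s))"
        by (intro sum.cong refl) (use hw in auto)
      finally show "(\<Sum>s\<in>{s \<in> supp h. \<beta> s = i}. mon s (cf h s)) = C i * vp i" by simp
    qed
    also have "\<dots> = C e * vp e + (\<Sum>i<e. C i * vp i)" by (simp add: lessThan_Suc_atMost[symmetric])
    finally show ?thesis .
  qed
  have c0: "C e \<noteq> 0"
  proof -
    have "e \<in> \<beta> ` supp h" unfolding e_def using h(2) by (intro Max_in) auto
    then obtain s where s: "s \<in> supp h" "\<beta> s = e" by auto
    have "cf (C e) (nscale (\<alpha> s) u) = (\<Sum>t\<in>{t \<in> supp h. \<beta> t = e}. if t = s then cf h s else 0)"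
      unfolding C_def lookup_sum
    proof (intro sum.cong refl)
      fix t assume t: "t \<in> {t \<in> supp h. \<beta> t = e}"
      have "nscale (\<alpha> t) u = nscale (\<alpha> s) u \<longleftrightarrow> t = s"
        using hw[OF s(1)] hw[of t] t s(2) by auto
      then show "cf (mon (nscale (\<alpha> t) u) (cf h t)) (nscale (\<alpha> s) u) = (if t = s then cf h s else 0)"
        by (simp add: lookup_single when_def)
    qed
    also have "\<dots> = cf h s" using s by simp
    finally show ?thesis using s(1) by (auto simp: in_keys_iff)
  qed
  have e_pos: "e \<noteq> 0"
  proof
    assume "e = 0"
    then have "h = C 0" using hsum by (simp add: vp_def)
    then show False using Bm[of h] CB[of 0] h by simp
  qed
  define c where "c = C e"
  have cB: "c \<in> Ku" unfolding c_def by (rule CB)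
  have cc: "c \<in> carrier KS" by (rule Bc(1)[OF cB])
  define J where "J = W \<times> {..<e}"
  define g :: "(nat \<times> nat) \<times> nat \<Rightarrow> 'k bipoly" where "g = (\<lambda>(w, i). mon w 1 * vp i)"
  have gc: "g j \<in> carrier KS" if "j \<in> J" for j
    using that basis_S(1) vpc by (auto simp: J_def g_def)
  \<comment> \<open>the elements that, up to a power of \<open>c\<close> and modulo \<open>m\<close>, are generated by the \<open>g j\<close>; this will be the whole ring\<close>
  define M where "M = {r \<in> carrier KS. \<exists>N a. (\<forall>j\<in>J. a j \<in> Ku) \<and> c ^ N * r - (\<Sum>j\<in>J. a j * g j) \<in> m}"
  have M_add: "r + r' \<in> M" if r: "r \<in> M" and r': "r' \<in> M" for r r'
  proof -
    obtain N a where a: "\<forall>j\<in>J. a j \<in> Ku" "c ^ N * r - (\<Sum>j\<in>J. a j * g j) \<in> m" using r by (auto simp: M_def)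
    obtain N' a' where a': "\<forall>j\<in>J. a' j \<in> Ku" "c ^ N' * r' - (\<Sum>j\<in>J. a' j * g j) \<in> m" using r' by (auto simp: M_def)
    have "c ^ N' * (c ^ N * r - (\<Sum>j\<in>J. a j * g j)) + c ^ N * (c ^ N' * r' - (\<Sum>j\<in>J. a' j * g j)) \<in> m"
      by (intro mc(3) mc(5) a a' KS_power cc)
    also have "c ^ N' * (c ^ N * r - (\<Sum>j\<in>J. a j * g j)) + c ^ N * (c ^ N' * r' - (\<Sum>j\<in>J. a' j * g j))
        = c ^ (N + N') * (r + r') - (\<Sum>j\<in>J. (c ^ N' * a j + c ^ N * a' j) * g j)"
      by (simp add: algebra_simps power_add sum_distrib_left sum.distrib)
    finally have "c ^ (N + N') * (r + r') - (\<Sum>j\<in>J. (c ^ N' * a j + c ^ N * a' j) * g j) \<in> m" .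
    moreover have "\<forall>j\<in>J. c ^ N' * a j + c ^ N * a' j \<in> Ku"
      by (intro ballI Bc(3) Bc(5) Bc(7)[OF cB] bspec[OF a(1)] bspec[OF a'(1)])
    moreover have "r + r' \<in> carrier KS" using r r' by (auto simp: M_def)
    ultimately show ?thesis unfolding M_def
      by (intro CollectI conjI exI[of _ "N + N'"] exI[of _ "\<lambda>j. c ^ N' * a j + c ^ N * a' j"])
  qed
  have M_mult: "b * r \<in> M" if b: "b \<in> Ku" and r: "r \<in> M" for b r
  proof -
    obtain N a where a: "\<forall>j\<in>J. a j \<in> Ku" "c ^ N * r - (\<Sum>j\<in>J. a j * g j) \<in> m" using r by (auto simp: M_def)
    have "b * (c ^ N * r - (\<Sum>j\<in>J. a j * g j)) \<in> m" by (rule mc(5)[OF a(2) Bc(1)[OF b]])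
    also have "b * (c ^ N * r - (\<Sum>j\<in>J. a j * g j)) = c ^ N * (b * r) - (\<Sum>j\<in>J. (b * a j) * g j)"
      by (simp add: algebra_simps sum_distrib_left)
    finally have "c ^ N * (b * r) - (\<Sum>j\<in>J. (b * a j) * g j) \<in> m" .
    moreover have "\<forall>j\<in>J. b * a j \<in> Ku" using a(1) b by (auto intro: Bc(5))
    moreover have "b * r \<in> carrier KS" using Bc(1)[OF b] r by (auto simp: M_def)
    ultimately show ?thesis unfolding M_def
      by (intro CollectI conjI exI[of _ N] exI[of _ "\<lambda>j. b * a j"])
  qed
  have M_m: "r \<in> M" if "r \<in> m" for r
    unfolding M_def using that mc(1) Bc(6)
    by (intro CollectI conjI exI[of _ 0] exI[of _ "\<lambda>j. 0"]) auto
  have M_sum: "sum f A \<in> M" if "\<And>i. i \<in> A \<Longrightarrow> f i \<in> M" for f :: "'z \<Rightarrow> 'k bipoly" and A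
    using that by (induction A rule: infinite_finite_induct) (auto intro: M_add M_m mc(2))
  have M_c: "r \<in> M" if r: "r \<in> carrier KS" and cr: "c * r \<in> M" for r
  proof -
    obtain N a where a: "\<forall>j\<in>J. a j \<in> Ku" "c ^ N * (c * r) - (\<Sum>j\<in>J. a j * g j) \<in> m" using cr by (auto simp: M_def)
    then have "c ^ Suc N * r - (\<Sum>j\<in>J. a j * g j) \<in> m" by (simp add: mult_ac)
    then show ?thesis unfolding M_def using r a(1) by blast
  qed
  have finJ: "finite J" using finite_W by (simp add: J_def)
  have M_g: "g j \<in> M" if j: "j \<in> J" for j
  proof -
    have "(\<Sum>i\<in>J. (if i = j then 1 else 0) * g i) = (\<Sum>i\<in>J. if i = j then g i else 0)"
      by (intro sum.cong refl) auto
    also have "\<dots> = g j" using j finJ by simp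
    finally have "c ^ 0 * g j - (\<Sum>i\<in>J. (if i = j then 1 else 0) * g i) \<in> m" using mc(2) by simp
    moreover have "\<forall>i\<in>J. (if i = j then 1 else 0) \<in> Ku" using Bc(2,6) by auto
    ultimately show ?thesis unfolding M_def using gc[OF j]
      by (intro CollectI conjI exI[of _ 0] exI[of _ "\<lambda>i. if i = j then 1 else 0"])
  qed
  have M_vp: "mon w 1 * vp n \<in> M" if w: "w \<in> W" for w n
  proof (induction n rule: less_induct)
    case (less n)
    have wc: "mon w 1 \<in> carrier KS" using basis_S(1)[OF w] by auto
    show ?case
    proof (cases "n < e")
      case True then show ?thesis using M_g[of "(w, n)"] w by (simp add: J_def g_def)
    next
      case False
      define k where "k = n - e"
      have n: "n = e + k" using False by (simp add: k_def)
      \<comment> \<open>\<open>h\<close> expresses \<open>c v\<^sup>e\<close> by lower powers of \<open>v\<close> modulo \<open>m\<close>\<close>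
      have "c * (mon w 1 * vp n) = mon w 1 * vp k * h + (0 - 1) * (\<Sum>i<e. C i * (mon w 1 * vp (i + k)))"
        unfolding hsum n vp_add c_def by (simp add: algebra_simps sum_distrib_left sum_negf)
      also have "\<dots> \<in> M"
      proof (rule M_add)
        show "mon w 1 * vp k * h \<in> M" by (intro M_m mc(5) h(1) KS_closed(3) wc vpc)
        show "(0 - 1) * (\<Sum>i<e. C i * (mon w 1 * vp (i + k))) \<in> M"
        proof (rule M_mult[OF _ M_sum])
          show "0 - 1 \<in> Ku" by (intro Bc(4) Bc(6) Bc(2))
          fix i assume "i \<in> {..<e}"
          then have "mon w 1 * vp (i + k) \<in> M" using less[of "i + k"] n by simp
          then show "C i * (mon w 1 * vp (i + k)) \<in> M" by (rule M_mult[OF CB])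
        qed
      qed
      finally show ?thesis using M_c[of "mon w 1 * vp n"] wc vpc by blast
    qed
  qed
  have M_all: "r \<in> M" if r: "r \<in> carrier KS" for r
  proof -
    have "(\<Sum>s\<in>supp r. mon s (cf r s)) \<in> M"
    proof (rule M_sum)
      fix s assume "s \<in> supp r"
      then have sS: "s \<in> S" using r by (auto simp: carrier_KS)
      have "mon s (cf r s) = mon (nscale (\<alpha> s) u) (cf r s) * (mon (\<omega> s) 1 * vp (\<beta> s))"
        using decomp[OF sS] by (simp add: vp_def mult_single add_ac)
      also have "\<dots> \<in> M" using decomp[OF sS] by (intro M_mult mon_u_Ku M_vp) simp
      finally show "mon s (cf r s) \<in> M" .
    qed
    then show ?thesis using sum_monomials[of r] by simp
  qed
  define q where "q = 1 + mon u 1 * c"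
  have uB: "mon u 1 \<in> Ku" using mon_u_Ku[of 1 1] by simp
  have qB: "q \<in> Ku" unfolding q_def by (intro Bc(3) Bc(2) Bc(5) cB uB)
  have q0: "q \<noteq> 0"
  proof
    assume "q = 0"
    then have "mon u 1 * (0 - c) = 1" by (simp add: q_def add_eq_0_iff)
    then have "0 \<in> supp (mon u 1 * (0 - c))" by simp
    then obtain y where "0 = u + y" using supp_mon_times[of u 1 "0 - c"] by auto
    then have "u = 0" by (cases u, cases y) (auto simp: zero_prod_def plus_prod_def)
    then show False using u_nonzero by simp
  qed
  have "\<exists>x\<in>Ku. q * x = 1"
  proof (rule unit_of_finitely_generated[OF m subalgebra_Ku Bm qB, where c = c and J = J and g = g and ?i0.0 = "(0, 0)"])
    show "q \<notin> m" using Bm[OF qB] q0 by blast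
    \<comment> \<open>modulo \<open>q = 1 + u c\<close>, the element \<open>- u\<close> is an inverse of \<open>c\<close>\<close>
    show "\<exists>x\<in>Ku. \<exists>y\<in>Ku. x * c ^ N + y * q = 1" for N
    proof -
      define z where "z = (0 - mon u 1) * c"
      have "1 - z ^ N = (1 - z) * (\<Sum>i<N. z ^ i)" by (rule one_diff_power_eq)
      moreover have "1 - z = q" by (simp add: z_def q_def algebra_simps)
      moreover have "z ^ N = (0 - mon u 1) ^ N * c ^ N" unfolding z_def by (rule power_mult_distrib)
      ultimately have "(0 - mon u 1) ^ N * c ^ N + (\<Sum>i<N. z ^ i) * q = 1" by (simp add: algebra_simps)
      moreover have zB: "0 - mon u 1 \<in> Ku" "z \<in> Ku" unfolding z_def by (intro Bc(5) Bc(4) Bc(6) uB cB)+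
      moreover have "(0 - mon u 1) ^ N \<in> Ku" "(\<Sum>i<N. z ^ i) \<in> Ku" by (intro Bc(8) Bc(7) zB)+
      ultimately show ?thesis by blast
    qed
    show "\<exists>N a. (\<forall>j\<in>J. a j \<in> Ku) \<and> c ^ N * r - (\<Sum>j\<in>J. a j * g j) \<in> m" if "r \<in> carrier KS" for r
      using M_all[OF that] by (simp add: M_def)
    show "(0, 0) \<in> J" using zero_W e_pos by (simp add: J_def)
    show "g (0, 0) = 1" by (simp add: g_def vp_def)
  qed (use finJ gc cB in auto)
  then obtain x where "x \<in> Ku" "q * x = 1" by blast
  then show False using Ku_unit[OF cB, of x] c0 by (simp add: q_def c_def)
qed

end

context free_plane_monoid begin

interpretation sw: free_plane_monoid S K v u W \<beta> \<alpha> \<omega> by (rule swapped)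

lemma regular_pair_in_maximal:
  assumes "maximalideal m KS"
  shows "\<exists>p q. p \<in> m \<and> q \<in> m \<and> p \<in> Ku \<and> q \<in> Kv \<and> p \<noteq> 0 \<and> q \<noteq> 0 \<and> regular_pair KS p q"
  using maximal_meets_Ku[OF assms] sw.maximal_meets_Ku[OF assms] regular_pair_Ku_Kv by blast

end

section \<open>Cohen-Macaulayness, and the type at the monomial maximal ideal\<close>

context free_plane_monoid begin

lemma mon_times_Ku:
  assumes "\<And>x. x \<in> supp p \<Longrightarrow> \<exists>i\<le>d. x = nscale i u"
  shows "mon s c * p = (\<Sum>i\<le>d. mon (nscale i u + s) (c * cf p (nscale i u)))"
proof -
  have inj: "inj_on (\<lambda>i. nscale i u) {..d}" using nscale_u_eq by (auto intro: inj_onI)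
  have "supp p \<subseteq> (\<lambda>i. nscale i u) ` {..d}" using assms by blast
  then have "(\<Sum>z\<in>supp p. mon z (cf p z)) = (\<Sum>z\<in>(\<lambda>i. nscale i u) ` {..d}. mon z (cf p z))"
    by (intro sum.mono_neutral_left) (auto simp: in_keys_iff)
  also have "\<dots> = (\<Sum>i\<le>d. mon (nscale i u) (cf p (nscale i u)))" by (simp add: sum.reindex[OF inj])
  finally have "p = (\<Sum>i\<le>d. mon (nscale i u) (cf p (nscale i u)))"
    by (rule trans[OF sum_monomials])
  from arg_cong[OF this, of "\<lambda>r. mon s c * r"]
  have "mon s c * p = (\<Sum>i\<le>d. mon s c * mon (nscale i u) (cf p (nscale i u)))"
    unfolding sum_distrib_left .
  also have "\<dots> = (\<Sum>i\<le>d. mon (nscale i u + s) (c * cf p (nscale i u)))"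
    by (intro sum.cong refl) (simp add: mult_single add.commute)
  finally show ?thesis .
qed

end

context free_plane_monoid begin

interpretation sw: free_plane_monoid S K v u W \<beta> \<alpha> \<omega> by (rule swapped)

lemma localized_KS: "maximalideal m KS \<Longrightarrow> localized_domain KS m"
  using noetherian_domain_KS KS.maximalideal_prime by (simp add: localized_domain_def)

lemma two_dim_local_KS:
  assumes m: "maximalideal m KS" and reg: "regular_pair KS p q" and pq: "p \<in> m" "q \<in> m"
  shows "two_dim_local (localization KS m) (localized_domain.mL KS m) (localized_domain.emb KS m p) (localized_domain.emb KS m q)"
  by (rule localized_domain.two_dim_local_L[OF localized_KS[OF m] _ reg pq]) (rule no_long_prime_chain)

lemma cohen_macaulay_KS: "cohen_macaulay KS"
  unfolding cohen_macaulay_def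
proof (intro conjI allI impI)
  show "cring KS" by (rule KS.is_cring)
  show "noetherian_ring KS" by (rule noetherian_KS)
  fix m assume m: "maximalideal m KS"
  obtain p q where pq: "p \<in> m" "q \<in> m" "regular_pair KS p q" using regular_pair_in_maximal[OF m] by blast
  show "cohen_macaulay_local (localization KS m)"
    by (rule two_dim_local.cohen_macaulay_local[OF two_dim_local_KS[OF m pq(3,1,2)]])
qed

text \<open>
  The socle basis carries over to the local ring, where linkage transports it to all maximal regular sequences.
\<close>

lemma cm_type_KS:
  assumes m: "maximalideal m KS" and reg: "regular_pair KS p q" and pq: "p \<in> m" "q \<in> m"
    and b: "socle_basis KS m (Idl\<^bsub>KS\<^esub> {p, q}) n b"
  shows "cm_type (localization KS m) = n"
proof -
  interpret loc: localized_domain KS m by (rule localized_KS[OF m])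
  have c: "p \<in> carrier KS" "q \<in> carrier KS" using reg by (auto simp: regular_pair_def)
  show ?thesis
    by (rule two_dim_local.cm_type_eq[OF two_dim_local_KS[OF m reg pq] loc.socle_basis_L[OF c b]])
qed

text \<open>
  The kernel of the evaluation at the origin.
\<close>

definition M0 :: "'k bipoly set" where "M0 = {p \<in> carrier KS. cf p 0 = 0}"

lemma plus_zero_iff: "x + y = 0 \<longleftrightarrow> x = 0 \<and> y = 0" for x y :: "nat \<times> nat"
  by (cases x, cases y) (auto simp: zero_prod_def)

lemma cf_times_zero: "cf (p * q) 0 = cf p 0 * cf q 0" for p q :: "'k bipoly"
  using cf_times_unique[of p q 0 0] by (simp add: plus_zero_iff)

lemma maximal_M0: "maximalideal M0 KS"
proof -
  have I: "ideal M0 KS"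
  proof (rule idealI[OF KS.ring_axioms])
    show "subgroup M0 (add_monoid KS)"
    proof (rule KS.add.subgroupI)
      show "M0 \<noteq> {}" using KS_closed(6) by (auto simp: M0_def intro!: exI[of _ 0])
      show "\<ominus>\<^bsub>KS\<^esub> p \<in> M0" if "p \<in> M0" for p using that by (auto simp: M0_def)
    qed (auto simp: M0_def lookup_add)
  qed (auto simp: M0_def cf_times_zero)
  show ?thesis
  proof (rule maximalidealI[OF I])
    have "1 \<notin> M0" by (simp add: M0_def)
    then show "carrier KS \<noteq> M0" using KS_closed(7) by blast
    fix J assume J: "ideal J KS" "M0 \<subseteq> J" "J \<subseteq> carrier KS"
    note Jc = ideal_KS[OF J(1)]
    show "J = M0 \<or> J = carrier KS"
    proof (cases "J \<subseteq> M0")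
      case False
      then obtain p where p: "p \<in> J" "p \<notin> M0" by blast
      have pc: "p \<in> carrier KS" by (rule Jc(1)[OF p(1)])
      define c where "c = cf p 0"
      have c0: "c \<noteq> 0" using p pc by (simp add: M0_def c_def)
      have mc: "mon 0 e \<in> carrier KS" for e using zero_S by blast
      have "p - mon 0 c \<in> M0" using KS_closed(2)[OF pc mc[of c]] by (simp add: M0_def lookup_minus c_def)
      then have "p - mon 0 c \<in> J" using J(2) by blast
      then have "p - (p - mon 0 c) \<in> J" using Jc(4) p(1) by blast
      then have "mon 0 (inverse c) * mon 0 c \<in> J" using Jc(5) mc by simp
      then have "\<one>\<^bsub>KS\<^esub> \<in> J" using c0 by (simp add: mult_single)
      then show ?thesis using ideal.one_imp_carrier[OF J(1)] by blast
    qed (use J in blast)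
  qed
qed

lemma monomial_max_ideal_eq: "monomial_max_ideal S = M0"
  unfolding monomial_max_ideal_def
proof
  let ?G = "(\<lambda>s. mon s 1) ` (S - {0})"
  have M0: "ideal M0 KS" using maximal_M0 by (rule maximalideal.axioms(1))
  have GM: "?G \<subseteq> M0" by (auto simp: M0_def lookup_single when_def)
  show "Idl\<^bsub>KS\<^esub> ?G \<subseteq> M0" by (rule KS.genideal_minimal[OF M0 GM])
  have Gc: "?G \<subseteq> carrier KS" by auto
  note J = ideal_KS[OF KS.genideal_ideal[OF Gc]]
  show "M0 \<subseteq> Idl\<^bsub>KS\<^esub> ?G"
  proof
    fix p assume p: "p \<in> M0"
    have "(\<Sum>s\<in>supp p. mon 0 (cf p s) * mon s 1) \<in> Idl\<^bsub>KS\<^esub> ?G"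
    proof (intro J(7) J(5))
      fix s assume "s \<in> supp p"
      then have "s \<in> S - {0}" using p by (auto simp: M0_def carrier_KS in_keys_iff)
      then show "mon s 1 \<in> Idl\<^bsub>KS\<^esub> ?G" using KS.genideal_self[OF Gc] by blast
      show "mon 0 (cf p s) \<in> carrier KS" using zero_S by blast
    qed
    then show "p \<in> Idl\<^bsub>KS\<^esub> ?G" using sum_monomials[of p] by (simp add: mult_single)
  qed
qed

lemma S_not_W:
  assumes "s \<in> S" "s \<notin> W"
  shows "\<exists>t\<in>S. s = u + t \<or> s = v + t"
proof -
  note d = decomp[OF assms(1)]
  have "\<alpha> s \<noteq> 0 \<or> \<beta> s \<noteq> 0"
  proof (rule ccontr)
    assume "\<not> ?thesis"
    then have "nscale (\<alpha> s) u + nscale (\<beta> s) v + \<omega> s = \<omega> s" by simp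
    then have "s = \<omega> s" using conjunct2[OF d] by (rule trans[rotated])
    then show False using conjunct1[OF d] assms(2) by simp
  qed
  then show ?thesis
  proof
    assume "\<alpha> s \<noteq> 0"
    then obtain n where "\<alpha> s = Suc n" using not0_implies_Suc by blast
    then have "s = u + (nscale n u + nscale (\<beta> s) v + \<omega> s)" using d by (simp add: add_ac)
    then show ?thesis using rep[of "\<omega> s" n "\<beta> s"] d by blast
  next
    assume "\<beta> s \<noteq> 0"
    then obtain n where "\<beta> s = Suc n" using not0_implies_Suc by blast
    then have "s = v + (nscale (\<alpha> s) u + nscale n v + \<omega> s)" using d by (simp add: add_ac)
    then show ?thesis using rep[of "\<omega> s" "\<alpha> s" n] d by blast
  qed
qed

lemma uv_plus_not_W: "t \<in> S \<Longrightarrow> u + t \<notin> W \<and> v + t \<notin> W"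
  using shift_u(2)[of t 1] shift_v(3)[of t 1] basis_S(2,3) by fastforce

text \<open>
  The basis \<open>W\<close> is the complement of \<open>(u + S) \<union> (v + S)\<close> in \<open>S\<close>.
\<close>

lemma Idl_uv: "Idl\<^bsub>KS\<^esub> {mon u 1, mon v 1} = {p. supp p \<subseteq> S - W}"
proof -
  have uS: "u \<in> S" "v \<in> S" using u_S(1)[of 1] v_S(1)[of 1] by auto
  have c: "mon u 1 \<in> carrier KS" "mon v 1 \<in> carrier KS" using uS by auto
  note J = ideal_KS[OF KS.ideal_pair[OF c]]
  show ?thesis
  proof (intro equalityI subsetI)
    fix p assume "p \<in> Idl\<^bsub>KS\<^esub> {mon u 1, mon v 1}"
    then obtain x y where xy: "x \<in> carrier KS" "y \<in> carrier KS" "p = mon u 1 * x + mon v 1 * y"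
      unfolding KS.Idl_pair[OF c] KS_ops mult.commute[of _ "mon u 1"] mult.commute[of _ "mon v 1"] by blast
    have "supp (mon t 1 * z) \<subseteq> S - W" if "z \<in> carrier KS" "t = u \<or> t = v" for z t
    proof
      fix s assume "s \<in> supp (mon t 1 * z)"
      then obtain s' where s': "s' \<in> supp z" "s = t + s'" using supp_mon_times[of t 1 z] by blast
      then have "s' \<in> S" using that by (auto simp: carrier_KS)
      then show "s \<in> S - W" unfolding s'(2) using that(2) uv_plus_not_W add_S uS by blast
    qed
    then have "supp p \<subseteq> S - W" unfolding xy(3) using xy(1,2) by (intro supp_add_subset) blast+
    then show "p \<in> {p. supp p \<subseteq> S - W}" by simp
  next
    fix p :: "'k bipoly" assume "p \<in> {p. supp p \<subseteq> S - W}"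
    then have p: "supp p \<subseteq> S - W" by simp
    have g: "mon u 1 \<in> Idl\<^bsub>KS\<^esub> {mon u 1, mon v 1}" "mon v 1 \<in> Idl\<^bsub>KS\<^esub> {mon u 1, mon v 1}"
      using KS.genideal_self[of "{mon u 1, mon v 1}"] c by auto
    have "(\<Sum>s\<in>supp p. mon s (cf p s)) \<in> Idl\<^bsub>KS\<^esub> {mon u 1, mon v 1}"
    proof (rule J(7))
      fix s assume "s \<in> supp p"
      then obtain t where t: "t \<in> S" "s = u + t \<or> s = v + t" using S_not_W[of s] p by blast
      have "mon u 1 * mon t (cf p s) \<in> Idl\<^bsub>KS\<^esub> {mon u 1, mon v 1}"
        "mon v 1 * mon t (cf p s) \<in> Idl\<^bsub>KS\<^esub> {mon u 1, mon v 1}"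
        using t(1) g by (auto intro!: J(6))
      then show "mon s (cf p s) \<in> Idl\<^bsub>KS\<^esub> {mon u 1, mon v 1}" using t(2) by (auto simp: mult_single)
    qed
    then show "p \<in> Idl\<^bsub>KS\<^esub> {mon u 1, mon v 1}" using sum_monomials[of p] by simp
  qed
qed

text \<open>
  All ideals involved are spanned by monomials, so the socle modulo \<open>t\<^sup>u, t\<^sup>v\<close> is spanned by the monomials
  of the basis \<open>W\<close> that every nonzero element of \<open>S\<close> moves out of \<open>W\<close>.
\<close>

lemma socle_basis_M0:
  assumes z: "bij_betw z {..<n} {w \<in> W. \<forall>s\<in>S - {0}. w + s \<notin> W}"
  shows "socle_basis KS M0 (Idl\<^bsub>KS\<^esub> {mon u 1, mon v 1}) n (\<lambda>i. mon (z i) 1)"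
proof -
  let ?Z = "{w \<in> W. \<forall>s\<in>S - {0}. w + s \<notin> W}"
  have zi: "z i \<in> W" "z i \<in> S" "\<And>s. s \<in> S \<Longrightarrow> s \<noteq> 0 \<Longrightarrow> z i + s \<notin> W" if "i < n" for i
  proof -
    have "z i \<in> ?Z" using z that by (auto simp: bij_betw_def)
    then show "z i \<in> W" "z i \<in> S" "\<And>s. s \<in> S \<Longrightarrow> s \<noteq> 0 \<Longrightarrow> z i + s \<notin> W" using basis_S(1) by auto
  qed
  have zinj: "i = j" if "i < n" "j < n" "z i = z j" for i j using z that by (auto simp: bij_betw_def inj_on_def)
  have fs: "finsum KS (\<lambda>i. c i \<otimes>\<^bsub>KS\<^esub> mon (z i) 1) {..<n} = (\<Sum>i<n. c i * mon (z i) 1)"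
    if "c \<in> {..<n} \<rightarrow> carrier KS" for c
    using that zi(2) by (subst KS_finsum) auto
  show ?thesis unfolding socle_basis_def Idl_uv
  proof (intro conjI allI impI ballI)
    fix i assume i: "i < n"
    show "mon (z i) 1 \<in> carrier KS" using zi(2)[OF i] by auto
    fix r assume r: "r \<in> M0"
    have "supp (r * mon (z i) 1) \<subseteq> S - W"
    proof
      fix s assume "s \<in> supp (r * mon (z i) 1)"
      then obtain t where t: "t \<in> supp r" "s = z i + t"
        using supp_mon_times[of "z i" 1 r] by (auto simp: mult.commute)
      then have "t \<in> S" "t \<noteq> 0" using r by (auto simp: M0_def carrier_KS in_keys_iff)
      then show "s \<in> S - W" unfolding t(2) using zi[OF i] add_S by blast
    qed
    then show "r \<otimes>\<^bsub>KS\<^esub> mon (z i) 1 \<in> {p. supp p \<subseteq> S - W}" by simp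
  next
    fix p assume p: "p \<in> carrier KS" "\<forall>r\<in>M0. r \<otimes>\<^bsub>KS\<^esub> p \<in> {p. supp p \<subseteq> S - W}"
    have key: "x \<in> ?Z" if x: "x \<in> supp p" "x \<in> W" for x
    proof -
      have "x + s \<notin> W" if s: "s \<in> S - {0}" for s
      proof -
        have "mon s 1 \<in> M0" using s by (auto simp: M0_def lookup_single when_def)
        then have "supp (mon s 1 * p) \<subseteq> S - W" using p(2) by auto
        moreover have "s + x \<in> supp (mon s 1 * p)" using cf_mon_times[of s 1 p x] x(1) by (simp add: in_keys_iff)
        ultimately show ?thesis by (auto simp: add.commute)
      qed
      then show ?thesis using x(2) by blast
    qed
    define c where "c = (\<lambda>i. mon 0 (cf p (z i)))"
    have cc: "c \<in> {..<n} \<rightarrow> carrier KS" unfolding c_def using zero_S by auto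
    have sc: "(\<Sum>i<n. c i * mon (z i) 1) \<in> carrier KS" using cc zi(2) by (intro KS_closed(8) KS_closed(3)) auto
    have coef: "cf (\<Sum>i<n. c i * mon (z i) 1) x = (\<Sum>i<n. if z i = x then cf p x else 0)" for x
      unfolding lookup_sum c_def by (intro sum.cong refl) (auto simp: mult_single lookup_single when_def)
    have "supp (p - (\<Sum>i<n. c i * mon (z i) 1)) \<subseteq> S - W"
    proof
      fix x assume x: "x \<in> supp (p - (\<Sum>i<n. c i * mon (z i) 1))"
      have xS: "x \<in> S" using x KS_closed(2)[OF p(1) sc] by (auto simp: carrier_KS)
      moreover have "x \<notin> W"
      proof
        assume xW: "x \<in> W"
        have ne: "cf p x \<noteq> (\<Sum>i<n. if z i = x then cf p x else 0)"
          using x coef[of x] by (simp add: in_keys_iff lookup_minus)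
        then have "cf p x \<noteq> 0" by (auto simp: if_distrib cong: if_cong)
        then have "x \<in> ?Z" using key xW by (simp add: in_keys_iff)
        then have "x \<in> z ` {..<n}" unfolding bij_betw_imp_surj_on[OF z] .
        then obtain i where i: "i < n" "z i = x" by auto
        have "(\<Sum>j<n. if z j = x then cf p x else 0) = (\<Sum>j<n. if j = i then cf p x else 0)"
          using zinj i by (intro sum.cong refl) auto
        then show False using ne i(1) by simp
      qed
      ultimately show "x \<in> S - W" by blast
    qed
    then have "p \<ominus>\<^bsub>KS\<^esub> finsum KS (\<lambda>i. c i \<otimes>\<^bsub>KS\<^esub> mon (z i) 1) {..<n} \<in> {p. supp p \<subseteq> S - W}"
      unfolding fs[OF cc] using sc by simp
    then show "\<exists>c\<in>{..<n} \<rightarrow> carrier KS. p \<ominus>\<^bsub>KS\<^esub> finsum KS (\<lambda>i. c i \<otimes>\<^bsub>KS\<^esub> mon (z i) 1) {..<n} \<in> {p. supp p \<subseteq> S - W}"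
      using cc by blast
  next
    fix c i assume cc: "c \<in> {..<n} \<rightarrow> carrier KS"
      and s: "finsum KS (\<lambda>i. c i \<otimes>\<^bsub>KS\<^esub> mon (z i) 1) {..<n} \<in> {p. supp p \<subseteq> S - W}" and i: "i < n"
    have "cf (\<Sum>j<n. c j * mon (z j) 1) (z i) = (\<Sum>j<n. if j = i then cf (c i) 0 else 0)"
      unfolding lookup_sum
    proof (intro sum.cong refl)
      fix j assume j: "j \<in> {..<n}"
      show "cf (c j * mon (z j) 1) (z i) = (if j = i then cf (c i) 0 else 0)"
      proof (cases "j = i")
        case True
        then show ?thesis using cf_mon_times[of "z i" 1 "c i" 0] by (simp add: mult.commute)
      next
        case False
        have "z i \<notin> supp (mon (z j) 1 * c j)"
        proof
          assume "z i \<in> supp (mon (z j) 1 * c j)"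
          then obtain t where t: "t \<in> supp (c j)" "z i = z j + t" using supp_mon_times[of "z j" 1 "c j"] by blast
          have "c j \<in> carrier KS" using cc j by auto
          then have "t \<in> S" using t(1) by (auto simp: carrier_KS)
          moreover have "t \<noteq> 0" using t(2) zinj[of i j] i j False by auto
          ultimately show False using zi(3)[of j t] zi(1)[OF i] t(2) j by auto
        qed
        then show ?thesis using False by (simp add: in_keys_iff mult.commute)
      qed
    qed
    also have "\<dots> = cf (c i) 0" using i by simp
    finally have "cf (c i) 0 = cf (\<Sum>j<n. c j * mon (z j) 1) (z i)" by simp
    moreover have "z i \<notin> supp (\<Sum>j<n. c j * mon (z j) 1)" using s zi(1)[OF i] unfolding fs[OF cc] by blast
    ultimately show "c i \<in> M0" using cc i by (auto simp: M0_def in_keys_iff)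
  qed
qed

lemma mon_uv_regular: "regular_pair KS (mon u 1) (mon v 1)"
proof (rule regular_pair_Ku_Kv)
  show "mon u 1 \<in> Ku" using mon_u_Ku[of 1 1] by simp
  show "mon v 1 \<in> sw.Ku" using sw.mon_u_Ku[of 1 1] by simp
  have "cf (mon t (1::'k)) t = 1" for t by simp
  then show "mon u (1::'k) \<noteq> 0" "mon v (1::'k) \<noteq> 0" by (metis lookup_zero zero_neq_one)+
qed

lemma semigroup_ring_type_eq:
  assumes "bij_betw z {..<n} {w \<in> W. \<forall>s\<in>S - {0}. w + s \<notin> W}"
  shows "semigroup_ring_type K S = n"
proof -
  have uS: "u \<in> S" "v \<in> S" using u_S(1)[of 1] v_S(1)[of 1] by auto
  have "mon u 1 \<in> M0" "mon v 1 \<in> M0"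
    using uS u_nonzero sw.u_nonzero by (auto simp: M0_def lookup_single when_def)
  then show ?thesis
    unfolding semigroup_ring_type_def monomial_max_ideal_eq
    by (rule cm_type_KS[OF maximal_M0 mon_uv_regular _ _ socle_basis_M0[OF assms]])
qed

end

section \<open>A residue functional, and rings of type one\<close>

text \<open>
  The linear recurrence whose characteristic polynomial has the coefficients \<open>c 0, \<dots>, c d\<close>, with initial
  values \<open>0, \<dots>, 0, 1\<close>. As a functional on polynomials it reads off the coefficient of \<open>x\<^sup>d\<^sup>-\<^sup>1\<close> in
  the remainder modulo the characteristic polynomial.
\<close>

fun lin_rec :: "(nat \<Rightarrow> 'k::field) \<Rightarrow> nat \<Rightarrow> nat \<Rightarrow> 'k" where
  "lin_rec c d n = (if n < d then if Suc n = d then 1 else 0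
     else - (\<Sum>i<d. c i * lin_rec c d (n - d + i)) / c d)"

declare lin_rec.simps [simp del]

lemma lin_rec_relation:
  assumes "c d \<noteq> 0"
  shows "(\<Sum>i\<le>d. c i * lin_rec c d (n + i)) = 0"
proof -
  have "(\<Sum>i\<le>d. c i * lin_rec c d (n + i)) = c d * lin_rec c d (n + d) + (\<Sum>i<d. c i * lin_rec c d (n + i))"
    by (simp add: lessThan_Suc_atMost[symmetric])
  also have "lin_rec c d (n + d) = - (\<Sum>i<d. c i * lin_rec c d (n + i)) / c d"
    by (subst lin_rec.simps) simp
  finally show ?thesis using assms by simp
qed

lemma lin_rec_initial: "Suc n < d \<Longrightarrow> lin_rec c d n = 0" "Suc n = d \<Longrightarrow> lin_rec c d n = 1"
  by (simp_all add: lin_rec.simps)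

text \<open>
  A matrix that is unitriangular for the order given by a key is invertible. In the row of an index with the largest key
  in the support of a vector only the diagonal term survives, and a system of equations can be solved in the order
  of increasing keys.
\<close>

lemma unitriangular_injective:
  fixes A :: "'x \<Rightarrow> 'x \<Rightarrow> 'k::field" and key :: "'x \<Rightarrow> nat"
  assumes fin: "finite I" and diag: "\<And>x. x \<in> I \<Longrightarrow> A x x = 1"
    and tri: "\<And>x y. \<lbrakk>x \<in> I; y \<in> I; A x y \<noteq> 0\<rbrakk> \<Longrightarrow> y = x \<or> key x < key y"
    and zero: "\<And>x. x \<in> I \<Longrightarrow> (\<Sum>y\<in>I. A x y * r y) = 0" and y: "y \<in> I"
  shows "r y = 0"
proof (rule ccontr)
  assume ry: "r y \<noteq> 0"
  let ?N = "{y \<in> I. r y \<noteq> 0}"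
  have ne: "key ` ?N \<noteq> {}" using y ry by auto
  have "Max (key ` ?N) \<in> key ` ?N" using ne fin by (intro Max_in) auto
  then obtain x where x: "x \<in> I" "r x \<noteq> 0" "key x = Max (key ` ?N)" by auto
  have "(\<Sum>y\<in>I. A x y * r y) = (\<Sum>y\<in>I. if y = x then r x else 0)"
  proof (intro sum.cong refl)
    fix z assume z: "z \<in> I"
    show "A x z * r z = (if z = x then r x else 0)"
    proof (cases "z = x")
      case False
      have "r z = 0 \<or> key z \<le> key x" unfolding x(3) using fin z by (auto intro!: Max_ge)
      then show ?thesis using tri[OF x(1) z] False by (cases "A x z = 0") auto
    qed (use diag x in auto)
  qed
  then show False using zero[OF x(1)] x(1,2) fin by simp
qed

lemma unitriangular_surjective:
  fixes A :: "'x \<Rightarrow> 'x \<Rightarrow> 'k::field" and key :: "'x \<Rightarrow> nat"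
  assumes fin: "finite I" and diag: "\<And>x. x \<in> I \<Longrightarrow> A x x = 1"
    and tri: "\<And>x y. \<lbrakk>x \<in> I; y \<in> I; A x y \<noteq> 0\<rbrakk> \<Longrightarrow> y = x \<or> key x < key y"
  shows "\<exists>c. \<forall>y\<in>I. (\<Sum>x\<in>I. c x * A x y) = \<phi> y"
proof -
  have "\<exists>c. (\<forall>x. n \<le> key x \<longrightarrow> c x = 0) \<and> (\<forall>y\<in>I. key y < n \<longrightarrow> (\<Sum>x\<in>I. c x * A x y) = \<phi> y)" for n
  proof (induction n)
    case 0 show ?case by (intro exI[of _ "\<lambda>_. 0"]) simp
  next
    case (Suc n)
    then obtain c where c: "\<And>x. n \<le> key x \<Longrightarrow> c x = 0" "\<And>y. y \<in> I \<Longrightarrow> key y < n \<Longrightarrow> (\<Sum>x\<in>I. c x * A x y) = \<phi> y"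
      by blast
    define c' where "c' = (\<lambda>x. if key x = n then \<phi> x - (\<Sum>x'\<in>I. c x' * A x' x) else c x)"
    have "(\<Sum>x\<in>I. c' x * A x y) = \<phi> y" if y: "y \<in> I" "key y < Suc n" for y
    proof -
      have "(\<Sum>x\<in>I. c' x * A x y) = (\<Sum>x\<in>I. c x * A x y + (if x = y \<and> key y = n then \<phi> y - (\<Sum>x'\<in>I. c x' * A x' y) else 0))"
      proof (intro sum.cong refl)
        fix x assume x: "x \<in> I"
        show "c' x * A x y = c x * A x y + (if x = y \<and> key y = n then \<phi> y - (\<Sum>x'\<in>I. c x' * A x' y) else 0)"
          using tri[OF x y(1)] c(1)[of x] diag[OF x] y(2) by (cases "A x y = 0"; cases "x = y") (auto simp: c'_def)
      qed
      also have "\<dots> = (\<Sum>x\<in>I. c x * A x y) + (if key y = n then \<phi> y - (\<Sum>x'\<in>I. c x' * A x' y) else 0)"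
        using fin y(1) by (cases "key y = n") (simp_all add: sum.distrib)
      also have "\<dots> = \<phi> y" using c(2)[OF y(1)] y(2) by auto
      finally show ?thesis .
    qed
    moreover have "\<forall>x. Suc n \<le> key x \<longrightarrow> c' x = 0" using c(1) by (auto simp: c'_def)
    ultimately show ?case by blast
  qed
  from this[of "Suc (Max (key ` I))"]
  obtain c where c: "\<forall>y\<in>I. key y < Suc (Max (key ` I)) \<longrightarrow> (\<Sum>x\<in>I. c x * A x y) = \<phi> y" by blast
  have "key y < Suc (Max (key ` I))" if "y \<in> I" for y using fin that by (auto simp: less_Suc_eq_le)
  then show ?thesis using c by blast
qed

lemma functional_separating:
  fixes J :: "'k::field bipoly set"
  assumes J: "bipoly.subspace J" and y: "y \<notin> J"
  shows "\<exists>\<phi>. (\<forall>p q. \<phi> (p + q) = \<phi> p + \<phi> q) \<and> (\<forall>c p. \<phi> (cscale c p) = c * \<phi> p) \<and> (\<forall>p\<in>J. \<phi> p = (0::'k)) \<and> \<phi> y \<noteq> 0"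
proof -
  interpret vp: vector_space_pair cscale "(*) :: 'k \<Rightarrow> 'k \<Rightarrow> 'k"
    by unfold_locales (auto simp: algebra_simps)
  obtain B where B: "B \<subseteq> J" "bipoly.independent B" "J \<subseteq> bipoly.span B"
    using bipoly.maximal_independent_subset[of J] by blast
  have "bipoly.span B = J" using B J bipoly.span_minimal by blast
  then have "bipoly.independent (insert y B)" using B(2) y by (simp add: bipoly.independent_insertI)
  then obtain \<phi> where \<phi>: "Vector_Spaces.linear cscale (*) \<phi>" "\<forall>b\<in>insert y B. \<phi> b = (if b = y then 1 else 0)"
    using vp.linear_independent_extend[of "insert y B" "\<lambda>b. if b = y then 1 else 0"] by blast
  interpret \<phi>: Vector_Spaces.linear cscale "(*)" \<phi> by (rule \<phi>(1))
  have yB: "y \<notin> B" using y B(1) by blast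
  have "\<phi> p = 0" if "p \<in> J" for p
  proof (rule vp.linear_eq_0_on_span[OF \<phi>(1)])
    show "p \<in> bipoly.span B" using that B(3) by blast
    show "\<phi> b = 0" if "b \<in> B" for b using \<phi>(2) that yB by auto
  qed
  then show ?thesis using \<phi>(2) by (intro exI[of _ \<phi>]) (auto simp: \<phi>.add \<phi>.scale)
qed

context free_plane_monoid begin

interpretation sw: free_plane_monoid S K v u W \<beta> \<alpha> \<omega> by (rule swapped)

text \<open>
  Suppose that \<open>w \<mapsto> \<delta> w\<close> is a duality on the basis \<open>W\<close>, with \<open>\<delta> w + w\<close> equal to a top element, and triangular for
  some rank. Then the quotient by \<open>p \<in> K[u]\<close> and \<open>q \<in> K[v]\<close> is a Frobenius algebra: taking the product
  of the residue functionals of \<open>p\<close> and \<open>q\<close> on the component of the top element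
  gives a linear form \<open>\<Lambda>\<close> for which \<open>(x, y) \<mapsto> \<Lambda> (x y)\<close> is nondegenerate. In a Frobenius algebra
  the annihilator of a maximal ideal is generated by any of its nonzero elements \<open>x\<close>: a linear
  form that vanishes on \<open>(x)\<close> is given by some \<open>w\<close> with \<open>w x = 0\<close>, so that \<open>w \<in> m\<close>, and hence it
  vanishes on the annihilator of \<open>m\<close>.
\<close>

lemma socle_basis_frobenius:
  assumes m: "maximalideal m KS" and pm: "p \<in> m" and qm: "q \<in> m"
    and p: "p \<in> Ku" "p \<noteq> 0" and q: "q \<in> Kv" "q \<noteq> 0"
    and dual: "\<And>w. w \<in> W \<Longrightarrow> \<delta> w \<in> W \<and> \<delta> w + w = \<tau>"
    and rank: "\<And>w w'. \<lbrakk>w \<in> W; w' \<in> W; \<omega> (\<delta> w + w') = \<tau>\<rbrakk> \<Longrightarrow> w' = w \<or> rank w < (rank w' :: nat)"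
    and \<tau>: "\<tau> \<in> W"
    and x: "x \<in> carrier KS" "x \<notin> Idl\<^bsub>KS\<^esub> {p, q}" "\<And>r. r \<in> m \<Longrightarrow> r * x \<in> Idl\<^bsub>KS\<^esub> {p, q}"
  shows "socle_basis KS m (Idl\<^bsub>KS\<^esub> {p, q}) 1 (\<lambda>_. x)"
proof -
  interpret m: maximalideal m KS by fact
  note mc = ideal_KS[OF m.ideal_axioms]
  define I where "I = Idl\<^bsub>KS\<^esub> {p, q}"
  have pc: "p \<in> carrier KS" "q \<in> carrier KS" using mc(1) pm qm by auto
  have Ii: "ideal I KS" unfolding I_def by (rule KS.ideal_pair[OF pc])
  note Ic = ideal_KS[OF Ii]
  have pqI: "p \<in> I" "q \<in> I" unfolding I_def using KS.genideal_self[of "{p, q}"] pc by auto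
  have I_iff: "r \<in> I \<longleftrightarrow> (\<exists>a b. a \<in> carrier KS \<and> b \<in> carrier KS \<and> r = a * p + b * q)" for r
    unfolding I_def KS.Idl_pair[OF pc] by auto
  obtain P where P: "cf p (nscale P u) \<noteq> 0" "\<And>x. x \<in> supp p \<Longrightarrow> \<exists>i\<le>P. x = nscale i u" using Ku_degree[OF p] by blast
  obtain Q where Q: "cf q (nscale Q v) \<noteq> 0" "\<And>x. x \<in> supp q \<Longrightarrow> \<exists>i\<le>Q. x = nscale i v" using sw.Ku_degree[OF q] by blast
  have one_m: "1 \<notin> m" using m.one_imp_carrier m.I_notcarr by auto
  have mono0: "mon 0 c \<in> carrier KS" for c using zero_S by blast
  have const: "c = 0" if "mon 0 c \<in> m" for c
  proof (rule ccontr)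
    assume "c \<noteq> 0"
    then have "mon 0 (inverse c) * mon 0 c = 1" by (simp add: mult_single)
    then show False using mc(5)[OF that mono0] one_m by metis
  qed
  \<comment> \<open>a polynomial of degree zero would be a unit in \<open>m\<close>\<close>
  have P0: "P \<noteq> 0"
  proof
    assume "P = 0"
    then have "supp p = {0}" using P by (auto simp: in_keys_iff)
    then have "p = mon 0 (cf p 0)" using sum_monomials[of p] by simp
    then show False using const[of "cf p 0"] pm P(1) \<open>P = 0\<close> by simp
  qed
  have Q0: "Q \<noteq> 0"
  proof
    assume "Q = 0"
    then have "supp q = {0}" using Q by (auto simp: in_keys_iff)
    then have "q = mon 0 (cf q 0)" using sum_monomials[of q] by simp
    then show False using const[of "cf q 0"] qm Q(1) \<open>Q = 0\<close> by simp
  qed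
  \<comment> \<open>\<open>\<Lambda>\<close> vanishes on multiples of \<open>p\<close> and \<open>q\<close> by the recurrences of \<open>lp\<close> and \<open>lq\<close>\<close>
  define lp where "lp = lin_rec (\<lambda>i. cf p (nscale i u)) P"
  define lq where "lq = lin_rec (\<lambda>i. cf q (nscale i v)) Q"
  define l where "l = (\<lambda>x. if \<omega> x = \<tau> then lp (\<alpha> x) * lq (\<beta> x) else 0)"
  define \<Lambda> where "\<Lambda> = (\<lambda>r :: 'k bipoly. \<Sum>s\<in>supp r. cf r s * l s)"
  have \<Lambda>_sup: "\<Lambda> r = (\<Sum>s\<in>T. cf r s * l s)" if "finite T" "supp r \<subseteq> T" for r T
    unfolding \<Lambda>_def using that by (intro sum.mono_neutral_left) (auto simp: in_keys_iff)
  have \<Lambda>_add: "\<Lambda> (r + r') = \<Lambda> r + \<Lambda> r'" for r r'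
    using \<Lambda>_sup[of "supp r \<union> supp r'" r] \<Lambda>_sup[of "supp r \<union> supp r'" r'] \<Lambda>_sup[of "supp r \<union> supp r'" "r + r'"]
      keys_add[of r r'] by (simp add: lookup_add distrib_right sum.distrib)
  have \<Lambda>_mon: "\<Lambda> (mon s c) = c * l s" for s c by (simp add: \<Lambda>_def)
  have \<Lambda>_0: "\<Lambda> 0 = 0" by (simp add: \<Lambda>_def)
  have \<Lambda>_sum: "\<Lambda> (sum f A) = (\<Sum>i\<in>A. \<Lambda> (f i))" for f :: "'z \<Rightarrow> 'k bipoly" and A
    by (induction A rule: infinite_finite_induct) (simp_all add: \<Lambda>_add \<Lambda>_0)
  have \<Lambda>_mon_p: "\<Lambda> (mon s c * p) = 0" if s: "s \<in> S" for s c
  proof -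
    have "\<Lambda> (mon s c * p) = (\<Sum>i\<le>P. c * cf p (nscale i u) * l (nscale i u + s))"
    proof -
      have "mon s c * p = (\<Sum>i\<le>P. mon (nscale i u + s) (c * cf p (nscale i u)))"
        by (rule mon_times_Ku) (rule P(2))
      then show ?thesis by (simp only: \<Lambda>_sum \<Lambda>_mon)
    qed
    also have "\<dots> = (\<Sum>i\<le>P. (if \<omega> s = \<tau> then c * lq (\<beta> s) else 0) * (cf p (nscale i u) * lp (\<alpha> s + i)))"
      by (intro sum.cong refl) (simp add: l_def shift_u[OF s] mult_ac add.commute[of "\<alpha> s"])
    also have "\<dots> = (if \<omega> s = \<tau> then c * lq (\<beta> s) else 0) * (\<Sum>i\<le>P. cf p (nscale i u) * lp (\<alpha> s + i))"
      by (simp only: sum_distrib_left)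
    also have "(\<Sum>i\<le>P. cf p (nscale i u) * lp (\<alpha> s + i)) = 0"
      unfolding lp_def by (rule lin_rec_relation) (rule P(1))
    finally show ?thesis by simp
  qed
  have \<Lambda>_mon_q: "\<Lambda> (mon s c * q) = 0" if s: "s \<in> S" for s c
  proof -
    have "\<Lambda> (mon s c * q) = (\<Sum>i\<le>Q. c * cf q (nscale i v) * l (nscale i v + s))"
    proof -
      have "mon s c * q = (\<Sum>i\<le>Q. mon (nscale i v + s) (c * cf q (nscale i v)))"
        by (rule sw.mon_times_Ku) (rule Q(2))
      then show ?thesis by (simp only: \<Lambda>_sum \<Lambda>_mon)
    qed
    also have "\<dots> = (\<Sum>i\<le>Q. (if \<omega> s = \<tau> then c * lp (\<alpha> s) else 0) * (cf q (nscale i v) * lq (\<beta> s + i)))"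
      by (intro sum.cong refl) (simp add: l_def shift_v[OF s] mult_ac add.commute[of "\<beta> s"])
    also have "\<dots> = (if \<omega> s = \<tau> then c * lp (\<alpha> s) else 0) * (\<Sum>i\<le>Q. cf q (nscale i v) * lq (\<beta> s + i))"
      by (simp only: sum_distrib_left)
    also have "(\<Sum>i\<le>Q. cf q (nscale i v) * lq (\<beta> s + i)) = 0"
      unfolding lq_def by (rule lin_rec_relation) (rule Q(1))
    finally show ?thesis by simp
  qed
  have \<Lambda>_I: "\<Lambda> r = 0" if rI: "r \<in> I" for r
  proof -
    have mult0: "\<Lambda> (a * z) = 0" if a: "a \<in> carrier KS" and z: "\<And>s c. s \<in> S \<Longrightarrow> \<Lambda> (mon s c * z) = 0" for a z
    proof -
      have "(\<Sum>s\<in>supp a. mon s (cf a s)) * z = (\<Sum>s\<in>supp a. mon s (cf a s) * z)"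
        by (rule sum_distrib_right)
      then have "a * z = (\<Sum>s\<in>supp a. mon s (cf a s) * z)" unfolding sum_monomials[of a, symmetric] .
      moreover have "(\<Sum>s\<in>supp a. \<Lambda> (mon s (cf a s) * z)) = 0"
      proof (intro sum.neutral ballI)
        fix s assume "s \<in> supp a"
        then show "\<Lambda> (mon s (cf a s) * z) = 0" using a by (intro z) (auto simp: carrier_KS)
      qed
      ultimately show ?thesis by (simp add: \<Lambda>_sum)
    qed
    obtain a b where ab: "a \<in> carrier KS" "b \<in> carrier KS" "r = a * p + b * q" using iffD1[OF I_iff rI] by blast
    show ?thesis unfolding ab(3) \<Lambda>_add using mult0[OF ab(1) \<Lambda>_mon_p] mult0[OF ab(2) \<Lambda>_mon_q] by simp
  qed
  \<comment> \<open>the monomials of \<open>B\<close> span the quotient: divide by \<open>p\<close>, then by \<open>q\<close>\<close>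
  define B where "B = {s \<in> S. \<alpha> s < P \<and> \<beta> s < Q}"
  have finB: "finite B"
  proof (rule finite_subset)
    show "B \<subseteq> (\<lambda>(n, k, w). nscale n u + nscale k v + w) ` ({..<P} \<times> {..<Q} \<times> W)"
    proof
      fix s assume s: "s \<in> B"
      then have "s = (\<lambda>(n, k, w). nscale n u + nscale k v + w) (\<alpha> s, \<beta> s, \<omega> s)" "\<omega> s \<in> W"
        using decomp[of s] by (auto simp: B_def)
      then show "s \<in> (\<lambda>(n, k, w). nscale n u + nscale k v + w) ` ({..<P} \<times> {..<Q} \<times> W)"
        using s by (intro image_eqI[of _ _ "(\<alpha> s, \<beta> s, \<omega> s)"]) (auto simp: B_def)
    qed
  qed (use finite_W in simp)
  have normal: "\<exists>r0. supp r0 \<subseteq> B \<and> r - r0 \<in> I" if r: "r \<in> carrier KS" for r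
  proof -
    obtain t r' where t: "t \<in> carrier KS" "r' \<in> carrier KS" "r = t * p + r'" "\<forall>x\<in>supp r'. \<alpha> x < P"
      using division_by_Ku[OF p(1) P r] by blast
    obtain t' r'' where t': "t' \<in> carrier KS" "r'' \<in> carrier KS" "r' = t' * q + r''"
      "\<forall>x\<in>supp r''. \<beta> x < Q \<and> \<alpha> x \<in> \<alpha> ` supp r'"
      using sw.division_by_Ku[OF q(1) Q t(2)] by blast
    have "supp r'' \<subseteq> B"
    proof
      fix s assume s: "s \<in> supp r''"
      then have "\<beta> s < Q" "\<alpha> s \<in> \<alpha> ` supp r'" using t'(4) by auto
      then show "s \<in> B" using t(4) s t'(2) by (auto simp: B_def carrier_KS)
    qed
    moreover have "r - r'' \<in> I" unfolding I_iff t(3) t'(3)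
      using t(1) t'(1) by (intro exI[of _ t] exI[of _ t']) simp
    ultimately show ?thesis by blast
  qed
  \<comment> \<open>in \<open>star s + s\<close> the coordinates add up to \<open>P - 1\<close>, \<open>Q - 1\<close> and \<open>\<tau>\<close>, where the functional has the value \<open>1\<close>; so \<open>A\<close>, the
      matrix of the bilinear form, is unitriangular\<close>
  define star where "star = (\<lambda>s. nscale (P - 1 - \<alpha> s) u + nscale (Q - 1 - \<beta> s) v + \<delta> (\<omega> s))"
  define A where "A = (\<lambda>s t. l (star s + t))"
  define key where "key = (\<lambda>s. (rank (\<omega> s) * P + \<alpha> s) * Q + \<beta> s)"
  have BS: "s \<in> S" "\<alpha> s < P" "\<beta> s < Q" "\<omega> s \<in> W" if "s \<in> B" for s
    using that decomp[of s] by (auto simp: B_def)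
  have starS: "star s \<in> S" if "s \<in> B" for s
    unfolding star_def using rep dual BS(4)[OF that] by blast
  have starsum: "star s + t = nscale (P - 1 - \<alpha> s + \<alpha> t) u + nscale (Q - 1 - \<beta> s + \<beta> t) v + (\<delta> (\<omega> s) + \<omega> t)"
    if "t \<in> B" for s t
  proof -
    have "star s + (nscale (\<alpha> t) u + nscale (\<beta> t) v + \<omega> t)
      = nscale (P - 1 - \<alpha> s + \<alpha> t) u + nscale (Q - 1 - \<beta> s + \<beta> t) v + (\<delta> (\<omega> s) + \<omega> t)"
      unfolding star_def by (simp only: nscale_add add_ac)
    then show ?thesis using decomp[OF BS(1)[OF that]] by simp
  qed
  have A_val: "A s t = (if \<omega> (\<delta> (\<omega> s) + \<omega> t) = \<tau>
      then lp (P - 1 - \<alpha> s + \<alpha> t + \<alpha> (\<delta> (\<omega> s) + \<omega> t)) * lq (Q - 1 - \<beta> s + \<beta> t + \<beta> (\<delta> (\<omega> s) + \<omega> t)) else 0)"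
    if s: "s \<in> B" and t: "t \<in> B" for s t
  proof -
    have "\<delta> (\<omega> s) + \<omega> t \<in> S" 
      using dual[OF BS(4)[OF s]] basis_S(1) BS(4)[OF t] by (intro add_S) auto
    then show ?thesis unfolding A_def starsum[OF t] l_def by (simp add: shift)
  qed
  have A_same: "A s t = lp (P - 1 - \<alpha> s + \<alpha> t) * lq (Q - 1 - \<beta> s + \<beta> t)" if s: "s \<in> B" and t: "t \<in> B" "\<omega> t = \<omega> s" for s t
    using A_val[OF s t(1)] dual[OF BS(4)[OF s]] t(2) basis_S[OF \<tau>] by simp
  have lp_top: "lp (P - 1) = 1" and lq_top: "lq (Q - 1) = 1"
    unfolding lp_def lq_def by (rule lin_rec_initial(2); use P0 Q0 in simp)+
  have lp_small: "lp n = 0" if "Suc n < P" for n unfolding lp_def by (rule lin_rec_initial(1)[OF that])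
  have lq_small: "lq n = 0" if "Suc n < Q" for n unfolding lq_def by (rule lin_rec_initial(1)[OF that])
  have diag: "A s s = 1" if s: "s \<in> B" for s
  proof -
    have "P - 1 - \<alpha> s + \<alpha> s = P - 1" "Q - 1 - \<beta> s + \<beta> s = Q - 1" using BS(2,3)[OF s] by auto
    then show ?thesis using A_same[OF s s refl] lp_top lq_top by (simp only: mult_1)
  qed
  have tri: "t = s \<or> key s < key t" if s: "s \<in> B" and t: "t \<in> B" and nz: "A s t \<noteq> 0" for s t
  proof -
    have "\<omega> (\<delta> (\<omega> s) + \<omega> t) = \<tau>" using nz A_val[OF s t] by (auto split: if_splits)
    then consider "\<omega> t = \<omega> s" | "rank (\<omega> s) < rank (\<omega> t)" using rank BS(4) s t by blast
    then show ?thesis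
    proof cases
      case 1
      have lpq: "lp (P - 1 - \<alpha> s + \<alpha> t) \<noteq> 0" "lq (Q - 1 - \<beta> s + \<beta> t) \<noteq> 0" using nz A_same[OF s t 1] by auto
      have "\<alpha> s \<le> \<alpha> t"
      proof (rule ccontr)
        assume "\<not> \<alpha> s \<le> \<alpha> t"
        then have "Suc (P - 1 - \<alpha> s + \<alpha> t) < P" using BS(2)[OF s] by simp
        then show False using lpq(1) lp_small by blast
      qed
      moreover have "\<beta> s \<le> \<beta> t"
      proof (rule ccontr)
        assume "\<not> \<beta> s \<le> \<beta> t"
        then have "Suc (Q - 1 - \<beta> s + \<beta> t) < Q" using BS(3)[OF s] by simp
        then show False using lpq(2) lq_small by blast
      qed
      moreover have "t = s" if "\<alpha> s = \<alpha> t" "\<beta> s = \<beta> t"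
        using decomp[OF BS(1)[OF s]] decomp[OF BS(1)[OF t]] 1 that by metis
      moreover have "key s < key t" if "\<alpha> s \<le> \<alpha> t" "\<beta> s \<le> \<beta> t" "\<alpha> s \<noteq> \<alpha> t \<or> \<beta> s \<noteq> \<beta> t"
      proof (cases "\<alpha> s = \<alpha> t")
        case True then show ?thesis using that 1 by (simp add: key_def)
      next
        case False
        then have "rank (\<omega> s) * P + \<alpha> s < rank (\<omega> t) * P + \<alpha> t" using that 1 by simp
        then have "(rank (\<omega> s) * P + \<alpha> s) * Q < (rank (\<omega> t) * P + \<alpha> t) * Q" using Q0 by simp
        then show ?thesis unfolding key_def using that(2) by (rule add_less_le_mono)
      qed
      ultimately show ?thesis by blast
    next
      case 2
      have "rank (\<omega> s) * P + \<alpha> s < Suc (rank (\<omega> s)) * P" using BS(2)[OF s] by simp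
      also have "\<dots> \<le> rank (\<omega> t) * P" using 2 by (intro mult_le_mono1) simp
      finally have "Suc (rank (\<omega> s) * P + \<alpha> s) \<le> rank (\<omega> t) * P + \<alpha> t" by simp
      then have "Suc (rank (\<omega> s) * P + \<alpha> s) * Q \<le> (rank (\<omega> t) * P + \<alpha> t) * Q" by (rule mult_le_mono1)
      then show ?thesis unfolding key_def using BS(3)[OF s] by simp
    qed
  qed
  have nondeg: "r \<in> I" if r: "r \<in> carrier KS" and z: "\<And>s. s \<in> carrier KS \<Longrightarrow> \<Lambda> (r * s) = 0" for r
  proof -
    obtain r0 where r0: "supp r0 \<subseteq> B" "r - r0 \<in> I" using normal[OF r] by blast
    have "cf r0 t = 0" if "t \<in> B" for t
    proof (rule unitriangular_injective[OF finB diag tri _ that])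
      fix s assume s: "s \<in> B"
      have sc: "mon (star s) 1 \<in> carrier KS" using starS[OF s] by blast
      have "\<Lambda> (mon (star s) 1 * r) = 0" using z[OF sc] by (simp add: mult.commute)
      moreover have "\<Lambda> (mon (star s) 1 * (r - r0)) = 0" using \<Lambda>_I[OF Ic(5)[OF r0(2) sc]] .
      moreover have "mon (star s) 1 * r = mon (star s) 1 * (r - r0) + mon (star s) 1 * r0"
        by (simp add: algebra_simps)
      ultimately have "\<Lambda> (mon (star s) 1 * r0) = 0" by (simp add: \<Lambda>_add)
      moreover have "mon (star s) 1 * r0 = (\<Sum>t\<in>B. mon (star s + t) (cf r0 t))"
      proof -
        have "r0 = (\<Sum>t\<in>B. mon t (cf r0 t))"
          using sum.mono_neutral_left[OF finB r0(1), of "\<lambda>t. mon t (cf r0 t)"] sum_monomials[of r0]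
          by (auto simp: in_keys_iff)
        then have "mon (star s) 1 * r0 = mon (star s) 1 * (\<Sum>t\<in>B. mon t (cf r0 t))" by simp
        then show ?thesis by (simp add: sum_distrib_left mult_single)
      qed
      ultimately show "(\<Sum>t\<in>B. A s t * cf r0 t) = 0" by (simp add: \<Lambda>_sum \<Lambda>_mon A_def mult.commute)
    qed
    then have "r0 = 0" using r0(1) by (intro poly_mapping_eqI) (auto simp: in_keys_iff)
    then show ?thesis using r0(2) by simp
  qed
  \<comment> \<open>the annihilator of \<open>x\<close> modulo \<open>I\<close> is a proper ideal containing \<open>m\<close>\<close>
  have ann: "c \<in> m" if c: "c \<in> carrier KS" "c * x \<in> I" for c
  proof (rule ccontr)
    assume "c \<notin> m"
    have id: "ideal {r \<in> carrier KS. r \<otimes>\<^bsub>KS\<^esub> x \<in> I} KS" by (rule KS.colon_ideal[OF Ii x(1)])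
    have "m \<subseteq> {r \<in> carrier KS. r \<otimes>\<^bsub>KS\<^esub> x \<in> I}" using x(3) mc(1) by (auto simp: I_def)
    then have "{r \<in> carrier KS. r \<otimes>\<^bsub>KS\<^esub> x \<in> I} = carrier KS"
      using m.I_maximal[OF id] c \<open>c \<notin> m\<close> by auto
    then have "1 \<in> {r \<in> carrier KS. r \<otimes>\<^bsub>KS\<^esub> x \<in> I}" using KS_closed(7) by (simp only:)
    then have "1 * x \<in> I" by simp
    then show False using x(2) by (simp add: I_def)
  qed
  \<comment> \<open>otherwise a linear form \<open>\<phi>\<close> separates \<open>y\<close> from \<open>(x) + I\<close>; it is \<open>r \<mapsto> \<Lambda> (w r)\<close> for some \<open>w\<close>, and \<open>w x \<in> I\<close>\<close>
  have gen: "\<exists>c. c \<in> carrier KS \<and> y - c * x \<in> I" if y: "y \<in> carrier KS" "\<And>r. r \<in> m \<Longrightarrow> r * y \<in> I" for y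
  proof (rule ccontr)
    assume no: "\<nexists>c. c \<in> carrier KS \<and> y - c * x \<in> I"
    define J where "J = {c * x + i | c i. c \<in> carrier KS \<and> i \<in> I}"
    have J: "bipoly.subspace J"
    proof (rule bipoly.subspaceI)
      have "0 * x + 0 \<in> J" unfolding J_def using Ic(2) KS_closed(6) by blast
      then show "0 \<in> J" by simp
      fix f assume "f \<in> J"
      then obtain c i where ci: "c \<in> carrier KS" "i \<in> I" "f = c * x + i" unfolding J_def by blast
      have "cscale e f = cscale e c * x + mon 0 e * i" for e
        unfolding ci(3) by (simp add: cscale_def algebra_simps)
      then show "cscale e f \<in> J" for e
        unfolding J_def using KS_cscale[OF ci(1)] Ic(5)[OF ci(2) mono0] by blast
      fix f' assume "f' \<in> J"
      then obtain c' i' where ci': "c' \<in> carrier KS" "i' \<in> I" "f' = c' * x + i'" unfolding J_def by blast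
      have "f + f' = (c + c') * x + (i + i')" unfolding ci(3) ci'(3) by (simp add: algebra_simps)
      then show "f + f' \<in> J" unfolding J_def using ci(1,2) ci'(1,2) Ic(3) KS_closed(1) by blast
    qed
    have yJ: "y \<notin> J"
    proof
      assume "y \<in> J"
      then obtain c i where "c \<in> carrier KS" "i \<in> I" "y = c * x + i" unfolding J_def by blast
      then show False using no by auto
    qed
    have "\<exists>\<phi>. (\<forall>p q. \<phi> (p + q) = \<phi> p + \<phi> q) \<and> (\<forall>c p. \<phi> (cscale c p) = c * \<phi> p) \<and> (\<forall>p\<in>J. \<phi> p = (0::'k)) \<and> \<phi> y \<noteq> 0"
      by (rule functional_separating[OF J yJ])
    then obtain \<phi> :: "'k bipoly \<Rightarrow> 'k" where \<phi>: "\<And>p q. \<phi> (p + q) = \<phi> p + \<phi> q"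
      "\<And>c p. \<phi> (cscale c p) = c * \<phi> p" "\<And>p. p \<in> J \<Longrightarrow> \<phi> p = 0" "\<phi> y \<noteq> 0" by blast
    have \<phi>0: "\<phi> 0 = 0" using \<phi>(2)[of 0 0] by simp
    have \<phi>_sum: "\<phi> (sum f T) = (\<Sum>i\<in>T. \<phi> (f i))" for f :: "nat \<times> nat \<Rightarrow> 'k bipoly" and T
      by (induction T rule: infinite_finite_induct) (auto simp: \<phi>(1) \<phi>0)
    have \<phi>I: "\<phi> i = 0" if "i \<in> I" for i
    proof -
      have "0 * x + i \<in> J" unfolding J_def using that KS_closed(6) by blast
      then show ?thesis using \<phi>(3)[of i] by simp
    qed
    have "\<exists>c. \<forall>t\<in>B. (\<Sum>s\<in>B. c s * A s t) = \<phi> (mon t 1)"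
    proof (rule unitriangular_surjective[OF finB])
      show "A s s = 1" if "s \<in> B" for s by (rule diag[OF that])
      show "t = s \<or> key s < key t" if "s \<in> B" "t \<in> B" "A s t \<noteq> 0" for s t by (rule tri[OF that])
    qed
    then obtain c where c: "\<And>t. t \<in> B \<Longrightarrow> (\<Sum>s\<in>B. c s * A s t) = \<phi> (mon t 1)" by blast
    define w where "w = (\<Sum>s\<in>B. mon (star s) (c s))"
    have wc: "w \<in> carrier KS" unfolding w_def using starS by (intro KS_closed(8) KS_closed(4))
    have \<Lambda>w: "\<Lambda> (w * r) = \<phi> r" if r: "r \<in> carrier KS" for r
    proof -
      obtain r0 where r0: "supp r0 \<subseteq> B" "r - r0 \<in> I" using normal[OF r] by blast
      have r0_eq: "(\<Sum>t\<in>B. mon t (cf r0 t)) = r0"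
        using sum.mono_neutral_left[OF finB r0(1), of "\<lambda>t. mon t (cf r0 t)"] sum_monomials[of r0]
        by (auto simp: in_keys_iff)
      have "w * r = w * (r - r0) + w * r0" by (simp add: algebra_simps)
      then have "\<Lambda> (w * r) = \<Lambda> (w * r0)" using \<Lambda>_I[OF Ic(5)[OF r0(2) wc]] by (simp add: \<Lambda>_add)
      also have "w * r0 = (\<Sum>t\<in>B. \<Sum>s\<in>B. mon (star s + t) (c s * cf r0 t))"
      proof -
        have "w * (\<Sum>t\<in>B. mon t (cf r0 t)) = (\<Sum>t\<in>B. \<Sum>s\<in>B. mon (star s + t) (c s * cf r0 t))"
          unfolding w_def sum_product by (subst sum.swap) (simp add: mult_single)
        then show ?thesis unfolding r0_eq .
      qed
      also have "\<Lambda> \<dots> = (\<Sum>t\<in>B. cf r0 t * (\<Sum>s\<in>B. c s * A s t))"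
        by (simp add: \<Lambda>_sum \<Lambda>_mon A_def sum_distrib_left mult_ac)
      also have "\<dots> = (\<Sum>t\<in>B. \<phi> (mon t (cf r0 t)))"
      proof (intro sum.cong refl)
        fix t assume t: "t \<in> B"
        show "cf r0 t * (\<Sum>s\<in>B. c s * A s t) = \<phi> (mon t (cf r0 t))"
          unfolding c[OF t] using \<phi>(2)[of "cf r0 t" "mon t 1"] mon_eq_cscale[of t "cf r0 t"] by simp
      qed
      also have "\<dots> = \<phi> r0" unfolding \<phi>_sum[symmetric] r0_eq ..
      also have "\<dots> = \<phi> r" using \<phi>(1)[of "r - r0" r0] \<phi>I[OF r0(2)] by simp
      finally show ?thesis .
    qed
    have "w * x \<in> I"
    proof (rule nondeg)
      show "w * x \<in> carrier KS" using wc x(1) by blast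
      fix s assume s: "s \<in> carrier KS"
      have "s * x + 0 \<in> J" unfolding J_def using s Ic(2) by blast
      then have "\<phi> (x * s) = 0" using \<phi>(3) by (simp add: mult.commute)
      then show "\<Lambda> (w * x * s) = 0" using \<Lambda>w[OF KS_closed(3)[OF x(1) s]] by (simp add: mult.assoc)
    qed
    then have "w \<in> m" by (rule ann[OF wc])
    then have "\<phi> y = 0" using \<Lambda>w[OF y(1)] \<Lambda>_I[OF y(2)] by simp
    with \<phi>(4) show False ..
  qed
  have fs: "finsum KS (\<lambda>i. c i \<otimes>\<^bsub>KS\<^esub> x) {..<1::nat} = c 0 * x" if "c \<in> {..<1} \<rightarrow> carrier KS" for c
  proof -
    have "c 0 \<in> carrier KS" using that by auto
    then show ?thesis using x(1) by (subst KS_finsum) auto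
  qed
  show ?thesis unfolding socle_basis_def I_def[symmetric]
  proof (intro conjI allI impI ballI)
    show "x \<in> carrier KS" by (rule x(1))
    show "r \<otimes>\<^bsub>KS\<^esub> x \<in> I" if "r \<in> m" for r using x(3)[OF that] by (simp add: I_def)
    fix y assume y: "y \<in> carrier KS" "\<forall>r\<in>m. r \<otimes>\<^bsub>KS\<^esub> y \<in> I"
    obtain c where c: "c \<in> carrier KS" "y - c * x \<in> I" using gen[OF y(1)] y(2) by auto
    have cc: "(\<lambda>_. c) \<in> {..<1::nat} \<rightarrow> carrier KS" using c(1) by auto
    have "y \<ominus>\<^bsub>KS\<^esub> finsum KS (\<lambda>i. c \<otimes>\<^bsub>KS\<^esub> x) {..<1::nat} \<in> I"
      unfolding fs[OF cc] using KS_closed(3)[OF c(1) x(1)] c(2) by simp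
    then show "\<exists>c\<in>{..<1::nat} \<rightarrow> carrier KS. y \<ominus>\<^bsub>KS\<^esub> finsum KS (\<lambda>i. c i \<otimes>\<^bsub>KS\<^esub> x) {..<1} \<in> I"
      by (rule bexI[OF _ cc])
  next
    fix c and i :: nat assume c: "c \<in> {..<1::nat} \<rightarrow> carrier KS" "finsum KS (\<lambda>i. c i \<otimes>\<^bsub>KS\<^esub> x) {..<1} \<in> I" and i: "i < 1"
    have "c 0 \<in> carrier KS" using c(1) by auto
    then have "c 0 \<in> m" using ann[of "c 0"] c(2) unfolding fs[OF c(1)] by blast
    then show "c i \<in> m" using i by simp
  qed
qed

text \<open>
  At every maximal ideal the socle has a nonzero element, which may be chosen in \<open>K[S]\<close> and then generates the socle.
\<close>

lemma gorenstein_KS: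
  assumes dual: "\<And>w. w \<in> W \<Longrightarrow> \<delta> w \<in> W \<and> \<delta> w + w = \<tau>"
    and rank: "\<And>w w'. \<lbrakk>w \<in> W; w' \<in> W; \<omega> (\<delta> w + w') = \<tau>\<rbrakk> \<Longrightarrow> w' = w \<or> rank w < (rank w' :: nat)"
    and \<tau>: "\<tau> \<in> W"
  shows "gorenstein KS"
  unfolding gorenstein_def
proof (intro conjI allI impI)
  show "cring KS" by (rule KS.is_cring)
  show "noetherian_ring KS" by (rule noetherian_KS)
  fix m assume m: "maximalideal m KS"
  obtain p q where pq: "p \<in> m" "q \<in> m" "p \<in> Ku" "q \<in> Kv" "p \<noteq> 0" "q \<noteq> 0" and reg: "regular_pair KS p q"
    using regular_pair_in_maximal[OF m] by blast
  have c: "p \<in> carrier KS" "q \<in> carrier KS" using reg by (auto simp: regular_pair_def)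
  interpret loc: localized_domain KS m by (rule localized_KS[OF m])
  interpret two: two_dim_local "localization KS m" loc.mL "loc.emb p" "loc.emb q"
    by (rule two_dim_local_KS[OF m reg pq(1,2)])
  obtain y where y: "y \<in> carrier (localization KS m)" "y \<notin> Idl\<^bsub>localization KS m\<^esub> {loc.emb p, loc.emb q}"
    "\<And>r. r \<in> loc.mL \<Longrightarrow> r \<otimes>\<^bsub>localization KS m\<^esub> y \<in> Idl\<^bsub>localization KS m\<^esub> {loc.emb p, loc.emb q}"
    using two.socle_nonzero by blast
  obtain x s where x: "x \<in> carrier KS" "s \<in> loc.denoms" "y = loc_frac KS m x s"
    "\<And>r. r \<in> m \<Longrightarrow> r \<otimes>\<^bsub>KS\<^esub> x \<in> Idl\<^bsub>KS\<^esub> {p, q}"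
    using loc.socle_lift[OF c y(1,3)] by blast
  have xI: "x \<notin> Idl\<^bsub>KS\<^esub> {p, q}"
  proof
    assume "x \<in> Idl\<^bsub>KS\<^esub> {p, q}"
    then have "\<exists>t\<in>loc.denoms. t \<otimes>\<^bsub>KS\<^esub> x \<in> Idl\<^bsub>KS\<^esub> {p, q}"
      by (intro bexI[OF _ loc.one_denoms]) simp
    then show False using loc.frac_in_ext[OF c x(1,2)] y(2) x(3) by blast
  qed
  have "socle_basis KS m (Idl\<^bsub>KS\<^esub> {p, q}) 1 (\<lambda>_. x)"
    by (rule socle_basis_frobenius[OF m pq(1,2,3,5,4,6) dual rank \<tau> x(1) xI]) (use x(4) in auto)
  then have "cm_type (localization KS m) = 1" by (rule cm_type_KS[OF m reg pq(1,2)])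
  then show "gorenstein_local (localization KS m)"
    unfolding gorenstein_local_def using two.cohen_macaulay_local by blast
qed

end

section \<open>Affine semigroups\<close>

lemma affine_zero: "0 \<in> affine_semigroup A"
  unfolding affine_semigroup_def by (intro CollectI exI[of _ "\<lambda>_. 0"]) simp

lemma affine_add:
  assumes "s \<in> affine_semigroup A" "t \<in> affine_semigroup A"
  shows "s + t \<in> affine_semigroup A"
proof -
  obtain l l' where "s = (\<Sum>v\<in>A. nscale (l v) v)" "t = (\<Sum>v\<in>A. nscale (l' v) v)"
    using assms unfolding affine_semigroup_def by blast
  then have "s + t = (\<Sum>v\<in>A. nscale (l v + l' v) v)" by (simp add: nscale_add sum.distrib)
  then show ?thesis unfolding affine_semigroup_def by (intro CollectI exI[of _ "\<lambda>v. l v + l' v"]) simp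
qed

lemma affine_gen:
  assumes "finite A" "g \<in> A"
  shows "g \<in> affine_semigroup A"
proof -
  have "(\<Sum>v\<in>A. nscale (if v = g then 1 else 0) v) = (\<Sum>v\<in>A. if v = g then g else 0)"
    by (intro sum.cong refl) auto
  also have "\<dots> = g" using assms by simp
  finally have "g = (\<Sum>v\<in>A. nscale (if v = g then 1 else 0) v)" by simp
  then show ?thesis unfolding affine_semigroup_def by (intro CollectI exI[of _ "\<lambda>v. if v = g then 1 else 0"]) simp
qed

lemma affine_nscale: "s \<in> affine_semigroup A \<Longrightarrow> nscale n s \<in> affine_semigroup A"
  by (induction n) (simp_all add: affine_zero affine_add)

lemma affine_induct [consumes 2, case_names zero add]:
  assumes "finite A" "s \<in> affine_semigroup A" "Q 0"
    and step: "\<And>g x. \<lbrakk>g \<in> A; x \<in> affine_semigroup A; Q x\<rbrakk> \<Longrightarrow> Q (g + x)"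
  shows "Q s"
proof -
  have "s = (\<Sum>v\<in>A. nscale (l v) v) \<Longrightarrow> Q s" for l s
  proof (induction "\<Sum>v\<in>A. l v" arbitrary: l s)
    case 0
    then have "s = 0" using assms(1) by simp
    then show ?case using assms(3) by simp
  next
    case (Suc n)
    have "\<exists>g\<in>A. l g \<noteq> 0"
    proof (rule ccontr)
      assume "\<not> ?thesis"
      then have "(\<Sum>v\<in>A. l v) = 0" by simp
      then show False using Suc.hyps(2) by simp
    qed
    then obtain g where g: "g \<in> A" "l g \<noteq> 0" by blast
    then obtain i where i: "l g = Suc i" using not0_implies_Suc by blast
    define l' where "l' = l(g := i)"
    have A: "A = insert g (A - {g})" using g(1) by blast
    have same: "(\<Sum>v\<in>A - {g}. h (l' v) v) = (\<Sum>v\<in>A - {g}. h (l v) v)" for h :: "nat \<Rightarrow> nat \<times> nat \<Rightarrow> 'z::comm_monoid_add"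
      by (intro sum.cong refl) (auto simp: l'_def)
    have "(\<Sum>v\<in>A. l v) = Suc (\<Sum>v\<in>A. l' v)"
      using sum.remove[OF assms(1) g(1), of l] sum.remove[OF assms(1) g(1), of l'] same[of "\<lambda>n _. n"] i
      by (simp add: l'_def)
    then have n: "n = (\<Sum>v\<in>A. l' v)" using Suc.hyps(2) by simp
    have "s = g + (\<Sum>v\<in>A. nscale (l' v) v)"
      using Suc.prems sum.remove[OF assms(1) g(1), of "\<lambda>v. nscale (l v) v"]
        sum.remove[OF assms(1) g(1), of "\<lambda>v. nscale (l' v) v"] same[of nscale] i
      by (simp add: l'_def add.assoc)
    moreover have "(\<Sum>v\<in>A. nscale (l' v) v) \<in> affine_semigroup A" unfolding affine_semigroup_def by blast
    ultimately show ?case using step[OF g(1)] Suc.hyps(1)[OF n refl] by simp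
  qed
  then show ?thesis using assms(2) unfolding affine_semigroup_def by blast
qed

section \<open>The semigroup generated by an arithmetic sequence and one more vector\<close>

locale arithmetic_extension =
  fixes a d b :: "nat \<times> nat" and k \<mu> :: nat
  assumes k2: "k \<ge> 2" and indep: "lin_indep_rat a d" and b_notin: "b \<notin> S_adk a d k"
    and mu_pos: "\<mu> > 0" and mu_b: "nscale \<mu> b \<in> S_adk a d k"
begin

abbreviation "T \<equiv> S_adk a d k"
abbreviation "S \<equiv> S_adkb a d k b"

lemma determinant: "int (fst a) * int (snd d) - int (snd a) * int (fst d) \<noteq> 0"
proof
  assume "int (fst a) * int (snd d) - int (snd a) * int (fst d) = 0"
  then have "of_int (int (fst a) * int (snd d) - int (snd a) * int (fst d)) = (0 :: rat)" by simp
  then have det: "rat_of_nat (fst a) * rat_of_nat (snd d) = rat_of_nat (snd a) * rat_of_nat (fst d)" by simp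
  have li: "p * rat_of_nat (fst a) + q * rat_of_nat (fst d) = 0 \<Longrightarrow> p * rat_of_nat (snd a) + q * rat_of_nat (snd d) = 0 \<Longrightarrow> p = 0 \<and> q = 0" for p q
    using indep unfolding lin_indep_rat_def by blast
  have "rat_of_nat (snd d) = 0 \<and> - rat_of_nat (snd a) = 0" by (rule li) (use det in \<open>simp_all add: algebra_simps\<close>)
  moreover have "rat_of_nat (fst d) = 0 \<and> - rat_of_nat (fst a) = 0" by (rule li) (use det in \<open>simp_all add: algebra_simps\<close>)
  ultimately have "(1::rat) = 0 \<and> (0::rat) = 0" by (intro li) auto
  then show False by simp
qed

lemma int_independent:
  assumes "\<xi> * int (fst a) + \<eta> * int (fst d) = 0" "\<xi> * int (snd a) + \<eta> * int (snd d) = 0"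
  shows "\<xi> = 0 \<and> \<eta> = 0"
proof -
  let ?D = "int (fst a) * int (snd d) - int (snd a) * int (fst d)"
  have "\<xi> * ?D = (\<xi> * int (fst a) + \<eta> * int (fst d)) * int (snd d) - (\<xi> * int (snd a) + \<eta> * int (snd d)) * int (fst d)"
    by (simp add: algebra_simps)
  also have "\<dots> = 0" unfolding assms by simp
  finally have "\<xi> = 0" using determinant by simp
  have "\<eta> * ?D = (\<xi> * int (snd a) + \<eta> * int (snd d)) * int (fst a) - (\<xi> * int (fst a) + \<eta> * int (fst d)) * int (snd a)"
    by (simp add: algebra_simps)
  also have "\<dots> = 0" unfolding assms by simp
  finally have "\<eta> = 0" using determinant by simp
  with \<open>\<xi> = 0\<close> show ?thesis ..
qed

lemma nat_independent:
  assumes "nscale m a + nscale y d = nscale m' a + nscale y' d"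
  shows "m = m' \<and> y = y'"
proof -
  have "m * fst a + y * fst d = m' * fst a + y' * fst d" "m * snd a + y * snd d = m' * snd a + y' * snd d"
    using arg_cong[OF assms, of fst] arg_cong[OF assms, of snd] by (simp_all add: nscale_def)
  then have "int (m * fst a + y * fst d) = int (m' * fst a + y' * fst d)"
    "int (m * snd a + y * snd d) = int (m' * snd a + y' * snd d)" by simp_all
  then have "(int m - int m') * int (fst a) + (int y - int y') * int (fst d) = 0"
    "(int m - int m') * int (snd a) + (int y - int y') * int (snd d) = 0"
    by (simp_all add: algebra_simps)
  from int_independent[OF this] show ?thesis by simp
qed

lemma finite_gens: "finite (arith_gens a d k)" by (simp add: arith_gens_def)

lemma gens_T: "i \<le> k \<Longrightarrow> a + nscale i d \<in> T"
  unfolding S_adk_def by (rule affine_gen[OF finite_gens]) (auto simp: arith_gens_def)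

lemma T_zero: "0 \<in> T" and T_add: "\<lbrakk>x \<in> T; y \<in> T\<rbrakk> \<Longrightarrow> x + y \<in> T"
  unfolding S_adk_def by (rule affine_zero) (rule affine_add)

lemma T_iff: "x \<in> T \<longleftrightarrow> (\<exists>m y. x = nscale m a + nscale y d \<and> y \<le> k * m)"
proof
  assume "x \<in> T"
  then show "\<exists>m y. x = nscale m a + nscale y d \<and> y \<le> k * m"
    unfolding S_adk_def
  proof (induction rule: affine_induct[OF finite_gens, consumes 1, case_names zero add])
    case zero show ?case by (intro exI[of _ 0]) simp
  next
    case (add g x)
    obtain i where i: "i \<le> k" "g = a + nscale i d" using add(1) by (auto simp: arith_gens_def)
    obtain m y where "x = nscale m a + nscale y d" "y \<le> k * m" using add(3) by blast
    then have "g + x = nscale (Suc m) a + nscale (i + y) d" "i + y \<le> k * Suc m"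
      using i by (simp_all add: nscale_add add_ac)
    then show ?case by blast
  qed
next
  have "y \<le> k * m \<Longrightarrow> nscale m a + nscale y d \<in> T" for m y
  proof (induction m arbitrary: y)
    case 0 then show ?case using T_zero by simp
  next
    case (Suc m)
    \<comment> \<open>split off the generator \<open>a + i d\<close> with the largest possible \<open>i\<close>\<close>
    define i where "i = min y k"
    have "nscale m a + nscale (y - i) d \<in> T" by (rule Suc.IH) (use Suc.prems in \<open>auto simp: i_def\<close>)
    moreover have "a + nscale i d \<in> T" by (rule gens_T) (simp add: i_def)
    ultimately have "(a + nscale i d) + (nscale m a + nscale (y - i) d) \<in> T" by (rule T_add[rotated])
    moreover have "(a + nscale i d) + (nscale m a + nscale (y - i) d) = nscale (Suc m) a + nscale (i + (y - i)) d"
      by (simp only: nscale_add nscale_simps add_ac)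
    moreover have "i + (y - i) = y" by (simp add: i_def)
    ultimately show ?case by simp
  qed
  then show "\<exists>m y. x = nscale m a + nscale y d \<and> y \<le> k * m \<Longrightarrow> x \<in> T" by blast
qed

lemma S_zero: "0 \<in> S" and S_add: "\<lbrakk>x \<in> S; y \<in> S\<rbrakk> \<Longrightarrow> x + y \<in> S"
  unfolding S_adkb_def by (rule affine_zero) (rule affine_add)

lemma S_iff: "s \<in> S \<longleftrightarrow> (\<exists>x\<in>T. \<exists>i. s = x + nscale i b)"
proof
  assume "s \<in> S"
  then show "\<exists>x\<in>T. \<exists>i. s = x + nscale i b"
    unfolding S_adkb_def
  proof (induction rule: affine_induct[OF finite.insertI[OF finite_gens], consumes 1, case_names zero add])
    case zero show ?case by (intro bexI[OF _ T_zero] exI[of _ 0]) simp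
  next
    case (add g s)
    obtain x i where x: "x \<in> T" "s = x + nscale i b" using add(3) by blast
    show ?case
    proof (cases "g = b")
      case True
      then have "g + s = x + nscale (Suc i) b" unfolding x(2) by (simp add: add_ac)
      then show ?thesis using x(1) by blast
    next
      case False
      then have "g \<in> T" using add(1) affine_gen[OF finite_gens] by (auto simp: S_adk_def)
      then have "g + x \<in> T" "g + s = (g + x) + nscale i b" using x T_add by (simp_all add: add_ac)
      then show ?thesis by blast
    qed
  qed
next
  have fin: "finite (insert b (arith_gens a d k))" using finite_gens by simp
  have "x \<in> T \<Longrightarrow> x \<in> S" for x
    unfolding S_adk_def
  proof (induction rule: affine_induct[OF finite_gens, consumes 1, case_names zero add])
    case (add g x)
    have "g \<in> S" unfolding S_adkb_def using affine_gen[OF fin] add(1) by blast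
    then show ?case using add(3) S_add by blast
  qed (rule S_zero)
  moreover have "nscale i b \<in> S" for i
    unfolding S_adkb_def by (intro affine_nscale affine_gen[OF fin]) simp
  ultimately show "\<exists>x\<in>T. \<exists>i. s = x + nscale i b \<Longrightarrow> s \<in> S" using S_add by blast
qed

subsection \<open>The order of the additional vector modulo the lattice\<close>

text \<open>
  \<open>n b\<close> lies in the lattice generated by \<open>a\<close> and \<open>d\<close>, whose coefficients may be negative.
\<close>

definition in_lattice :: "nat \<Rightarrow> bool" where
  "in_lattice n \<longleftrightarrow> (\<exists>\<xi> \<eta> :: int. int n * int (fst b) = \<xi> * int (fst a) + \<eta> * int (fst d) \<and>
     int n * int (snd b) = \<xi> * int (snd a) + \<eta> * int (snd d))"

definition \<nu> :: nat where "\<nu> = (LEAST n. n > 0 \<and> in_lattice n)"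

lemma in_lattice_mu: "in_lattice \<mu>"
proof -
  obtain m y where "nscale \<mu> b = nscale m a + nscale y d" using mu_b T_iff by blast
  then have "\<mu> * fst b = m * fst a + y * fst d" "\<mu> * snd b = m * snd a + y * snd d"
    by (simp_all add: nscale_def)
  then show ?thesis unfolding in_lattice_def
    by (intro exI[of _ "int m"] exI[of _ "int y"]) (simp flip: of_nat_mult of_nat_add)
qed

lemma nu: "\<nu> > 0" "in_lattice \<nu>" and nu_least: "\<lbrakk>n > 0; in_lattice n\<rbrakk> \<Longrightarrow> \<nu> \<le> n"
proof -
  have "\<nu> > 0 \<and> in_lattice \<nu>" unfolding \<nu>_def by (rule LeastI[of _ \<mu>]) (use mu_pos in_lattice_mu in simp)
  then show "\<nu> > 0" "in_lattice \<nu>" by auto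
  show "\<lbrakk>n > 0; in_lattice n\<rbrakk> \<Longrightarrow> \<nu> \<le> n" unfolding \<nu>_def by (rule Least_le) simp
qed

text \<open>
  The semigroup generated by the arithmetic sequence consists of all lattice points of its cone, so
  it contains the first multiple of \<open>b\<close> that lies in the lattice.
\<close>

lemma nu_b: obtains m y where "nscale \<nu> b = nscale m a + nscale y d" "y \<le> k * m"
proof -
  obtain \<xi> \<eta> where XY: "int \<nu> * int (fst b) = \<xi> * int (fst a) + \<eta> * int (fst d)"
     "int \<nu> * int (snd b) = \<xi> * int (snd a) + \<eta> * int (snd d)" using nu(2) unfolding in_lattice_def by blast
  obtain m y where my: "nscale \<mu> b = nscale m a + nscale y d" "y \<le> k * m" using mu_b T_iff by blast
  have "\<mu> * fst b = m * fst a + y * fst d" "\<mu> * snd b = m * snd a + y * snd d"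
    using arg_cong[OF my(1), of fst] arg_cong[OF my(1), of snd] by (simp_all add: nscale_def)
  then have m: "int \<mu> * int (fst b) = int m * int (fst a) + int y * int (fst d)"
     "int \<mu> * int (snd b) = int m * int (snd a) + int y * int (snd d)"
    by (simp_all flip: of_nat_mult of_nat_add)
  have eq: "(int \<mu> * \<xi> - int \<nu> * int m) * e + (int \<mu> * \<eta> - int \<nu> * int y) * f = 0"
    if "int \<nu> * g = \<xi> * e + \<eta> * f" "int \<mu> * g = int m * e + int y * f" for e f g
  proof -
    have "(int \<mu> * \<xi> - int \<nu> * int m) * e + (int \<mu> * \<eta> - int \<nu> * int y) * f
        = int \<mu> * (\<xi> * e + \<eta> * f) - int \<nu> * (int m * e + int y * f)" by (simp add: algebra_simps)
    also have "\<dots> = 0" unfolding that[symmetric] by simp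
    finally show ?thesis .
  qed
  have "int \<mu> * \<xi> - int \<nu> * int m = 0 \<and> int \<mu> * \<eta> - int \<nu> * int y = 0"
    using int_independent[OF eq[OF XY(1) m(1)] eq[OF XY(2) m(2)]] .
  then have e: "int \<mu> * \<xi> = int \<nu> * int m" "int \<mu> * \<eta> = int \<nu> * int y" by auto
  have mu: "int \<mu> > 0" using mu_pos by simp
  have "int \<mu> * \<xi> \<ge> 0" "int \<mu> * \<eta> \<ge> 0" unfolding e by simp_all
  then have XY0: "\<xi> \<ge> 0" "\<eta> \<ge> 0" using mu by (simp_all add: zero_le_mult_iff)
  have "int \<mu> * \<eta> \<le> int \<mu> * (int k * \<xi>)"
  proof -
    have "int y \<le> int k * int m" using my(2) by (simp flip: of_nat_mult)
    then have "int \<nu> * int y \<le> int \<nu> * (int k * int m)" by (rule mult_left_mono) simp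
    also have "\<dots> = int k * (int \<nu> * int m)" by (rule mult.left_commute)
    also have "\<dots> = int \<mu> * (int k * \<xi>)" unfolding e(1)[symmetric] by (rule mult.left_commute)
    finally show ?thesis unfolding e(2) .
  qed
  then have YX: "\<eta> \<le> int k * \<xi>" using mu by simp
  show thesis
  proof (rule that[of "nat \<xi>" "nat \<eta>"])
    have "int (\<nu> * fst b) = int (nat \<xi> * fst a + nat \<eta> * fst d)" "int (\<nu> * snd b) = int (nat \<xi> * snd a + nat \<eta> * snd d)"
      using XY XY0 by simp_all
    then have "\<nu> * fst b = nat \<xi> * fst a + nat \<eta> * fst d" "\<nu> * snd b = nat \<xi> * snd a + nat \<eta> * snd d"
      by (simp_all only: of_nat_eq_iff)
    then show "nscale \<nu> b = nscale (nat \<xi>) a + nscale (nat \<eta>) d" by (simp add: nscale_def)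
    have "nat \<eta> \<le> nat (int k * \<xi>)" using YX by (rule nat_mono)
    then show "nat \<eta> \<le> k * nat \<xi>" by (simp add: nat_mult_distrib)
  qed
qed

lemma nu_b_T: "nscale \<nu> b \<in> T"
  using nu_b T_iff by metis

text \<open>
  The difference of two indices of the same element puts a multiple of \<open>b\<close> into the lattice.
\<close>

lemma index_unique:
  assumes x: "x \<in> T" "x' \<in> T" and i: "i < \<nu>" "i' < \<nu>" and eq: "x + nscale i b = x' + nscale i' b"
  shows "i = i' \<and> x = x'"
proof -
  have no: False if h: "x \<in> T" "x' \<in> T" "i < i'" "i' < \<nu>" "x + nscale i b = x' + nscale i' b" for x x' i i'
  proof -
    obtain m y where x: "x = nscale m a + nscale y d" using h(1) T_iff by blast
    obtain m' y' where x': "x' = nscale m' a + nscale y' d" using h(2) T_iff by blast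
    have "m * fst a + y * fst d + i * fst b = m' * fst a + y' * fst d + i' * fst b"
      "m * snd a + y * snd d + i * snd b = m' * snd a + y' * snd d + i' * snd b"
      using arg_cong[OF h(5), of fst] arg_cong[OF h(5), of snd] by (simp_all add: x x' nscale_def)
    then have "int (m * fst a + y * fst d + i * fst b) = int (m' * fst a + y' * fst d + i' * fst b)"
      "int (m * snd a + y * snd d + i * snd b) = int (m' * snd a + y' * snd d + i' * snd b)" by simp_all
    then have "int (i' - i) * int (fst b) = (int m - int m') * int (fst a) + (int y - int y') * int (fst d)"
      "int (i' - i) * int (snd b) = (int m - int m') * int (snd a) + (int y - int y') * int (snd d)"
      using h(3) by (simp_all add: of_nat_diff algebra_simps)
    then have "in_lattice (i' - i)" unfolding in_lattice_def by blast
    then show False using nu_least[of "i' - i"] h(3,4) by simp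
  qed
  have "\<not> i < i'" "\<not> i' < i" using no[OF x(1,2) _ i(2) eq] no[OF x(2,1) _ i(1) eq[symmetric]] by blast+
  then have "i = i'" by simp
  then show ?thesis using eq by simp
qed

subsection \<open>The basis over the two extremal generators\<close>

definition "v = a + nscale k d"
text \<open>
  For \<open>j < k\<close>, \<open>e j\<close> is the only element of the form \<open>n a + j d\<close> from which neither \<open>a\<close> nor \<open>v\<close> can be subtracted within \<open>T\<close>.
  This is \<open>0\<close>, and not \<open>a\<close>, for \<open>j = 0\<close>.
\<close>

definition e :: "nat \<Rightarrow> nat \<times> nat" where "e j = (if j = 0 then 0 else a + nscale j d)"
definition W :: "(nat \<times> nat) set" where "W = (\<lambda>(j, i). e j + nscale i b) ` ({..<k} \<times> {..<\<nu>})"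

lemma v_T: "v \<in> T" and a_T: "a \<in> T" and e_T: "j < k \<Longrightarrow> e j \<in> T"
  using gens_T[of k] gens_T[of 0] gens_T[of j] T_zero by (auto simp: v_def e_def)

lemma T_nscale: "x \<in> T \<Longrightarrow> nscale n x \<in> T"
  unfolding S_adk_def by (rule affine_nscale)

lemma T_subset_S: "x \<in> T \<Longrightarrow> x \<in> S"
  unfolding S_iff by (intro bexI[of _ x] exI[of _ 0]) simp_all

lemma nscale_v: "nscale m v = nscale m a + nscale (k * m) d"
  by (simp add: v_def nscale_def algebra_simps)

text \<open>
  The correction by \<open>1\<close> counts the copy of \<open>a\<close> that is contained in \<open>e j\<close> for \<open>j \<noteq> 0\<close>.
\<close>

lemma standard_form:
  "nscale n a + nscale m v + e j = nscale (n + m + (if j = 0 then 0 else 1)) a + nscale (k * m + j) d"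
  by (simp add: nscale_v nscale_add e_def add_ac)

lemma standard_form_unique:
  assumes "j < k" "j' < k" "nscale n a + nscale m v + e j = nscale n' a + nscale m' v + e j'"
  shows "n = n' \<and> m = m' \<and> j = j'"
proof -
  have h: "n + m + (if j = 0 then 0 else 1) = n' + m' + (if j' = 0 then 0 else 1)" "k * m + j = k * m' + j'"
    using nat_independent[OF assms(3)[unfolded standard_form]] by auto
  have "j = (k * m + j) mod k" "j' = (k * m' + j') mod k" using assms(1,2) by simp_all
  then have j: "j = j'" using h(2) by simp
  then have "k * m = k * m'" using h(2) by simp
  then have "m = m'" using k2 by simp
  then show ?thesis using h(1) j by auto
qed

lemma standard_form_exists:
  assumes "x \<in> T"
  shows "\<exists>n m j. j < k \<and> x = nscale n a + nscale m v + e j"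
proof -
  obtain M y where My: "x = nscale M a + nscale y d" "y \<le> k * M" using assms T_iff by blast
  \<comment> \<open>\<open>y\<close> copies of \<open>d\<close> are taken up by \<open>m\<close> copies of \<open>v\<close> and one \<open>e j\<close>\<close>
  define m where "m = y div k"
  define j where "j = y mod k"
  have y: "y = k * m + j" and j: "j < k" using k2 by (simp_all add: m_def j_def)
  have "m + (if j = 0 then 0 else 1) \<le> M"
  proof (cases "j = 0")
    case True
    then have "k * m \<le> k * M" using My(2) y by simp
    then show ?thesis using True k2 by simp
  next
    case False
    then have "k * m < k * M" using My(2) y by linarith
    then show ?thesis using False by simp
  qed
  then have "x = nscale (M - (m + (if j = 0 then 0 else 1))) a + nscale m v + e j"
    unfolding standard_form My(1) y by simp
  then show ?thesis using j by blast
qed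

definition coords :: "nat \<times> nat \<Rightarrow> nat \<times> nat \<times> nat \<times> nat" where
  "coords s = (THE (n, m, j, i). j < k \<and> i < \<nu> \<and> s = nscale n a + nscale m v + (e j + nscale i b))"

lemma coords_eq:
  assumes "j < k" "i < \<nu>"
  shows "coords (nscale n a + nscale m v + (e j + nscale i b)) = (n, m, j, i)"
  unfolding coords_def
proof (rule the_equality)
  fix t assume t: "case t of (n', m', j', i') \<Rightarrow> j' < k \<and> i' < \<nu> \<and>
      nscale n a + nscale m v + (e j + nscale i b) = nscale n' a + nscale m' v + (e j' + nscale i' b)"
  obtain n' m' j' i' where tt: "t = (n', m', j', i')" by (cases t) auto
  have h: "j' < k" "i' < \<nu>" "(nscale n a + nscale m v + e j) + nscale i b = (nscale n' a + nscale m' v + e j') + nscale i' b"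
    using t unfolding tt by (simp_all add: add.assoc)
  have T: "nscale n a + nscale m v + e j \<in> T" if "j < k" for n m j
    using that by (intro T_add T_nscale a_T v_T e_T)
  show "t = (n, m, j, i)"
    using index_unique[OF T[OF assms(1)] T[OF h(1)] assms(2) h(2,3)] standard_form_unique[OF assms(1) h(1)]
    unfolding tt by auto
qed (use assms in simp)

lemma S_coords:
  assumes "s \<in> S"
  obtains n m j i where "j < k" "i < \<nu>" "s = nscale n a + nscale m v + (e j + nscale i b)"
proof -
  obtain x i where x: "x \<in> T" "s = x + nscale i b" using assms S_iff by blast
  have "nscale i b = nscale (i div \<nu>) (nscale \<nu> b) + nscale (i mod \<nu>) b"
  proof -
    have "nscale i b = nscale ((i div \<nu>) * \<nu> + i mod \<nu>) b" by simp
    then show ?thesis by (simp only: nscale_add) (simp add: nscale_def mult_ac)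
  qed
  then have s: "s = (x + nscale (i div \<nu>) (nscale \<nu> b)) + nscale (i mod \<nu>) b" using x(2) by (simp add: add.assoc)
  have "x + nscale (i div \<nu>) (nscale \<nu> b) \<in> T" by (rule T_add[OF x(1) T_nscale[OF nu_b_T]])
  then obtain n m j where "j < k" "x + nscale (i div \<nu>) (nscale \<nu> b) = nscale n a + nscale m v + e j"
    using standard_form_exists by blast
  then show thesis using that[of j "i mod \<nu>" n m] s nu(1) by (simp add: add.assoc)
qed

definition "\<alpha> s = fst (coords s)"
definition "\<beta> s = fst (snd (coords s))"
definition "\<omega> s = (case coords s of (n, m, j, i) \<Rightarrow> e j + nscale i b)"

lemma W_I: "j < k \<Longrightarrow> i < \<nu> \<Longrightarrow> e j + nscale i b \<in> W"
  unfolding W_def by (rule image_eqI[of _ _ "(j, i)"]) auto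

lemma W_E:
  assumes "w \<in> W"
  obtains j i where "j < k" "i < \<nu>" "w = e j + nscale i b"
  using assms unfolding W_def by auto

lemma coords_W: "j < k \<Longrightarrow> i < \<nu> \<Longrightarrow> coords (e j + nscale i b) = (0, 0, j, i)"
  using coords_eq[of j i 0 0] by simp

lemma free: "free_plane_monoid S a v W \<alpha> \<beta> \<omega>"
proof unfold_locales
  show "0 \<in> S" by (rule S_zero)
  show "x \<in> S \<Longrightarrow> y \<in> S \<Longrightarrow> x + y \<in> S" for x y by (rule S_add)
  show "finite W" by (simp add: W_def)
  show "0 \<in> W" using W_I[of 0 0] k2 nu(1) by (simp add: e_def)
  fix w n m assume "w \<in> W"
  then obtain j i where w: "j < k" "i < \<nu>" "w = e j + nscale i b" by (rule W_E)
  have "nscale n a + nscale m v + e j \<in> T" using w(1) by (intro T_add T_nscale a_T v_T e_T)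
  moreover have "nscale n a + nscale m v + w = (nscale n a + nscale m v + e j) + nscale i b"
    by (simp add: w(3) add.assoc)
  ultimately have "nscale n a + nscale m v + w \<in> S" unfolding S_iff by blast
  then show "nscale n a + nscale m v + w \<in> S \<and> \<alpha> (nscale n a + nscale m v + w) = n \<and>
      \<beta> (nscale n a + nscale m v + w) = m \<and> \<omega> (nscale n a + nscale m v + w) = w"
    using coords_eq[OF w(1,2), of n m] by (simp add: w(3) \<alpha>_def \<beta>_def \<omega>_def)
next
  fix s assume "s \<in> S"
  then obtain n m j i where s: "j < k" "i < \<nu>" "s = nscale n a + nscale m v + (e j + nscale i b)" by (rule S_coords)
  then show "\<omega> s \<in> W \<and> s = nscale (\<alpha> s) a + nscale (\<beta> s) v + \<omega> s"
    using coords_eq[OF s(1,2), of n m] W_I by (simp add: \<alpha>_def \<beta>_def \<omega>_def)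
qed

lemma e_inj: "\<lbrakk>j < k; j' < k; i < \<nu>; i' < \<nu>; e j + nscale i b = e j' + nscale i' b\<rbrakk> \<Longrightarrow> j = j' \<and> i = i'"
proof -
  assume h: "j < k" "j' < k" "i < \<nu>" "i' < \<nu>" and eq: "e j + nscale i b = e j' + nscale i' b"
  have "(0::nat, 0::nat, j, i) = (0, 0, j', i')"
    by (rule trans[OF coords_W[OF h(1,3), symmetric] trans[OF arg_cong[OF eq, of coords] coords_W[OF h(2,4)]]])
  then show ?thesis by simp
qed

text \<open>
  The socle monomials: \<open>(a + j d) + (\<nu> - 1) b\<close> with \<open>0 < j < k\<close>. Adding a generator of the arithmetic sequence
  or \<open>b\<close> produces a summand \<open>a\<close> or \<open>a + k d\<close>. For the other elements of the basis,
  \<open>b\<close> or \<open>a + d\<close> does not.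
\<close>

lemma socle_monomials:
  "bij_betw (\<lambda>j. e (Suc j) + nscale (\<nu> - 1) b) {..<k - 1} {w \<in> W. \<forall>s\<in>S - {0}. w + s \<notin> W}"
proof -
  interpret F: free_plane_monoid S "TYPE(rat)" a v W \<alpha> \<beta> \<omega> by (rule free)
  have k1: "1 < k" using k2 by simp
  have b0: "b \<noteq> 0" using b_notin T_zero by blast
  have e1: "e 1 \<noteq> 0"
  proof
    assume "e 1 = 0"
    then have "e 1 + nscale 0 b = e 0 + nscale 0 b" by (simp add: e_def)
    from e_inj[OF k1 _ nu(1) nu(1) this] k1 show False by simp
  qed
  have bS: "b \<in> S" unfolding S_iff by (intro bexI[OF _ T_zero] exI[of _ 1]) simp
  \<comment> \<open>the sum of an inner generator and any generator contains an extremal one\<close>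
  have two: "\<exists>t\<in>T. e j + (a + nscale l d) = a + t \<or> e j + (a + nscale l d) = v + t" if "0 < j" "j < k" "l \<le> k" for j l
  proof (cases "k \<le> j + l")
    case True
    have "nscale j d + nscale l d = nscale k d + nscale (j + l - k) d"
      using True by (simp flip: nscale_add)
    then have "(a + nscale j d) + (a + nscale l d) = (a + nscale k d) + (a + nscale (j + l - k) d)"
      by (simp only: add_ac)
    then have "e j + (a + nscale l d) = v + (a + nscale (j + l - k) d)"
      using that(1) by (simp add: e_def v_def)
    moreover have "a + nscale (j + l - k) d \<in> T" using that by (intro gens_T) simp
    ultimately show ?thesis by blast
  next
    case False
    have "e j + (a + nscale l d) = a + (a + nscale (j + l) d)"
      using that by (simp add: e_def nscale_add add_ac)
    moreover have "a + nscale (j + l) d \<in> T" using False by (intro gens_T) simp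
    ultimately show ?thesis by blast
  qed
  have notW: "e j + (a + nscale l d) + s \<notin> W" if h: "0 < j" "j < k" "l \<le> k" "s \<in> S" for j l s
  proof -
    obtain t where t: "t \<in> T" "e j + (a + nscale l d) = a + t \<or> e j + (a + nscale l d) = v + t" using two[OF h(1-3)] by blast
    have "t + s \<in> S" using T_subset_S[OF t(1)] h(4) by (rule S_add)
    moreover have "e j + (a + nscale l d) + s = a + (t + s) \<or> e j + (a + nscale l d) + s = v + (t + s)"
      using t(2) by (elim disjE) (simp_all only: add.assoc simp_thms)
    ultimately show ?thesis using F.uv_plus_not_W[of "t + s"] by (elim disjE) simp_all
  qed
  have gen: "\<exists>l\<le>k. \<exists>y\<in>T. x = (a + nscale l d) + y" if "x \<in> T" "x \<noteq> 0" for x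
  proof -
    have "x = 0 \<or> (\<exists>l\<le>k. \<exists>y\<in>T. x = (a + nscale l d) + y)"
      using that(1) unfolding S_adk_def
      by (induction rule: affine_induct[OF finite_gens, consumes 1, case_names zero add]) (auto simp: arith_gens_def)
    then show ?thesis using that(2) by blast
  qed
  have nS: "nscale n b \<in> S" for n unfolding S_iff by (intro bexI[OF _ T_zero] exI[of _ n]) simp
  have in_socle: "e j + nscale (\<nu> - 1) b + s \<notin> W" if j: "0 < j" "j < k" and s: "s \<in> S" "s \<noteq> 0" for j s
  proof -
    obtain x i where x: "x \<in> T" "s = x + nscale i b" using s(1) S_iff by blast
    show ?thesis
    proof (cases "x = 0")
      case False
      then obtain l y where y: "l \<le> k" "y \<in> T" "x = (a + nscale l d) + y" using gen x(1) by blast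
      have "e j + nscale (\<nu> - 1) b + s = e j + (a + nscale l d) + (y + nscale i b + nscale (\<nu> - 1) b)"
        unfolding x(2) y(3) by (simp add: add_ac)
      moreover have "y + nscale i b + nscale (\<nu> - 1) b \<in> S" by (intro S_add nS T_subset_S y(2))
      ultimately show ?thesis using notW[OF j y(1)] by simp
    next
      case True
      then obtain i' where i': "i = Suc i'" using s(2) x(2) by (cases i) auto
      have "nscale \<nu> b \<noteq> 0" using b0 nu(1) by (cases b) (auto simp: nscale_def zero_prod_def)
      then obtain l y where y: "l \<le> k" "y \<in> T" "nscale \<nu> b = (a + nscale l d) + y" using gen nu_b_T by blast
      have "nscale (\<nu> - 1) b + b = nscale \<nu> b" using nu(1) by (cases \<nu>) (simp_all add: add.commute)
      then have "nscale \<nu> b = nscale (\<nu> - 1) b + b" by (rule sym)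
      then have "e j + nscale (\<nu> - 1) b + s = e j + nscale \<nu> b + nscale i' b"
        unfolding x(2) True i' by (elim ssubst) (simp add: add_ac)
      also have "\<dots> = e j + (a + nscale l d) + (y + nscale i' b)" unfolding y(3) by (simp add: add_ac)
      finally show ?thesis using notW[OF j y(1), of "y + nscale i' b"] S_add[OF T_subset_S[OF y(2)] nS] by simp
    qed
  qed
  have "{w \<in> W. \<forall>s\<in>S - {0}. w + s \<notin> W} = (\<lambda>j. e (Suc j) + nscale (\<nu> - 1) b) ` {..<k - 1}"
  proof (intro equalityI subsetI)
    fix w assume "w \<in> (\<lambda>j. e (Suc j) + nscale (\<nu> - 1) b) ` {..<k - 1}"
    then obtain j where j: "j < k - 1" "w = e (Suc j) + nscale (\<nu> - 1) b" by auto
    then show "w \<in> {w \<in> W. \<forall>s\<in>S - {0}. w + s \<notin> W}" using W_I[of "Suc j" "\<nu> - 1"] in_socle[of "Suc j"] nu(1) by auto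
  next
    fix w assume w: "w \<in> {w \<in> W. \<forall>s\<in>S - {0}. w + s \<notin> W}"
    then have "w \<in> W" by simp
    then obtain j i where ji: "j < k" "i < \<nu>" "w = e j + nscale i b" by (rule W_E)
    have i: "i = \<nu> - 1"
    proof (rule ccontr)
      assume "i \<noteq> \<nu> - 1"
      then have "e j + nscale (Suc i) b \<in> W" using ji by (intro W_I) auto
      then have "w + b \<in> W" by (simp add: ji(3) add_ac)
      then show False using w bS b0 by blast
    qed
    have "j \<noteq> 0"
    proof
      assume "j = 0"
      then have "w + e 1 = e 1 + nscale i b" by (simp add: ji(3) e_def add.commute)
      then have "w + e 1 \<in> W" using W_I[OF k1 ji(2)] by simp
      moreover have "e 1 \<in> S - {0}" using T_subset_S[OF e_T[OF k1]] e1 by simp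
      ultimately show False using w by blast
    qed
    then obtain j' where "j = Suc j'" using not0_implies_Suc by blast
    then show "w \<in> (\<lambda>j. e (Suc j) + nscale (\<nu> - 1) b) ` {..<k - 1}" using ji i by auto
  qed
  moreover have "inj_on (\<lambda>j. e (Suc j) + nscale (\<nu> - 1) b) {..<k - 1}"
  proof (rule inj_onI)
    fix j j' assume h: "j \<in> {..<k - 1}" "j' \<in> {..<k - 1}"
      and eq: "e (Suc j) + nscale (\<nu> - 1) b = e (Suc j') + nscale (\<nu> - 1) b"
    have lt: "Suc j < k" "Suc j' < k" "\<nu> - 1 < \<nu>" using h nu(1) by auto
    show "j = j'" using e_inj[OF lt(1,2,3,3) eq] by simp
  qed
  ultimately show ?thesis by (simp add: bij_betw_def)
qed

text \<open>
  For \<open>k = 2\<close> the basis consists of \<open>i b\<close> and \<open>(a + d) + i b\<close> with \<open>i < \<nu>\<close>, and \<open>e j + i b \<mapsto> e (1 - j) + (\<nu> - 1 - i) b\<close> is a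
  duality on it with top element \<open>(a + d) + (\<nu> - 1) b\<close>. The rank orders the pairs \<open>(i, j)\<close> lexicographically.
\<close>

lemma gorenstein_of_k2:
  assumes k: "k = 2"
  shows "gorenstein (semigroup_ring S :: 'k::field bipoly ring)"
proof -
  interpret F: free_plane_monoid S "TYPE('k)" a v W \<alpha> \<beta> \<omega> by (rule free)
  have k0: "0 < k" and k1: "1 < k" and nu1: "\<nu> - 1 < \<nu>" using k nu(1) by auto
  define \<delta> where "\<delta> = (\<lambda>w. case coords w of (n, m, j, i) \<Rightarrow> e (1 - j) + nscale (\<nu> - 1 - i) b)"
  define rank where "rank = (\<lambda>w. case coords w of (n, m, j, i) \<Rightarrow> 2 * i + j)"
  have dl: "\<delta> (e j + nscale i b) = e (1 - j) + nscale (\<nu> - 1 - i) b" "rank (e j + nscale i b) = 2 * i + j"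
    if "j < k" "i < \<nu>" for j i using coords_W[OF that] by (simp_all add: \<delta>_def rank_def)
  have om: "\<exists>j<k. \<omega> (x + nscale i b) = e j + nscale i b" if x: "x \<in> T" and i: "i < \<nu>" for x i
  proof -
    obtain n m j where j: "j < k" "x = nscale n a + nscale m v + e j" using standard_form_exists[OF x] by blast
    have "\<omega> (x + nscale i b) = e j + nscale i b"
      using coords_eq[OF j(1) i, of n m] unfolding \<omega>_def j(2) by (simp add: add.assoc)
    then show ?thesis using j(1) by blast
  qed
  show ?thesis
  proof (rule F.gorenstein_KS[of \<delta> "e 1 + nscale (\<nu> - 1) b" rank])
    show "e 1 + nscale (\<nu> - 1) b \<in> W" using k nu(1) by (intro W_I) auto
    fix w assume "w \<in> W"
    then obtain j i where w: "j < k" "i < \<nu>" "w = e j + nscale i b" by (rule W_E)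
    have "e (1 - j) + e j = e 1" using w(1) k by (cases "j = 0") (auto simp: e_def less_Suc_eq numeral_2_eq_2)
    moreover have "nscale (\<nu> - 1 - i) b + nscale i b = nscale (\<nu> - 1) b" using w(2) by (simp flip: nscale_add)
    ultimately have "\<delta> w + w = e 1 + nscale (\<nu> - 1) b"
      unfolding w(3) dl(1)[OF w(1,2)] by (metis (no_types, lifting) add.assoc add.left_commute)
    moreover have "\<delta> w \<in> W" unfolding w(3) dl(1)[OF w(1,2)] using w k by (intro W_I) auto
    ultimately show "\<delta> w \<in> W \<and> \<delta> w + w = e 1 + nscale (\<nu> - 1) b" by blast
    fix w' assume "w' \<in> W" and top: "\<omega> (\<delta> w + w') = e 1 + nscale (\<nu> - 1) b"
    then obtain j' i' where w': "j' < k" "i' < \<nu>" "w' = e j' + nscale i' b" by (elim W_E)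
    have sum: "\<delta> w + w' = (e (1 - j) + e j') + nscale (\<nu> - 1 - i + i') b"
      unfolding w(3) w'(3) dl(1)[OF w(1,2)] by (simp add: nscale_add add_ac)
    have eT: "e (1 - j) + e j' \<in> T" using w(1) w'(1) k by (intro T_add e_T) auto
    \<comment> \<open>for \<open>i' < i\<close> the multiple of \<open>b\<close> in the sum stays below \<open>\<nu> - 1\<close>, so the top element cannot be reached\<close>
    have "i \<le> i'"
    proof (rule ccontr)
      assume "\<not> i \<le> i'"
      then have lt: "\<nu> - 1 - i + i' < \<nu>" "\<nu> - 1 - i + i' \<noteq> \<nu> - 1" using w(2) by auto
      obtain j0 where j0: "j0 < k" "\<omega> (\<delta> w + w') = e j0 + nscale (\<nu> - 1 - i + i') b"
        using om[OF eT lt(1)] unfolding sum by blast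
      have "e j0 + nscale (\<nu> - 1 - i + i') b = e 1 + nscale (\<nu> - 1) b" by (rule trans[OF j0(2)[symmetric] top])
      then have "\<nu> - 1 - i + i' = \<nu> - 1" by (rule e_inj[OF j0(1) k1 lt(1) nu1, THEN conjunct2])
      then show False using lt(2) by contradiction
    qed
    moreover have "j \<le> j'" if "i = i'"
    proof (rule ccontr)
      assume "\<not> j \<le> j'"
      then have j: "j = 1" "j' = 0" using w(1) w'(1) k by auto
      have "\<delta> w + w' = e 0 + nscale (\<nu> - 1) b" unfolding sum j using that w(2) by (simp add: e_def)
      moreover have "\<omega> (e 0 + nscale (\<nu> - 1) b) = e 0 + nscale (\<nu> - 1) b"
        unfolding \<omega>_def coords_W[OF k0 nu1] by simp
      ultimately have "e 0 + nscale (\<nu> - 1) b = e 1 + nscale (\<nu> - 1) b" using top by simp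
      then have "(0::nat) = 1" by (rule e_inj[OF k0 k1 nu1 nu1, THEN conjunct1])
      then show False by simp
    qed
    ultimately consider "i < i'" | "i = i'" "j < j'" | "i = i'" "j = j'" by linarith
    then show "w' = w \<or> rank w < rank w'"
      unfolding w(3) w'(3) dl(2)[OF w(1,2)] dl(2)[OF w'(1,2)] using w(1) k by cases auto
  qed
qed

end

theorem corollary7p5:
  fixes a d b :: "nat \<times> nat" and k \<mu> :: nat and l :: "nat \<Rightarrow> nat"
  assumes "k \<ge> 2"
    and "lin_indep_rat a d"
    and "minimal_generating_set (arith_gens a d k) (S_adk a d k)"
    and "b \<notin> S_adk a d k"
    and "\<mu> > 0"
    and "nscale \<mu> b \<in> S_adk a d k"
    and "nscale \<mu> b = (\<Sum>i=1..k+1. nscale (l i) (a + nscale (i - 1) d))"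
    and "l 1 \<noteq> 0 \<or> l (k + 1) \<noteq> 0"
  shows "cohen_macaulay (semigroup_ring (S_adkb a d k b) :: ((nat \<times> nat) \<Rightarrow>\<^sub>0 'k::field) ring) \<and>
         semigroup_ring_type TYPE('k) (S_adkb a d k b) = k - 1 \<and>
         (gorenstein (semigroup_ring (S_adkb a d k b) :: ((nat \<times> nat) \<Rightarrow>\<^sub>0 'k) ring) \<longleftrightarrow> k = 2)"
proof -
  interpret E: arithmetic_extension a d b k \<mu> by unfold_locales (use assms in auto)
  interpret F: free_plane_monoid "S_adkb a d k b" "TYPE('k)" a E.v E.W E.\<alpha> E.\<beta> E.\<omega> by (rule E.free)
  have type: "semigroup_ring_type TYPE('k) (S_adkb a d k b) = k - 1"
    by (rule F.semigroup_ring_type_eq[OF E.socle_monomials])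
  have "k = 2" if g: "gorenstein (semigroup_ring (S_adkb a d k b) :: 'k bipoly ring)"
  proof -
    have "gorenstein_local (localization (semigroup_ring (S_adkb a d k b) :: 'k bipoly ring) F.M0)"
      using g F.maximal_M0 unfolding gorenstein_def by blast
    then have "semigroup_ring_type TYPE('k) (S_adkb a d k b) = 1"
      unfolding gorenstein_local_def semigroup_ring_type_def F.monomial_max_ideal_eq by blast
    then show ?thesis using type assms(1) by simp
  qed
  then show ?thesis using F.cohen_macaulay_KS type E.gorenstein_of_k2 by blast
qed

end
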